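(* Let $f:\mathbb{P}^1\to\mathbb{P}^1$ be an endomorphism over $\mathbb{C}$ of degree at least $2$. Let $o$ be a repelling fixed point of $f$ with $df(o)=\lambda$. Let $(o_i)_{i\ge0}$ be a homoclinic orbit of $f$ at $o$ such that $o_i\notin C(f)$ for every $i\ge0$. Assume that there is $C\in\mathbb{C}^*$ such that for one (hence every) adjoint sequence $(q_i)_{i\ge0}$ of $(o_i)_{i\ge0}$ we have $df^i(q_i)=C\lambda^i$ for all $i$ large. Then $f$ is exceptional.
   Context: $C(f)$ is the set of critical points of $f$; $\mathbb{D}$ is the open unit disk in $\mathbb{C}$; $df^i(q)$ denotes the derivative of $f^i$ at a point $q$ fixed by $f^i$ (its multiplier). $\mathbb{P}^1(\mathbb{C})$ carries the complex topology. Homoclinic orbit: for a repelling fixed point $o$ of $f$ (i.e. $|df(o)|>1$), a homoclinic orbit of $f$ at $o$ is a sequence of points $(o_i)_{i\ge0}$ with $o_0=o$, $o_1\ne o$, $f(o_i)=o_{i-1}$ for $i\ge1$, and $\lim_{i\to\infty}o_i=o$. Linearization domain: an open neighborhood $U$ of $o$ such that there is an isomorphism $\phi:U\to\mathbb{D}$ with $\phi(o)=0$ conjugating $f|_{U_0}:U_0\to U$ to $z\mapsto\lambda z$, where $U_0=f^{-1}(U)\cap U$ and $\lambda=df(o)$. Good return time: let $U$ be a connected open neighborhood of $o$ contained in a linearization domain. For $i\ge0$ let $U_i$ be the connected component of $f^{-i}(U)$ containing $o_i$. An integer $m\ge1$ is a good return time for the homoclinic orbit and $U$ if (i) $o_i\in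 U$ for every $i\ge m$, and (ii) $U_m\subset\subset U$ (relatively compact) and $f^m:U_m\to U$ is an isomorphism. If $U$ is a linearization domain and $m$ is a good return time, then every $i\ge m$ is also a good return time. Adjoint sequence: let $U$ be a linearization domain and $m$ a good return time of $U$ for $(o_i)$. For $i\ge m$, $(f^i|_{U_i})^{-1}:U\to U_i$ has a unique fixed point $q_i\in U_i$, which is the unique fixed point of $f^i$ in $U_i$. The sequence $(q_i)_{i\ge m}$ is called the adjoint sequence with respect to $(U,m)$. A sequence of points $(q_i)_{i\ge0}$ is an adjoint sequence of $(o_i)_{i\ge0}$ if $(q_i)_{i\ge m}$ is the adjoint sequence with respect to some such $(U,m)$. (When $o_i\notin C(f)$ for all $i\ge 1$ adjoint sequences exist, and any two coincide for large indices.) Exceptional maps: an endomorphism $f$ of $\mathbb{P}^1$ over $\mathbb{C}$ of degree at least $2$ is Lattès if there are an elliptic curve $E$, a morphism $g:E\to E$ and a non-constant morphism $\pi:E\to\mathbb{P}^1$ with $f\circ\pi=\pi\circ g$. It is of monomial type if there are an integer $k$ with $|k|\ge2$ and a non-constant morphism $\pi:\mathbb{P}^1\to\mathbb{P}^1$ with $f(\pi(z))=\pi(z^k)$. It is exceptional if it is Lattès or of monomial type. *)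

theory Defs
  imports "HOL-Analysis.Complex_Analysis_Basics" "HOL-Analysis.Cartesian_Euclidean_Space"
begin

section \<open>Complex projective space\<close>

text \<open>A point of \<open>'n cproj\<close> is a line through the origin of \<open>complex ^ 'n\<close>, so \<open>2 cproj\<close> is the
  projective line and \<open>3 cproj\<close> the projective plane over the complex numbers.\<close>

typedef ('n::finite) cproj = "{range (\<lambda>c. c *s v) | v :: complex ^ 'n. v \<noteq> 0}"
proof -
  have "(1 :: complex ^ 'n) \<noteq> 0"
    by (simp add: vec_eq_iff)
  then show ?thesis by blast
qed

definition pt :: "complex ^ 'n::finite \<Rightarrow> 'n cproj" where
  "pt v = Abs_cproj (range (\<lambda>c. c *s v))"

lemma pt_eq_iff:
  fixes v w :: "complex ^ 'n::finite"
  assumes "v \<noteq> 0" "w \<noteq> 0"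
  shows "pt v = pt w \<longleftrightarrow> (\<exists>c. c \<noteq> 0 \<and> v = c *s w)"
proof -
  have "pt v = pt w \<longleftrightarrow> range (\<lambda>c. c *s v) = range (\<lambda>c. c *s w)"
    unfolding pt_def using assms by (intro Abs_cproj_inject) blast+
  also have "\<dots> \<longleftrightarrow> (\<exists>c. c \<noteq> 0 \<and> v = c *s w)"
  proof
    assume "range (\<lambda>c. c *s v) = range (\<lambda>c. c *s w)"
    moreover have "v \<in> range (\<lambda>c. c *s v)"
      by (rule range_eqI[of _ _ 1]) simp
    ultimately obtain c where "v = c *s w" by auto
    moreover from this \<open>v \<noteq> 0\<close> have "c \<noteq> 0" by auto
    ultimately show "\<exists>c. c \<noteq> 0 \<and> v = c *s w" by blast
  next
    assume "\<exists>c. c \<noteq> 0 \<and> v = c *s w"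
    then obtain c where c: "c \<noteq> 0" "v = c *s w" by blast
    have "a *s v = (a * c) *s w" "a *s w = (a / c) *s v" for a
      using c by (simp_all add: vector_smult_assoc)
    then have "a *s v \<in> range (\<lambda>c. c *s w)" "a *s w \<in> range (\<lambda>c. c *s v)" for a
      by (metis rangeI)+
    then show "range (\<lambda>c. c *s v) = range (\<lambda>c. c *s w)"
      by (intro subset_antisym image_subsetI)
  qed
  finally show ?thesis .
qed

lemma pt_surj: "\<exists>v. v \<noteq> 0 \<and> p = pt v"
  by (cases p) (auto simp: pt_def)

text \<open>The complex topology is the quotient topology from the punctured vector space.\<close>

instantiation cproj :: (finite) topological_space
begin

definition open_cproj :: "'a cproj set \<Rightarrow> bool" where
  "open_cproj S \<longleftrightarrow> open {v :: complex ^ 'a. v \<noteq> 0 \<and> pt v \<in> S}"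

instance
proof
  have "{v :: complex ^ 'a. v \<noteq> 0 \<and> pt v \<in> UNIV} = - {0}" by auto
  then show "open (UNIV :: 'a cproj set)"
    unfolding open_cproj_def by (metis open_delete open_UNIV Compl_eq_Diff_UNIV)
next
  fix S T :: "'a cproj set"
  assume "open S" "open T"
  then have "open ({v :: complex ^ 'a. v \<noteq> 0 \<and> pt v \<in> S} \<inter> {v. v \<noteq> 0 \<and> pt v \<in> T})"
    unfolding open_cproj_def by (rule open_Int)
  also have "{v :: complex ^ 'a. v \<noteq> 0 \<and> pt v \<in> S} \<inter> {v. v \<noteq> 0 \<and> pt v \<in> T} =
      {v. v \<noteq> 0 \<and> pt v \<in> S \<inter> T}" by blast
  finally show "open (S \<inter> T)"
    unfolding open_cproj_def .
next
  fix K :: "'a cproj set set"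
  assume "\<forall>S\<in>K. open S"
  then have "open (\<Union>S\<in>K. {v :: complex ^ 'a. v \<noteq> 0 \<and> pt v \<in> S})"
    unfolding open_cproj_def by (rule open_UN)
  also have "(\<Union>S\<in>K. {v :: complex ^ 'a. v \<noteq> 0 \<and> pt v \<in> S}) =
      {v. v \<noteq> 0 \<and> pt v \<in> \<Union>K}" by blast
  finally show "open (\<Union>K)"
    unfolding open_cproj_def .
qed

end


section \<open>Morphisms of projective varieties\<close>

definition hom_poly :: "nat \<Rightarrow> (complex ^ 'n::finite \<Rightarrow> complex) \<Rightarrow> bool" where
  "hom_poly d F \<longleftrightarrow> (\<exists>c :: ('n \<Rightarrow> nat) \<Rightarrow> complex. \<forall>v.
     F v = (\<Sum>\<alpha> | (\<Sum>i\<in>UNIV. \<alpha> i) = d. c \<alpha> * (\<Prod>i\<in>UNIV. (v $ i) ^ \<alpha> i)))"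

text \<open>The sum in \<^const>\<open>hom_poly\<close> is a finite one.\<close>

lemma finite_exponents: "finite {\<alpha> :: 'n::finite \<Rightarrow> nat. (\<Sum>i\<in>UNIV. \<alpha> i) = d}"
proof (rule finite_subset)
  show "{\<alpha> :: 'n \<Rightarrow> nat. (\<Sum>i\<in>UNIV. \<alpha> i) = d} \<subseteq> UNIV \<rightarrow>\<^sub>E {..d}"
    by (auto simp: PiE_def extensional_def intro: member_le_sum)
  show "finite ((UNIV :: 'n set) \<rightarrow>\<^sub>E {..d})"
    by (intro finite_PiE) auto
qed

text \<open>A map between projective varieties \<open>X\<close> and \<open>Y\<close> is a morphism if it is given, Zariski-locally
  around every point, by homogeneous polynomials of a common degree without common zero.
  It is enough to ask that the polynomials do not all vanish at the point and represent the map
  wherever they do not all vanish: from a representation on a smaller neighbourhood, the complement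
  in \<open>X\<close> of a hypersurface \<open>H = 0\<close>, one obtains this by multiplying all polynomials by \<open>H\<close>.\<close>

definition morphism :: "'n::finite cproj set \<Rightarrow> 'm::finite cproj set \<Rightarrow> ('n cproj \<Rightarrow> 'm cproj) \<Rightarrow> bool" where
  "morphism X Y f \<longleftrightarrow> f ` X \<subseteq> Y \<and>
     (\<forall>x\<in>X. \<exists>d (F :: complex ^ 'n \<Rightarrow> complex ^ 'm).
        (\<forall>j. hom_poly d (\<lambda>v. F v $ j)) \<and>
        (\<exists>v. v \<noteq> 0 \<and> pt v = x \<and> F v \<noteq> 0) \<and>
        (\<forall>v. v \<noteq> 0 \<and> pt v \<in> X \<and> F v \<noteq> 0 \<longrightarrow> f (pt v) = pt (F v)))"

type_synonym P1 = "2 cproj"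

definition endomorphism_of_degree :: "nat \<Rightarrow> (P1 \<Rightarrow> P1) \<Rightarrow> bool" where
  "endomorphism_of_degree d f \<longleftrightarrow>
     (\<exists>F :: complex ^ 2 \<Rightarrow> complex ^ 2. (\<forall>j. hom_poly d (\<lambda>v. F v $ j)) \<and>
        (\<forall>v. v \<noteq> 0 \<longrightarrow> F v \<noteq> 0 \<and> f (pt v) = pt (F v)))"


section \<open>The complex structure of the projective line\<close>

definition affine0 :: "complex \<Rightarrow> P1" where
  "affine0 z = pt (vector [z, 1])"

definition affine1 :: "complex \<Rightarrow> P1" where
  "affine1 z = pt (vector [1, z])"

lemma inj_affine0: "inj affine0" and inj_affine1: "inj affine1"
  and affine0_Un_affine1: "range affine0 \<union> range affine1 = UNIV"
proof -
  have nz: "(vector [z, 1] :: complex ^ 2) \<noteq> 0" "(vector [1, z] :: complex ^ 2) \<noteq> 0" for z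
    by (auto simp: vec_eq_iff forall_2)
  show "inj affine0" "inj affine1"
    by (auto simp: inj_def affine0_def affine1_def pt_eq_iff nz vec_eq_iff forall_2)
  have "p \<in> range affine0 \<union> range affine1" for p :: P1
  proof -
    obtain v where v: "v \<noteq> 0" "p = pt v" using pt_surj by blast
    show ?thesis
    proof (cases "v $ 2 = 0")
      case False
      then have "pt v = pt (vector [v $ 1 / v $ 2, 1])"
        using v nz by (auto simp: pt_eq_iff vec_eq_iff forall_2 intro!: exI[of _ "v $ 2"])
      then show ?thesis using v by (auto simp: affine0_def)
    next
      case True
      then have "v $ 1 \<noteq> 0" using v by (auto simp: vec_eq_iff forall_2)
      then have "pt v = pt (vector [1, v $ 2 / v $ 1])"
        using v nz by (auto simp: pt_eq_iff vec_eq_iff forall_2 intro!: exI[of _ "v $ 1"])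
      then show ?thesis using v by (auto simp: affine1_def)
    qed
  qed
  then show "range affine0 \<union> range affine1 = UNIV" by blast
qed

definition chart_at :: "P1 \<Rightarrow> complex \<Rightarrow> P1" where
  "chart_at x = (if x \<in> range affine0 then affine0 else affine1)"

definition coord :: "P1 \<Rightarrow> P1 \<Rightarrow> complex" where
  "coord x = inv (chart_at x)"

text \<open>The map \<open>f\<close> near \<open>x\<close>, read in charts at \<open>x\<close> and at \<open>f x\<close>. Its values at arguments that \<open>f\<close>
  sends outside the chart at \<open>f x\<close> are irrelevant: for \<open>f\<close> continuous at \<open>x\<close> there are none close
  to \<open>coord x x\<close>.\<close>

definition local_rep :: "(P1 \<Rightarrow> P1) \<Rightarrow> P1 \<Rightarrow> complex \<Rightarrow> complex" where
  "local_rep f x = coord (f x) \<circ> f \<circ> chart_at x"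

text \<open>If \<open>f x = x\<close>, the same chart is used on both sides, so that this is the multiplier of \<open>f\<close> at \<open>x\<close>.
  In general only its vanishing has an intrinsic meaning.\<close>

definition P1_deriv :: "(P1 \<Rightarrow> P1) \<Rightarrow> P1 \<Rightarrow> complex" where
  "P1_deriv f x = deriv (local_rep f x) (coord x x)"

definition critical_points :: "(P1 \<Rightarrow> P1) \<Rightarrow> P1 set" where
  "critical_points f = {x. P1_deriv f x = 0}"

definition P1_holomorphic_on :: "(P1 \<Rightarrow> P1) \<Rightarrow> P1 set \<Rightarrow> bool" where
  "P1_holomorphic_on f U \<longleftrightarrow> open U \<and> continuous_on U f \<and>
     (\<forall>x\<in>U. local_rep f x field_differentiable at (coord x x))"

definition P1_isomorphism :: "(P1 \<Rightarrow> P1) \<Rightarrow> P1 set \<Rightarrow> P1 set \<Rightarrow> bool" where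
  "P1_isomorphism f U V \<longleftrightarrow> bij_betw f U V \<and>
     P1_holomorphic_on f U \<and> P1_holomorphic_on (inv_into U f) V"


section \<open>Homoclinic orbits and adjoint sequences\<close>

definition repelling_fixed_point :: "(P1 \<Rightarrow> P1) \<Rightarrow> P1 \<Rightarrow> bool" where
  "repelling_fixed_point f p \<longleftrightarrow> f p = p \<and> norm (P1_deriv f p) > 1"

definition homoclinic_orbit :: "(P1 \<Rightarrow> P1) \<Rightarrow> P1 \<Rightarrow> (nat \<Rightarrow> P1) \<Rightarrow> bool" where
  "homoclinic_orbit f p x \<longleftrightarrow> repelling_fixed_point f p \<and>
     x 0 = p \<and> x 1 \<noteq> p \<and> (\<forall>i\<ge>1. f (x i) = x (i - 1)) \<and> x \<longlonglongrightarrow> p"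

text \<open>The unit disk is regarded as a subset of the projective line by means of \<^const>\<open>affine0\<close>.
  On \<open>U0\<close>, the part of \<open>U\<close> that \<open>f\<close> maps into \<open>U\<close>, the map \<open>f\<close> is conjugate to multiplication by
  the multiplier, from the disk of radius \<open>1 / \<bar>multiplier\<bar>\<close> to the unit disk.\<close>

definition linearization_domain :: "(P1 \<Rightarrow> P1) \<Rightarrow> P1 \<Rightarrow> P1 set \<Rightarrow> bool" where
  "linearization_domain f p U \<longleftrightarrow> open U \<and> p \<in> U \<and>
     (\<exists>\<phi> :: P1 \<Rightarrow> complex.
        P1_isomorphism (affine0 \<circ> \<phi>) U (affine0 ` ball 0 1) \<and> \<phi> p = 0 \<and>
        (let U0 = f -` U \<inter> U; \<mu> = P1_deriv f p in
           \<phi> ` U0 = {z \<in> ball 0 1. \<mu> * z \<in> ball 0 1} \<and>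
           (\<forall>y\<in>U0. \<phi> (f y) = \<mu> * \<phi> y)))"

definition pullback :: "(P1 \<Rightarrow> P1) \<Rightarrow> (nat \<Rightarrow> P1) \<Rightarrow> P1 set \<Rightarrow> nat \<Rightarrow> P1 set" where
  "pullback f x U i = connected_component_set ((f ^^ i) -` U) (x i)"

definition good_return_time :: "(P1 \<Rightarrow> P1) \<Rightarrow> (nat \<Rightarrow> P1) \<Rightarrow> P1 set \<Rightarrow> nat \<Rightarrow> bool" where
  "good_return_time f x U m \<longleftrightarrow>
     open U \<and> connected U \<and> x 0 \<in> U \<and> (\<exists>W. linearization_domain f (x 0) W \<and> U \<subseteq> W) \<and>
     m \<ge> 1 \<and> (\<forall>i\<ge>m. x i \<in> U) \<and>
     compact (closure (pullback f x U m)) \<and> closure (pullback f x U m) \<subseteq> U \<and>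
     P1_isomorphism (f ^^ m) (pullback f x U m) U"

definition adjoint_sequence_wrt ::
    "(P1 \<Rightarrow> P1) \<Rightarrow> (nat \<Rightarrow> P1) \<Rightarrow> P1 set \<Rightarrow> nat \<Rightarrow> (nat \<Rightarrow> P1) \<Rightarrow> bool" where
  "adjoint_sequence_wrt f x U m q \<longleftrightarrow>
     linearization_domain f (x 0) U \<and> good_return_time f x U m \<and>
     (\<forall>i\<ge>m. {y \<in> pullback f x U i. (f ^^ i) y = y} = {q i})"

text \<open>The terms \<open>q i\<close> with \<open>i < m\<close> are arbitrary.\<close>

definition adjoint_sequence :: "(P1 \<Rightarrow> P1) \<Rightarrow> (nat \<Rightarrow> P1) \<Rightarrow> (nat \<Rightarrow> P1) \<Rightarrow> bool" where
  "adjoint_sequence f x q \<longleftrightarrow> (\<exists>U m. adjoint_sequence_wrt f x U m q)"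


section \<open>Exceptional maps\<close>

text \<open>The elliptic curve with affine Weierstrass equation \<open>y\<^sup>2 = x\<^sup>3 + a x + b\<close>, provided that
  \<open>4 a\<^sup>3 + 27 b\<^sup>2 \<noteq> 0\<close>. Over the complex numbers every elliptic curve is isomorphic to one of these.\<close>

definition weierstrass_curve :: "complex \<Rightarrow> complex \<Rightarrow> 3 cproj set" where
  "weierstrass_curve a b =
     {pt v | v. v \<noteq> 0 \<and> (v $ 2)\<^sup>2 * v $ 3 = (v $ 1) ^ 3 + a * v $ 1 * (v $ 3)\<^sup>2 + b * (v $ 3) ^ 3}"

definition elliptic_curve :: "3 cproj set \<Rightarrow> bool" where
  "elliptic_curve E \<longleftrightarrow> (\<exists>a b. 4 * a ^ 3 + 27 * b\<^sup>2 \<noteq> 0 \<and> E = weierstrass_curve a b)"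

definition lattes :: "(P1 \<Rightarrow> P1) \<Rightarrow> bool" where
  "lattes f \<longleftrightarrow> (\<exists>E (g :: 3 cproj \<Rightarrow> 3 cproj) (\<pi> :: 3 cproj \<Rightarrow> P1).
     elliptic_curve E \<and> morphism E E g \<and> morphism E UNIV \<pi> \<and> \<not> \<pi> constant_on E \<and>
     (\<forall>x\<in>E. f (\<pi> x) = \<pi> (g x)))"

text \<open>The endomorphism \<open>z \<mapsto> z\<^sup>k\<close> on homogeneous coordinates; for negative \<open>k\<close> it is
  \<open>[x : y] \<mapsto> [y\<^bsup>-k\<^esup> : x\<^bsup>-k\<^esup>]\<close>.\<close>

definition power_lift :: "int \<Rightarrow> complex ^ 2 \<Rightarrow> complex ^ 2" where
  "power_lift k v =
     (if k \<ge> 0 then vector [(v $ 1) ^ nat k, (v $ 2) ^ nat k]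
      else vector [(v $ 2) ^ nat (- k), (v $ 1) ^ nat (- k)])"

definition monomial_type :: "(P1 \<Rightarrow> P1) \<Rightarrow> bool" where
  "monomial_type f \<longleftrightarrow> (\<exists>(k :: int) (\<pi> :: P1 \<Rightarrow> P1).
     \<bar>k\<bar> \<ge> 2 \<and> morphism UNIV UNIV \<pi> \<and> \<not> \<pi> constant_on UNIV \<and>
     (\<forall>v. v \<noteq> 0 \<longrightarrow> f (\<pi> (pt v)) = \<pi> (pt (power_lift k v))))"

definition exceptional :: "(P1 \<Rightarrow> P1) \<Rightarrow> bool" where
  "exceptional f \<longleftrightarrow> lattes f \<or> monomial_type f"

end

theory Submission
  imports Defs "HOL-Complex_Analysis.Complex_Analysis"
begin

text \<open>The linearization at the fixed point extends to a Poincare function \<open>\<Psi>\<close> on the complex plane with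
  \<open>\<Psi> (\<mu> z) = f (\<Psi> z)\<close>. In the linearizing coordinate the good return map has derivative
  \<open>C \<mu>\<^sup>m\<close> at a sequence of points that correspond to the adjoint sequence and accumulate at the
  coordinate of \<open>x m\<close>, so it is affine. Hence \<open>\<Psi>\<close> is invariant under an affine map other than a
  linear one; conjugating it by \<open>\<mu>\<close> yields a nontrivial translation. The periods of \<open>\<Psi>\<close> form a
  discrete group that is stable under \<open>\<mu>\<close>.

  If this group is cyclic, then \<open>\<mu>\<close> is an integer and \<open>\<Psi>\<close> is a function \<open>H\<close> of an exponential. A
  local holomorphic map \<open>\<sigma>\<close> with \<open>\<Psi> \<circ> \<sigma> = \<Psi>\<close> that meets the line of real multiples of a period
  is affine, as one sees by rescaling with the powers of \<open>\<mu>\<close>. Therefore \<open>H\<close> has fibres with at most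
  two points over infinitely many values and is rational by the great Picard theorem. If the group is
  a lattice, then \<open>\<Psi>\<close> factors through an elliptic curve, on which \<open>\<mu>\<close> induces an
  endomorphism.\<close>

unbundle no fps_syntax

section \<open>Holomorphic curves in projective space\<close>

text \<open>The return map sends \<open>a\<close>, the nonzero coordinate of \<open>x m\<close>, to
  0 and has slope \<open>C * \<mu> ^ m\<close>. Comparison with multiplication by
  \<open>\<mu> ^ m\<close> gives the symmetry \<open>v \<mapsto> C * v - b\<close> of
  \<open>\<Psi>\<close> with \<open>b = C * \<mu> ^ m * a\<close>. Conjugation by \<mu> yields
  another symmetry with the same slope, and the two differ by the translation by
  \<open>(1 - \<mu>) * b\<close>. In the cyclic case the obstacle is to bound the fibres of
  \<open>\<Psi>\<close> modulo periods. Rigidity does it: a local symmetry has integral slope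
  \<open>D\<close>, and \<open>1 / D\<close> turns out to be a period too, so that \<open>D\<close>
  is 1 or -1. In the lattice case holomorphic maps from the torus must be made polynomial. This
  rests on comparing pole orders, with a quasi-periodic function in place of residues. Maps into
  projective space are given throughout by local analytic vectors, and equality of points by the
  vanishing of minors, so that limits and the identity theorem apply at poles and at infinity
  alike.\<close>

lemma pt_eq_iff_minors:
  fixes v w :: "complex ^ 'n::finite"
  assumes "v \<noteq> 0" "w \<noteq> 0"
  shows "pt v = pt w \<longleftrightarrow> (\<forall>i j. v $ i * w $ j = v $ j * w $ i)"
proof
  assume "pt v = pt w"
  then show "\<forall>i j. v $ i * w $ j = v $ j * w $ i"
    using assms by (auto simp: pt_eq_iff)
next
  assume *: "\<forall>i j. v $ i * w $ j = v $ j * w $ i"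
  obtain k where k: "w $ k \<noteq> 0" using assms(2) by (auto simp: vec_eq_iff)
  have eq: "v = (v $ k / w $ k) *s w"
    using * k by (auto simp: vec_eq_iff field_simps)
  moreover have "v $ k / w $ k \<noteq> 0"
    using eq assms(1) by (metis vector_smult_lzero)
  ultimately show "pt v = pt w"
    using assms by (subst pt_eq_iff) blast+
qed

lemma pt_scale:
  fixes v :: "complex ^ 'n::finite"
  assumes "v \<noteq> 0" "c \<noteq> 0"
  shows "pt (c *s v) = pt v"
  using assms by (subst pt_eq_iff) auto

lemma analytic_zero_dichotomy:
  assumes "f analytic_on {z}"
  shows "(\<forall>\<^sub>F w in nhds z. f w = 0) \<or> (\<forall>\<^sub>F w in at z. f w \<noteq> 0)"
proof (cases "f z = 0")
  case True
  show ?thesis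
  proof (cases "isolated_zero f z")
    case True
    then show ?thesis by (auto simp: isolated_zero_def)
  next
    case False
    then show ?thesis
      using non_isolated_zero_imp_eventually_zero'[OF assms True] by blast
  qed
next
  case False
  have "isCont f z" using assms by (simp add: analytic_at_imp_isCont)
  then have "\<forall>\<^sub>F w in at z. f w \<noteq> 0"
    using False by (simp add: isCont_def tendsto_imp_eventually_ne)
  then show ?thesis ..
qed

lemma eventually_nhds_imp_at: "(\<forall>\<^sub>F w in nhds z. P w) \<Longrightarrow> (\<forall>\<^sub>F w in at z. P w)"
  by (simp add: eventually_nhds_conv_at)

text \<open>A punctured neighbourhood is open, so an identity valid on it holds near each of its
  points and may be differentiated there.\<close>

lemma eventually_at_nhds_propagate:
  fixes z :: "'a::t1_space"
  assumes "\<forall>\<^sub>F w in at z. P w"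
  shows "\<forall>\<^sub>F w in at z. \<forall>\<^sub>F u in nhds w. P u"
proof -
  from assms obtain S where S: "open S" "z \<in> S" "\<And>w. w \<in> S \<Longrightarrow> w \<noteq> z \<Longrightarrow> P w"
    by (auto simp: eventually_at_topological)
  have "\<forall>\<^sub>F u in nhds w. P u" if "w \<in> S" "w \<noteq> z" for w
    using that S by (auto simp: eventually_nhds intro!: exI[of _ "S - {z}"] open_delete)
  then show ?thesis using S(1,2) by (auto simp: eventually_at_topological)
qed

lemma analytic_at_tendsto_nhds:
  assumes "g analytic_on {z}"
  shows "(g \<longlongrightarrow> g z) (nhds z)"
  using analytic_at_imp_isCont[OF assms] by (simp add: isCont_def tendsto_at_iff_tendsto_nhds)

definition vec_analytic_at :: "(complex \<Rightarrow> complex ^ 'n::finite) \<Rightarrow> complex \<Rightarrow> bool" where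
  "vec_analytic_at A z \<longleftrightarrow> (\<forall>j. (\<lambda>w. A w $ j) analytic_on {z})"

lemma vec_analytic_at_tendsto: "vec_analytic_at A z \<Longrightarrow> (A \<longlongrightarrow> A z) (nhds z)"
  unfolding vec_analytic_at_def by (auto intro!: vec_tendstoI analytic_at_tendsto_nhds)

lemma vec_analytic_at_nonzero:
  assumes "vec_analytic_at A z" "A z \<noteq> 0"
  shows "\<forall>\<^sub>F w in nhds z. A w \<noteq> 0"
  using tendsto_imp_eventually_ne[OF vec_analytic_at_tendsto[OF assms(1)] assms(2)] .

text \<open>Holomorphy is expressed by a nonvanishing analytic lift near the point. This singles out
  no chart, treats infinity like any other point, and is preserved by homogeneous polynomial maps
  without common zero.\<close>

definition hol_at :: "(complex \<Rightarrow> 'n::finite cproj) \<Rightarrow> complex \<Rightarrow> bool" where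
  "hol_at \<Phi> z \<longleftrightarrow> (\<exists>A. vec_analytic_at A z \<and> A z \<noteq> 0 \<and> (\<forall>\<^sub>F w in nhds z. \<Phi> w = pt (A w)))"

lemma hol_atE:
  assumes "hol_at \<Phi> z"
  obtains A where "vec_analytic_at A z" "A z \<noteq> 0" "\<Phi> z = pt (A z)"
    "\<forall>\<^sub>F w in nhds z. A w \<noteq> 0 \<and> \<Phi> w = pt (A w)"
proof -
  obtain A where A: "vec_analytic_at A z" "A z \<noteq> 0" "\<forall>\<^sub>F w in nhds z. \<Phi> w = pt (A w)"
    using assms unfolding hol_at_def by blast
  show thesis
    using A vec_analytic_at_nonzero[OF A(1,2)]
    by (intro that[of A]) (auto intro: eventually_conj dest: eventually_nhds_x_imp_x)
qed

lemma hol_at_cong: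
  assumes "\<forall>\<^sub>F w in nhds z. \<Phi> w = \<Phi>' w"
  shows "hol_at \<Phi> z \<longleftrightarrow> hol_at \<Phi>' z"
proof -
  have "(\<forall>\<^sub>F w in nhds z. \<Phi> w = pt (A w)) \<longleftrightarrow> (\<forall>\<^sub>F w in nhds z. \<Phi>' w = pt (A w))" for A
    by (rule eventually_cong[OF assms]) simp
  then show ?thesis by (simp add: hol_at_def)
qed

lemma vec_analytic_at_compose:
  assumes "vec_analytic_at A (g z)" "g analytic_on {z}"
  shows "vec_analytic_at (\<lambda>w. A (g w)) z"
  unfolding vec_analytic_at_def
proof
  fix j
  have "((\<lambda>w. A w $ j) \<circ> g) analytic_on {z}"
    using assms by (intro analytic_on_compose) (auto simp: vec_analytic_at_def)
  then show "(\<lambda>w. A (g w) $ j) analytic_on {z}" by (simp add: o_def)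
qed

lemma hol_at_compose:
  assumes "hol_at \<Phi> (g z)" "g analytic_on {z}"
  shows "hol_at (\<lambda>w. \<Phi> (g w)) z"
proof -
  obtain A where A: "vec_analytic_at A (g z)" "A (g z) \<noteq> 0" "\<forall>\<^sub>F w in nhds (g z). \<Phi> w = pt (A w)"
    using assms unfolding hol_at_def by blast
  have "\<forall>\<^sub>F w in nhds z. \<Phi> (g w) = pt (A (g w))"
    using A(3) analytic_at_tendsto_nhds[OF assms(2)] by (rule eventually_compose_filterlim)
  then show ?thesis
    unfolding hol_at_def using vec_analytic_at_compose[OF A(1) assms(2)] A(2) by blast
qed

text \<open>The minors of two lifts are finitely many analytic functions: either all of them vanish
  near the point, or one of them is nonzero on a punctured neighbourhood.\<close>

lemma hol_at_eq_dichotomy: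
  assumes "hol_at \<Phi> z" "hol_at \<Psi> z"
  shows "(\<forall>\<^sub>F w in nhds z. \<Phi> w = \<Psi> w) \<or> (\<forall>\<^sub>F w in at z. \<Phi> w \<noteq> \<Psi> w)"
proof -
  obtain A where A: "vec_analytic_at A z" "\<forall>\<^sub>F w in nhds z. A w \<noteq> 0 \<and> \<Phi> w = pt (A w)"
    using assms(1) by (rule hol_atE)
  obtain B where B: "vec_analytic_at B z" "\<forall>\<^sub>F w in nhds z. B w \<noteq> 0 \<and> \<Psi> w = pt (B w)"
    using assms(2) by (rule hol_atE)
  have ev: "\<forall>\<^sub>F w in nhds z. \<Phi> w = \<Psi> w \<longleftrightarrow> (\<forall>i j. A w $ i * B w $ j - A w $ j * B w $ i = 0)"
    using A(2) B(2) by eventually_elim (auto simp: pt_eq_iff_minors)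
  have an: "(\<lambda>w. A w $ i * B w $ j - A w $ j * B w $ i) analytic_on {z}" for i j
    using A(1) B(1) by (auto simp: vec_analytic_at_def intro!: analytic_intros)
  show ?thesis
  proof (cases "\<forall>i j. \<forall>\<^sub>F w in nhds z. A w $ i * B w $ j - A w $ j * B w $ i = 0")
    case True
    then have "\<forall>\<^sub>F w in nhds z. \<forall>i j. A w $ i * B w $ j - A w $ j * B w $ i = 0"
      by (simp add: eventually_all_finite)
    with ev have "\<forall>\<^sub>F w in nhds z. \<Phi> w = \<Psi> w" by eventually_elim blast
    then show ?thesis ..
  next
    case False
    then obtain i j where "\<forall>\<^sub>F w in at z. A w $ i * B w $ j - A w $ j * B w $ i \<noteq> 0"
      using analytic_zero_dichotomy[OF an] by blast
    with eventually_nhds_imp_at[OF ev] have "\<forall>\<^sub>F w in at z. \<Phi> w \<noteq> \<Psi> w"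
      by eventually_elim blast
    then show ?thesis ..
  qed
qed

text \<open>The set of points near which both maps agree is open, and by the dichotomy so is its
  complement; the plane is connected.\<close>

lemma hol_at_identity:
  assumes "\<And>z. hol_at \<Phi> z" "\<And>z. hol_at \<Psi> z" "\<exists>\<^sub>F w in at z0. \<Phi> w = \<Psi> w"
  shows "\<Phi> = \<Psi>"
proof -
  define S where "S = {z. \<forall>\<^sub>F w in nhds z. \<Phi> w = \<Psi> w}"
  have "open S"
    unfolding S_def by (subst open_subopen) (auto simp: eventually_nhds)
  moreover have "closed S"
  proof -
    have "\<exists>T. open T \<and> z \<in> T \<and> T \<subseteq> - S" if "z \<notin> S" for z
    proof -
      have "\<forall>\<^sub>F w in at z. \<Phi> w \<noteq> \<Psi> w"
        using hol_at_eq_dichotomy[OF assms(1,2), of z] that unfolding S_def by blast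
      then obtain T where T: "open T" "z \<in> T" "\<And>w. w \<in> T \<Longrightarrow> w \<noteq> z \<Longrightarrow> \<Phi> w \<noteq> \<Psi> w"
        by (auto simp: eventually_at_topological)
      have "w \<notin> S" if "w \<in> T" for w
      proof
        assume w: "w \<in> S"
        then have "\<Phi> w = \<Psi> w" unfolding S_def by (auto dest: eventually_nhds_x_imp_x)
        with T(3)[OF that] w \<open>z \<notin> S\<close> show False by blast
      qed
      with T show ?thesis by blast
    qed
    then show ?thesis unfolding closed_def by (subst open_subopen) blast
  qed
  moreover have "z0 \<in> S"
    using hol_at_eq_dichotomy[OF assms(1,2), of z0] assms(3)
    unfolding S_def frequently_def by blast
  ultimately have "S = UNIV" using clopen by blast
  then show ?thesis
    unfolding S_def by (auto intro!: ext dest!: eventually_nhds_x_imp_x)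
qed

text \<open>Minors of lifts depend continuously on the arguments, so their vanishing passes to the
  limit. This plays the part of the Hausdorff property of projective space.\<close>

lemma hol_at_eq_limit:
  assumes "hol_at \<Phi> a" "hol_at \<Psi> b" "(X \<longlongrightarrow> a) F" "(Y \<longlongrightarrow> b) F"
    and "\<forall>\<^sub>F n in F. \<Phi> (X n) = \<Psi> (Y n)" "F \<noteq> bot"
  shows "\<Phi> a = \<Psi> b"
proof -
  obtain A where A: "vec_analytic_at A a" "A a \<noteq> 0" "\<Phi> a = pt (A a)"
      "\<forall>\<^sub>F w in nhds a. A w \<noteq> 0 \<and> \<Phi> w = pt (A w)"
    using assms(1) by (rule hol_atE)
  obtain B where B: "vec_analytic_at B b" "B b \<noteq> 0" "\<Psi> b = pt (B b)"
      "\<forall>\<^sub>F w in nhds b. B w \<noteq> 0 \<and> \<Psi> w = pt (B w)"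
    using assms(2) by (rule hol_atE)
  have "A a $ i * B b $ j = A a $ j * B b $ i" for i j
  proof -
    have lA: "((\<lambda>n. A (X n)) \<longlongrightarrow> A a) F"
      using vec_analytic_at_tendsto[OF A(1)] assms(3) by (rule filterlim_compose)
    have lB: "((\<lambda>n. B (Y n)) \<longlongrightarrow> B b) F"
      using vec_analytic_at_tendsto[OF B(1)] assms(4) by (rule filterlim_compose)
    have "\<forall>\<^sub>F n in F. A (X n) \<noteq> 0 \<and> \<Phi> (X n) = pt (A (X n))"
      using A(4) assms(3) by (rule eventually_compose_filterlim)
    moreover have "\<forall>\<^sub>F n in F. B (Y n) \<noteq> 0 \<and> \<Psi> (Y n) = pt (B (Y n))"
      using B(4) assms(4) by (rule eventually_compose_filterlim)
    ultimately have ev: "\<forall>\<^sub>F n in F. A (X n) $ i * B (Y n) $ j = A (X n) $ j * B (Y n) $ i"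
      using assms(5) by eventually_elim (metis pt_eq_iff_minors)
    have "((\<lambda>n. A (X n) $ i * B (Y n) $ j) \<longlongrightarrow> A a $ i * B b $ j) F"
      by (intro tendsto_intros lA lB)
    moreover have "((\<lambda>n. A (X n) $ i * B (Y n) $ j) \<longlongrightarrow> A a $ j * B b $ i) F"
      by (subst filterlim_cong[OF refl refl ev]) (intro tendsto_intros lA lB)
    ultimately show ?thesis using tendsto_unique assms(6) by blast
  qed
  then show ?thesis using A B by (simp add: pt_eq_iff_minors)
qed

lemma analytic_on_hom_poly:
  assumes "hom_poly d G" "vec_analytic_at A z"
  shows "(\<lambda>w. G (A w)) analytic_on {z}"
proof -
  obtain c where c: "\<And>v. G v = (\<Sum>\<alpha> | (\<Sum>i\<in>UNIV. \<alpha> i) = d. c \<alpha> * (\<Prod>i\<in>UNIV. (v $ i) ^ \<alpha> i))"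
    using assms(1) unfolding hom_poly_def by blast
  show ?thesis
    unfolding c using assms(2) by (auto simp: vec_analytic_at_def intro!: analytic_intros)
qed

lemma hol_at_hom_poly:
  fixes F :: "complex ^ 'n::finite \<Rightarrow> complex ^ 'm::finite"
  assumes "\<And>j. hom_poly d (\<lambda>v. F v $ j)" "\<And>v. v \<noteq> 0 \<Longrightarrow> F v \<noteq> 0 \<and> f (pt v) = pt (F v)"
    and "hol_at \<Phi> z"
  shows "hol_at (\<lambda>w. f (\<Phi> w)) z"
proof -
  obtain A where A: "vec_analytic_at A z" "A z \<noteq> 0"
      "\<forall>\<^sub>F w in nhds z. A w \<noteq> 0 \<and> \<Phi> w = pt (A w)"
    using assms(3) by (rule hol_atE)
  have "vec_analytic_at (\<lambda>w. F (A w)) z"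
    using analytic_on_hom_poly[OF assms(1) A(1)] by (simp add: vec_analytic_at_def)
  moreover have "\<forall>\<^sub>F w in nhds z. f (\<Phi> w) = pt (F (A w))"
    using A(3) by eventually_elim (use assms(2) in auto)
  ultimately show ?thesis unfolding hol_at_def using assms(2) A(2) by blast
qed

lemma hom_poly_scale:
  assumes "hom_poly d G"
  shows "G (c *s v) = c ^ d * G v"
proof -
  obtain a where a: "\<And>v. G v = (\<Sum>\<alpha> | (\<Sum>i\<in>UNIV. \<alpha> i) = d. a \<alpha> * (\<Prod>i\<in>UNIV. (v $ i) ^ \<alpha> i))"
    using assms unfolding hom_poly_def by blast
  have "(\<Prod>i\<in>UNIV. ((c *s v) $ i) ^ \<alpha> i) = c ^ d * (\<Prod>i\<in>UNIV. (v $ i) ^ \<alpha> i)"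
    if "(\<Sum>i\<in>UNIV. \<alpha> i) = d" for \<alpha>
    using that by (simp add: power_mult_distrib prod.distrib flip: power_sum)
  then show ?thesis
    unfolding a by (auto simp: sum_distrib_left intro!: sum.cong)
qed

section \<open>Charts of the projective line\<close>

lemma vector2_nonzero [simp]:
  "(vector [z, 1] :: complex ^ 2) \<noteq> 0" "(vector [1, z] :: complex ^ 2) \<noteq> 0"
  by (auto simp: vec_eq_iff forall_2)

lemma pt_affine0: "v $ 2 \<noteq> 0 \<Longrightarrow> pt v = affine0 (v $ 1 / v $ 2)"
  unfolding affine0_def
  by (subst pt_eq_iff) (auto simp: vec_eq_iff forall_2 intro!: exI[of _ "v $ 2"])

lemma pt_affine1: "v $ 1 \<noteq> 0 \<Longrightarrow> pt v = affine1 (v $ 2 / v $ 1)"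
  unfolding affine1_def
  by (subst pt_eq_iff) (auto simp: vec_eq_iff forall_2 intro!: exI[of _ "v $ 1"])

lemma pt_in_range_affine0: "v \<noteq> 0 \<Longrightarrow> pt v \<in> range affine0 \<longleftrightarrow> v $ 2 \<noteq> 0"
  by (auto simp: pt_affine0) (auto simp: affine0_def pt_eq_iff vec_eq_iff forall_2)

lemma pt_in_range_affine1: "v \<noteq> 0 \<Longrightarrow> pt v \<in> range affine1 \<longleftrightarrow> v $ 1 \<noteq> 0"
  by (auto simp: pt_affine1) (auto simp: affine1_def pt_eq_iff vec_eq_iff forall_2)

lemma affine0_eq_affine1: "z \<noteq> 0 \<Longrightarrow> affine0 z = affine1 (inverse z)"
  unfolding affine0_def by (subst pt_affine1) (auto simp: inverse_eq_divide)

lemma inj_chart_at: "inj (chart_at x)"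
  using inj_affine0 inj_affine1 by (auto simp: chart_at_def)

lemma chart_at_range: "x \<in> range (chart_at x)"
  using affine0_Un_affine1 by (auto simp: chart_at_def)

lemma coord_chart_at [simp]: "coord x (chart_at x z) = z"
  by (simp add: coord_def inj_chart_at)

lemma chart_at_coord: "y \<in> range (chart_at x) \<Longrightarrow> chart_at x (coord x y) = y"
  by (simp add: coord_def f_inv_into_f)

lemma chart_at_coord_self [simp]: "chart_at x (coord x x) = x"
  by (simp add: chart_at_coord chart_at_range)

lemma continuous_on_vector2 [continuous_intros]:
  "continuous_on S (\<lambda>z. vector [z, 1] :: complex ^ 2)"
  "continuous_on S (\<lambda>z. vector [1, z] :: complex ^ 2)"
proof -
  have *: "(vector [z, 1] :: complex ^ 2) = (\<chi> i. if i = 1 then z else 1)"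
    "(vector [1, z] :: complex ^ 2) = (\<chi> i. if i = 1 then 1 else z)" for z
    by (auto simp: vec_eq_iff forall_2)
  have "continuous_on S (\<lambda>z. if b then z else (1 :: complex))"
    "continuous_on S (\<lambda>z. if b then 1 else (z :: complex))" for b
    by (cases b; simp)+
  then show "continuous_on S (\<lambda>z. vector [z, 1] :: complex ^ 2)"
    "continuous_on S (\<lambda>z. vector [1, z] :: complex ^ 2)"
    unfolding * by (intro continuous_on_vec_lambda; blast)+
qed

lemma open_vimage_affine:
  assumes "open S"
  shows "open (affine0 -` S)" "open (affine1 -` S)"
proof -
  have S: "open {v :: complex ^ 2. v \<noteq> 0 \<and> pt v \<in> S}"
    using assms by (simp add: open_cproj_def)
  have "affine0 -` S = (\<lambda>z. vector [z, 1]) -` {v :: complex ^ 2. v \<noteq> 0 \<and> pt v \<in> S}"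
    "affine1 -` S = (\<lambda>z. vector [1, z]) -` {v :: complex ^ 2. v \<noteq> 0 \<and> pt v \<in> S}"
    by (auto simp: affine0_def affine1_def)
  moreover have "open ((\<lambda>z. vector [z, 1]) -` {v :: complex ^ 2. v \<noteq> 0 \<and> pt v \<in> S})"
    "open ((\<lambda>z. vector [1, z]) -` {v :: complex ^ 2. v \<noteq> 0 \<and> pt v \<in> S})"
    by (intro open_vimage S continuous_on_vector2)+
  ultimately show "open (affine0 -` S)" "open (affine1 -` S)" by simp_all
qed

lemma open_affine_image:
  assumes "open S"
  shows "open (affine0 ` S)" "open (affine1 ` S)"
proof -
  have "{v :: complex ^ 2. v \<noteq> 0 \<and> pt v \<in> affine0 ` S} =
      {v. v $ 2 \<noteq> 0} \<inter> (\<lambda>v. v $ 1 / v $ 2) -` S"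
  proof (intro set_eqI iffI)
    fix v :: "complex ^ 2"
    assume "v \<in> {v. v \<noteq> 0 \<and> pt v \<in> affine0 ` S}"
    then obtain z where z: "v \<noteq> 0" "z \<in> S" "pt v = affine0 z" by auto
    then have v2: "v $ 2 \<noteq> 0" using pt_in_range_affine0[of v] by auto
    with z have "z = v $ 1 / v $ 2" using pt_affine0[OF v2] inj_affine0 by (simp add: inj_eq)
    with z v2 show "v \<in> {v. v $ 2 \<noteq> 0} \<inter> (\<lambda>v. v $ 1 / v $ 2) -` S" by simp
  qed (auto simp: pt_affine0)
  moreover have "open ({v :: complex ^ 2. v $ 2 \<noteq> 0} \<inter> (\<lambda>v. v $ 1 / v $ 2) -` S)"
    by (intro continuous_open_preimage assms continuous_intros open_Collect_neq) auto
  ultimately show "open (affine0 ` S)" by (simp add: open_cproj_def)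
  have "{v :: complex ^ 2. v \<noteq> 0 \<and> pt v \<in> affine1 ` S} =
      {v. v $ 1 \<noteq> 0} \<inter> (\<lambda>v. v $ 2 / v $ 1) -` S"
  proof (intro set_eqI iffI)
    fix v :: "complex ^ 2"
    assume "v \<in> {v. v \<noteq> 0 \<and> pt v \<in> affine1 ` S}"
    then obtain z where z: "v \<noteq> 0" "z \<in> S" "pt v = affine1 z" by auto
    then have v1: "v $ 1 \<noteq> 0" using pt_in_range_affine1[of v] by auto
    with z have "z = v $ 2 / v $ 1" using pt_affine1[OF v1] inj_affine1 by (simp add: inj_eq)
    with z v1 show "v \<in> {v. v $ 1 \<noteq> 0} \<inter> (\<lambda>v. v $ 2 / v $ 1) -` S" by simp
  qed (auto simp: pt_affine1)
  moreover have "open ({v :: complex ^ 2. v $ 1 \<noteq> 0} \<inter> (\<lambda>v. v $ 2 / v $ 1) -` S)"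
    by (intro continuous_open_preimage assms continuous_intros open_Collect_neq) auto
  ultimately show "open (affine1 ` S)" by (simp add: open_cproj_def)
qed

lemma continuous_on_affine0: "continuous_on S affine0"
  using open_vimage_affine(1) continuous_on_subset[of UNIV affine0 S]
  by (simp add: continuous_on_open_vimage)

lemma hol_at_pt:
  assumes "vec_analytic_at A z" "A z \<noteq> 0"
  shows "hol_at (\<lambda>w. pt (A w)) z"
  unfolding hol_at_def using assms by (intro exI[of _ A]) simp

lemma hol_at_affine:
  assumes "c analytic_on {z}"
  shows "hol_at (\<lambda>w. affine0 (c w)) z" "hol_at (\<lambda>w. affine1 (c w)) z"
proof -
  have "vec_analytic_at (\<lambda>w. vector [c w, 1] :: complex ^ 2) z"
    "vec_analytic_at (\<lambda>w. vector [1, c w] :: complex ^ 2) z"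
    using assms by (auto simp: vec_analytic_at_def forall_2)
  then show "hol_at (\<lambda>w. affine0 (c w)) z" "hol_at (\<lambda>w. affine1 (c w)) z"
    unfolding affine0_def affine1_def by (auto intro!: hol_at_pt)
qed

text \<open>Links lifts with the charts that define \<open>P1_deriv\<close>; the chart at
  \<open>\<Phi> z\<close> stays valid nearby because a nonzero coordinate of the lift remains
  nonzero.\<close>

lemma hol_at_chart:
  assumes "hol_at \<Phi> z"
  defines "c \<equiv> \<lambda>w. coord (\<Phi> z) (\<Phi> w)"
  shows "c analytic_on {z}" and "\<forall>\<^sub>F w in nhds z. \<Phi> w = chart_at (\<Phi> z) (c w)"
proof -
  obtain A where A: "vec_analytic_at A z" "A z \<noteq> 0" "\<Phi> z = pt (A z)"
      "\<forall>\<^sub>F w in nhds z. A w \<noteq> 0 \<and> \<Phi> w = pt (A w)"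
    using assms(1) by (rule hol_atE)
  define b where "b = (if A z $ 2 \<noteq> 0 then (\<lambda>w. A w $ 1 / A w $ 2) else (\<lambda>w. A w $ 2 / A w $ 1))"
  have nz: "A z $ 2 \<noteq> 0 \<or> A z $ 1 \<noteq> 0"
    using A(2) by (auto simp: vec_eq_iff forall_2)
  have ch: "chart_at (\<Phi> z) = (if A z $ 2 \<noteq> 0 then affine0 else affine1)"
    using A(2) by (simp add: chart_at_def A(3) pt_in_range_affine0)
  have b: "b analytic_on {z}"
    using A(1) nz by (auto simp: b_def vec_analytic_at_def intro!: analytic_intros)
  have ne: "\<forall>\<^sub>F w in nhds z. A z $ j \<noteq> 0 \<longrightarrow> A w $ j \<noteq> 0" for j
  proof -
    have "((\<lambda>w. A w $ j) \<longlongrightarrow> A z $ j) (nhds z)"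
      using vec_analytic_at_tendsto[OF A(1)] by (rule tendsto_vec_nth)
    then show ?thesis
      by (cases "A z $ j = 0") (auto dest: tendsto_imp_eventually_ne)
  qed
  have ev: "\<forall>\<^sub>F w in nhds z. \<Phi> w = chart_at (\<Phi> z) (b w)"
    using A(4) ne[of 1] ne[of 2]
    by eventually_elim (use nz in \<open>auto simp: ch b_def pt_affine0 pt_affine1\<close>)
  then have eq: "\<forall>\<^sub>F w in nhds z. c w = b w"
    by eventually_elim (simp add: c_def)
  then show "c analytic_on {z}" using b by (subst analytic_at_cong[OF _ refl]) auto
  show "\<forall>\<^sub>F w in nhds z. \<Phi> w = chart_at (\<Phi> z) (c w)"
    using ev eq by eventually_elim simp
qed

text \<open>In a chart, \<open>\<Psi>\<close> is an injective holomorphic function near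
  \<open>z0\<close>; such a function is open and has a holomorphic inverse.\<close>

lemma hol_at_local_inverse:
  assumes "hol_at \<Psi> z0" "inj_on \<Psi> (ball z0 r)" "r > 0"
    and c_def: "c = (\<lambda>w. coord (\<Psi> z0) (\<Psi> w))"
  obtains g where "g analytic_on {c z0}" "g (c z0) = z0" "deriv c z0 * deriv g (c z0) = 1"
    "\<forall>\<^sub>F t in nhds (c z0). c (g t) = t \<and> \<Psi> (g t) = chart_at (\<Psi> z0) t"
proof -
  have ca: "c analytic_on {z0}" and ev: "\<forall>\<^sub>F w in nhds z0. \<Psi> w = chart_at (\<Psi> z0) (c w)"
    using hol_at_chart[OF assms(1)] by (simp_all add: c_def)
  obtain s1 where s1: "s1 > 0" "c holomorphic_on ball z0 s1"
    using ca analytic_at_ball by blast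
  obtain s2 where s2: "s2 > 0" "\<And>w. w \<in> ball z0 s2 \<Longrightarrow> \<Psi> w = chart_at (\<Psi> z0) (c w)"
    using ev by (auto simp: eventually_nhds_metric dist_commute)
  define B where "B = ball z0 (min r (min s1 s2))"
  have B: "open B" "z0 \<in> B" "connected B"
    using assms(3) s1 s2 by (auto simp: B_def)
  have hol: "c holomorphic_on B"
    using s1(2) by (rule holomorphic_on_subset) (auto simp: B_def)
  have eqB: "\<Psi> w = chart_at (\<Psi> z0) (c w)" if "w \<in> B" for w
    using that s2(2) by (auto simp: B_def)
  have inj: "inj_on c B"
  proof (rule inj_onI)
    fix x y assume xy: "x \<in> B" "y \<in> B" "c x = c y"
    then have "\<Psi> x = \<Psi> y" using eqB by simp
    with xy assms(2) show "x = y" by (auto simp: B_def inj_on_def)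
  qed
  obtain g where g: "g holomorphic_on c ` B" "\<And>z. z \<in> B \<Longrightarrow> deriv c z * deriv g (c z) = 1"
      "\<And>z. z \<in> B \<Longrightarrow> g (c z) = z"
    using holomorphic_has_inverse[OF hol B(1) inj] by blast
  have op: "open (c ` B)"
    using open_mapping_thm3[OF hol B(1) inj] .
  have "g analytic_on {c z0}"
    using g(1) op B(2) by (auto simp: analytic_at)
  moreover have "\<forall>\<^sub>F t in nhds (c z0). c (g t) = t \<and> \<Psi> (g t) = chart_at (\<Psi> z0) t"
  proof -
    have "\<forall>\<^sub>F t in nhds (c z0). t \<in> c ` B"
      using op B(2) by (intro eventually_nhds_in_open) auto
    then show ?thesis
    proof eventually_elim
      case (elim t)
      then obtain w where w: "w \<in> B" "t = c w" by blast
      then show ?case using g(3)[OF w(1)] eqB[OF w(1)] by simp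
    qed
  qed
  ultimately show thesis by (rule that[OF _ g(3)[OF B(2)] g(2)[OF B(2)]])
qed

text \<open>\<open>\<sigma>\<close> is a local inverse of \<open>\<Psi>\<close> composed with
  \<open>\<Phi>\<close>. Both the return map and the local symmetries of \<open>\<Psi>\<close> arise
  in this way.\<close>

lemma hol_at_transfer:
  fixes \<Phi> \<Psi> :: "complex \<Rightarrow> P1"
  assumes "hol_at \<Phi> z1" "hol_at \<Psi> z2" "\<Phi> z1 = \<Psi> z2" "inj_on \<Psi> (ball z2 r)" "r > 0"
  obtains \<sigma> where "\<sigma> analytic_on {z1}" "\<sigma> z1 = z2" "\<forall>\<^sub>F w in nhds z1. \<Psi> (\<sigma> w) = \<Phi> w"
proof -
  obtain g where g: "g analytic_on {coord (\<Psi> z2) (\<Psi> z2)}" "g (coord (\<Psi> z2) (\<Psi> z2)) = z2"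
      "\<forall>\<^sub>F t in nhds (coord (\<Psi> z2) (\<Psi> z2)). coord (\<Psi> z2) (\<Psi> (g t)) = t \<and>
        \<Psi> (g t) = chart_at (\<Psi> z2) t"
    by (rule hol_at_local_inverse[OF assms(2,4,5) refl])
  define b where "b = (\<lambda>w. coord (\<Phi> z1) (\<Phi> w))"
  have b: "b analytic_on {z1}" and ev: "\<forall>\<^sub>F w in nhds z1. \<Phi> w = chart_at (\<Phi> z1) (b w)"
    using hol_at_chart[OF assms(1)] by (simp_all add: b_def)
  have b1: "b z1 = coord (\<Psi> z2) (\<Psi> z2)" by (simp add: b_def assms(3))
  have "(g \<circ> b) analytic_on {z1}"
    using b g(1) by (intro analytic_on_compose) (simp_all add: b1)
  moreover have "\<forall>\<^sub>F w in nhds z1. coord (\<Psi> z2) (\<Psi> (g (b w))) = b w \<and> \<Psi> (g (b w)) = chart_at (\<Psi> z2) (b w)"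
    using g(3) analytic_at_tendsto_nhds[OF b] unfolding b1 by (rule eventually_compose_filterlim)
  with ev have "\<forall>\<^sub>F w in nhds z1. \<Psi> ((g \<circ> b) w) = \<Phi> w"
    by eventually_elim (simp add: assms(3))
  ultimately show thesis using g(2) b1 by (intro that[of "g \<circ> b"]) auto
qed

text \<open>In the chart, \<open>h\<close> becomes \<open>c \<circ> \<sigma> \<circ> g\<close> with
  \<open>g\<close> inverse to \<open>c\<close>; the derivatives of \<open>c\<close> and
  \<open>g\<close> cancel at the fixed point.\<close>

lemma P1_deriv_conjugate:
  assumes "hol_at \<Psi> z0" "inj_on \<Psi> (ball z0 r)" "r > 0"
    and "\<sigma> analytic_on {z0}" "\<sigma> z0 = z0" "\<forall>\<^sub>F z in nhds z0. h (\<Psi> z) = \<Psi> (\<sigma> z)"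
  shows "P1_deriv h (\<Psi> z0) = deriv \<sigma> z0"
proof -
  define c where "c = (\<lambda>w. coord (\<Psi> z0) (\<Psi> w))"
  have c: "c analytic_on {z0}"
    using hol_at_chart(1)[OF assms(1)] by (simp add: c_def)
  obtain g where g: "g analytic_on {c z0}" "g (c z0) = z0" "deriv c z0 * deriv g (c z0) = 1"
      "\<forall>\<^sub>F t in nhds (c z0). c (g t) = t \<and> \<Psi> (g t) = chart_at (\<Psi> z0) t"
    by (rule hol_at_local_inverse[OF assms(1-3) c_def])
  have h_fix: "h (\<Psi> z0) = \<Psi> z0"
    using eventually_nhds_x_imp_x[OF assms(6)] assms(5) by simp
  have "\<forall>\<^sub>F t in nhds (c z0). h (\<Psi> (g t)) = \<Psi> (\<sigma> (g t))"
    using assms(6) analytic_at_tendsto_nhds[OF g(1)] unfolding g(2)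
    by (rule eventually_compose_filterlim)
  with g(4) have "\<forall>\<^sub>F t in nhds (c z0). local_rep h (\<Psi> z0) t = c (\<sigma> (g t))"
    by eventually_elim (auto simp: local_rep_def h_fix c_def)
  then have "P1_deriv h (\<Psi> z0) = deriv (\<lambda>t. c (\<sigma> (g t))) (c z0)"
    unfolding P1_deriv_def by (intro deriv_cong_ev) (simp_all add: c_def)
  also have "((\<lambda>t. c (\<sigma> (g t))) has_field_derivative deriv c z0 * (deriv \<sigma> z0 * deriv g (c z0))) (at (c z0))"
  proof (intro DERIV_chain2[of c] DERIV_chain2[of \<sigma>])
    show "(c has_field_derivative deriv c z0) (at (\<sigma> (g (c z0))))"
      using c by (simp add: g(2) assms(5) analytic_on_imp_differentiable_at DERIV_deriv_iff_field_differentiable)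
    show "(\<sigma> has_field_derivative deriv \<sigma> z0) (at (g (c z0)))"
      using assms(4) by (simp add: g(2) analytic_on_imp_differentiable_at DERIV_deriv_iff_field_differentiable)
    show "(g has_field_derivative deriv g (c z0)) (at (c z0))"
      using g(1) by (simp add: analytic_on_imp_differentiable_at DERIV_deriv_iff_field_differentiable)
  qed
  then have "deriv (\<lambda>t. c (\<sigma> (g t))) (c z0) = deriv c z0 * (deriv \<sigma> z0 * deriv g (c z0))"
    by (rule DERIV_imp_deriv)
  also have "\<dots> = deriv \<sigma> z0" using g(3) by (simp add: algebra_simps)
  finally show ?thesis .
qed

section \<open>The Poincare function\<close>

lemma hol_at_transform:
  assumes "hol_at \<Phi> z" "\<forall>\<^sub>F w in nhds z. \<Phi> w = \<Phi>' w"
  shows "hol_at \<Phi>' z"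
  using assms hol_at_cong by blast

text \<open>\<open>P1_holomorphic_on\<close> asserts differentiability of each
  \<open>local_rep\<close> at one point, in charts that vary with the point. These statements have
  to be translated into a single target chart near \<open>z\<close> before they give a holomorphic
  function.\<close>

lemma hol_at_P1_holomorphic_on:
  fixes h :: "P1 \<Rightarrow> P1"
  assumes "P1_holomorphic_on h V" "affine0 z \<in> V"
  shows "hol_at (\<lambda>w. h (affine0 w)) z"
proof -
  have V: "open V" "continuous_on V h"
    and diff: "\<And>y. y \<in> V \<Longrightarrow> local_rep h y field_differentiable at (coord y y)"
    using assms(1) by (auto simp: P1_holomorphic_on_def)
  have ch: "chart_at (affine0 w) = affine0" for w by (simp add: chart_at_def)
  have co: "coord (affine0 w) (affine0 w) = w" for w
    using coord_chart_at[of "affine0 w" w] by (simp add: ch)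
  have opn: "open {w. affine0 w \<in> V \<and> h (affine0 w) \<in> S}" if "open S" for S
  proof -
    have "open (h -` S \<inter> V)"
      using V that by (simp add: continuous_on_open_vimage)
    then have "open (affine0 -` (h -` S \<inter> V))" by (rule open_vimage_affine)
    moreover have "affine0 -` (h -` S \<inter> V) = {w. affine0 w \<in> V \<and> h (affine0 w) \<in> S}" by auto
    ultimately show ?thesis by simp
  qed
  have open_range: "open (range affine0)" "open (range affine1)"
    by (simp_all add: open_affine_image)
  define c0 where "c0 = (\<lambda>w. inv affine0 (h (affine0 w)))"
  define c1 where "c1 = (\<lambda>w. inv affine1 (h (affine0 w)))"
  have dc0: "c0 field_differentiable at w" if "affine0 w \<in> V" "h (affine0 w) \<in> range affine0" for w
    using diff[OF that(1)] that(2)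
    by (simp add: local_rep_def ch co coord_def[of "h (affine0 w)"] chart_at_def[of "h (affine0 w)"] c0_def o_def)
  show ?thesis
  proof (cases "h (affine0 z) \<in> range affine0")
    case True
    define W where "W = {w. affine0 w \<in> V \<and> h (affine0 w) \<in> range affine0}"
    have W: "open W" "z \<in> W" using opn[OF open_range(1)] True assms(2) by (auto simp: W_def)
    have "c0 holomorphic_on W"
      unfolding holomorphic_on_open[OF W(1)] using dc0 by (auto simp: W_def field_differentiable_def)
    then have "c0 analytic_on {z}" using W by (auto simp: analytic_at)
    then have "hol_at (\<lambda>w. affine0 (c0 w)) z" by (rule hol_at_affine)
    moreover have "\<forall>\<^sub>F w in nhds z. w \<in> W" using W by (rule eventually_nhds_in_open)
    then have "\<forall>\<^sub>F w in nhds z. affine0 (c0 w) = h (affine0 w)"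
      by eventually_elim (auto simp: W_def c0_def intro: f_inv_into_f)
    ultimately show ?thesis by (rule hol_at_transform)
  next
    case False
    define W where "W = {w. affine0 w \<in> V \<and> h (affine0 w) \<in> range affine1}"
    have W: "open W" "z \<in> W"
      using opn[OF open_range(2)] False assms(2) affine0_Un_affine1 by (auto simp: W_def)
    \<comment> \<open>Where the image is finite, the hypothesis speaks of the coordinate
      \<open>c0\<close>; there \<open>c1\<close> is its inverse.\<close>
    have dc1: "c1 field_differentiable at w" if w: "w \<in> W" for w
    proof (cases "h (affine0 w) \<in> range affine0")
      case True
      define W' where "W' = W \<inter> {w. affine0 w \<in> V \<and> h (affine0 w) \<in> range affine0}"
      have W': "open W'" "w \<in> W'"
        using opn[OF open_range(1)] True w W(1) by (auto simp: W'_def W_def)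
      have c: "c0 u \<noteq> 0 \<and> c1 u = inverse (c0 u)" if "u \<in> W'" for u
      proof -
        have eq: "affine0 (c0 u) = h (affine0 u)" "affine1 (c1 u) = h (affine0 u)"
          using that by (auto simp: W'_def W_def c0_def c1_def f_inv_into_f)
        have "pt (vector [c0 u, 1]) \<in> range affine1"
          using eq by (metis affine0_def rangeI)
        then have nz: "c0 u \<noteq> 0" by (simp add: pt_in_range_affine1)
        with eq have "affine1 (c1 u) = affine1 (inverse (c0 u))" by (simp flip: affine0_eq_affine1)
        with nz show ?thesis using inj_affine1 by (simp add: inj_eq)
      qed
      have "(\<lambda>u. inverse (c0 u)) field_differentiable at w"
        using dc0[of w] True w c[OF W'(2)] by (auto simp: W_def intro!: derivative_intros)
      then obtain D where "((\<lambda>u. inverse (c0 u)) has_field_derivative D) (at w)"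
        by (auto simp: field_differentiable_def)
      then have "(c1 has_field_derivative D) (at w)"
        using W' c by (auto intro: has_field_derivative_transform_within_open[of _ _ _ W'])
      then show ?thesis by (auto simp: field_differentiable_def)
    next
      case False
      have "affine0 w \<in> V" using w by (simp add: W_def)
      from diff[OF this] False show ?thesis
        by (simp add: local_rep_def ch co coord_def[of "h (affine0 w)"] chart_at_def[of "h (affine0 w)"] c1_def o_def)
    qed
    have "c1 holomorphic_on W"
      unfolding holomorphic_on_open[OF W(1)] using dc1 by (auto simp: field_differentiable_def)
    then have "c1 analytic_on {z}" using W by (auto simp: analytic_at)
    then have "hol_at (\<lambda>w. affine1 (c1 w)) z" by (rule hol_at_affine)
    moreover have "\<forall>\<^sub>F w in nhds z. w \<in> W" using W by (rule eventually_nhds_in_open)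
    then have "\<forall>\<^sub>F w in nhds z. affine1 (c1 w) = h (affine0 w)"
      by eventually_elim (auto simp: W_def c1_def intro: f_inv_into_f)
    ultimately show ?thesis by (rule hol_at_transform)
  qed
qed

lemma disk_isomorphism_inverse:
  fixes \<phi> :: "P1 \<Rightarrow> complex"
  assumes "P1_isomorphism (affine0 \<circ> \<phi>) U (affine0 ` ball 0 1)"
  obtains \<psi> where "\<forall>z\<in>ball 0 1. \<psi> z \<in> U \<and> \<phi> (\<psi> z) = z"
    "\<forall>y\<in>U. \<phi> y \<in> ball 0 1 \<and> \<psi> (\<phi> y) = y"
    "\<forall>z\<in>ball 0 1. hol_at \<psi> z"
    "continuous_on (ball 0 1) \<psi>" "continuous_on U \<phi>"
proof -
  let ?g = "affine0 \<circ> \<phi>"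
  have bij: "bij_betw ?g U (affine0 ` ball 0 1)"
    and hol: "P1_holomorphic_on ?g U" "P1_holomorphic_on (inv_into U ?g) (affine0 ` ball 0 1)"
    using assms by (auto simp: P1_isomorphism_def)
  define \<psi> where "\<psi> = (\<lambda>z. inv_into U ?g (affine0 z))"
  have 1: "\<psi> z \<in> U \<and> \<phi> (\<psi> z) = z" if "z \<in> ball 0 1" for z
  proof -
    have im: "affine0 z \<in> ?g ` U" using that bij by (auto simp: bij_betw_def)
    then have "?g (\<psi> z) = affine0 z" unfolding \<psi>_def by (rule f_inv_into_f)
    then have "\<phi> (\<psi> z) = z" using inj_affine0 by (simp add: inj_eq)
    then show ?thesis using inv_into_into[OF im] by (simp add: \<psi>_def)
  qed
  have 2: "\<phi> y \<in> ball 0 1 \<and> \<psi> (\<phi> y) = y" if "y \<in> U" for y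
  proof -
    have "affine0 (\<phi> y) \<in> affine0 ` ball 0 1" using that bij by (auto simp: bij_betw_def)
    then have "\<phi> y \<in> ball 0 1" using inj_affine0 by (simp add: inj_image_mem_iff)
    moreover have "\<psi> (\<phi> y) = y"
      using inv_into_f_f[OF bij_betw_imp_inj_on[OF bij] that] by (simp add: \<psi>_def)
    ultimately show ?thesis by blast
  qed
  have 3: "hol_at \<psi> z" if "z \<in> ball 0 1" for z
    unfolding \<psi>_def using that by (intro hol_at_P1_holomorphic_on[OF hol(2)]) auto
  have 4: "continuous_on (ball 0 1) \<psi>"
  proof -
    have "continuous_on (affine0 ` ball 0 1) (inv_into U ?g)"
      using hol(2) by (simp add: P1_holomorphic_on_def)
    from continuous_on_compose[OF continuous_on_affine0 this] show ?thesis
      by (simp add: \<psi>_def o_def)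
  qed
  \<comment> \<open>\<open>affine0\<close> is an injective open map, so continuity of
    \<open>affine0 \<circ> \<phi>\<close> descends to \<open>\<phi>\<close>.\<close>
  have 5: "continuous_on U \<phi>"
  proof -
    have U: "open U" "continuous_on U ?g" using hol(1) by (auto simp: P1_holomorphic_on_def)
    have "open (\<phi> -` S \<inter> U)" if "open S" for S
    proof -
      have "open (?g -` (affine0 ` S) \<inter> U)"
        using U(2) open_affine_image(1)[OF that] unfolding continuous_on_open_vimage[OF U(1)] by blast
      moreover have "?g -` (affine0 ` S) = \<phi> -` S"
        by (auto simp: inj_eq[OF inj_affine0])
      ultimately show ?thesis by simp
    qed
    then show ?thesis using U by (simp add: continuous_on_open_vimage)
  qed
  show thesis by (rule that[OF _ _ _ 4 5]) (use 1 2 3 in blast)+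
qed

text \<open>\<open>\<Psi> z\<close> is \<open>f ^^ n\<close> applied to
  \<open>\<psi> (z / \<mu> ^ n)\<close> for any \<open>n\<close> that brings
  \<open>z / \<mu> ^ n\<close> into the unit disk; the conjugacy makes the value independent of
  \<open>n\<close>, and iterates of \<open>f\<close> preserve \<open>hol_at\<close>.\<close>

lemma poincare_extension:
  fixes F :: "complex ^ 2 \<Rightarrow> complex ^ 2" and f :: "P1 \<Rightarrow> P1" and \<mu> :: complex
  assumes F: "\<And>j. hom_poly d (\<lambda>v. F v $ j)" "\<And>v. v \<noteq> 0 \<Longrightarrow> F v \<noteq> 0 \<and> f (pt v) = pt (F v)"
    and \<mu>: "1 < norm \<mu>"
    and \<psi>: "\<And>z. z \<in> ball 0 1 \<Longrightarrow> hol_at \<psi> z"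
    and eq: "\<And>z. z \<in> ball 0 1 \<Longrightarrow> \<mu> * z \<in> ball 0 1 \<Longrightarrow> f (\<psi> z) = \<psi> (\<mu> * z)"
  obtains \<Psi> where "\<forall>z. hol_at \<Psi> z" "\<forall>z. \<Psi> (\<mu> * z) = f (\<Psi> z)"
    "\<forall>z\<in>ball 0 1. \<Psi> z = \<psi> z"
proof -
  define G where "G n z = (f ^^ n) (\<psi> (z / \<mu> ^ n))" for n z
  have \<mu>0: "\<mu> \<noteq> 0" using \<mu> by auto
  have step: "G (Suc n) z = G n z" if "norm z < norm \<mu> ^ n" for n z
  proof -
    have "norm (z / \<mu> ^ n) < 1" using that \<mu>0 by (simp add: norm_divide norm_power)
    moreover have "norm (z / \<mu> ^ Suc n) \<le> norm (z / \<mu> ^ n)"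
      using \<mu> \<mu>0 by (simp add: norm_divide norm_mult norm_power divide_simps mult_le_cancel_left1)
    moreover have "\<mu> * (z / \<mu> ^ Suc n) = z / \<mu> ^ n" using \<mu>0 by simp
    ultimately have "f (\<psi> (z / \<mu> ^ Suc n)) = \<psi> (z / \<mu> ^ n)"
      using eq[of "z / \<mu> ^ Suc n"] by simp
    then show ?thesis by (simp add: G_def funpow_swap1)
  qed
  have mono: "norm \<mu> ^ n \<le> norm \<mu> ^ (n + k)" for n k using \<mu> by (intro power_increasing) auto
  have steps: "G (n + k) z = G n z" if "norm z < norm \<mu> ^ n" for n k z
  proof (induction k)
    case (Suc k)
    then show ?case using step[of z "n + k"] that mono[of n k] by simp
  qed simp
  define N where "N z = (LEAST n. norm z < norm \<mu> ^ n)" for z :: complex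
  have N: "norm z < norm \<mu> ^ N z" "\<And>n. norm z < norm \<mu> ^ n \<Longrightarrow> N z \<le> n" for z
    unfolding N_def using real_arch_pow[OF \<mu>, of "norm z"] by (auto intro: LeastI_ex Least_le)
  define \<Psi> where "\<Psi> z = G (N z) z" for z
  have \<Psi>: "\<Psi> z = G n z" if "norm z < norm \<mu> ^ n" for z n
    using steps[OF N(1), of z "n - N z"] N(2)[OF that] by (simp add: \<Psi>_def)
  have it: "hol_at (\<lambda>w. (f ^^ n) (\<Phi> w)) z" if "hol_at \<Phi> z" for n \<Phi> z
  proof (induction n)
    case (Suc n)
    then show ?case using hol_at_hom_poly[OF F Suc.IH] by simp
  qed (use that in simp)
  have "hol_at \<Psi> z" for z
  proof -
    define n where "n = N z"
    have z: "norm z < norm \<mu> ^ n" using N by (simp add: n_def)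
    have "z \<in> ball 0 (norm \<mu> ^ n)" using z by simp
    then have "\<forall>\<^sub>F w in nhds z. w \<in> ball 0 (norm \<mu> ^ n)" by (intro eventually_nhds_in_open) auto
    then have "\<forall>\<^sub>F w in nhds z. G n w = \<Psi> w" by eventually_elim (simp add: \<Psi>)
    moreover have "hol_at (G n) z"
      unfolding G_def
    proof (intro it hol_at_compose[where g = "\<lambda>z. z / \<mu> ^ n"] \<psi>)
      show "z / \<mu> ^ n \<in> ball 0 1" using z \<mu>0 by (simp add: norm_divide norm_power)
      show "(\<lambda>z. z / \<mu> ^ n) analytic_on {z}" using \<mu>0 by (intro analytic_intros) auto
    qed
    ultimately show ?thesis by (rule hol_at_transform[rotated])
  qed
  moreover have "\<Psi> (\<mu> * z) = f (\<Psi> z)" for z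
  proof -
    have "norm (\<mu> * z) < norm \<mu> ^ Suc (N z)"
      using N(1)[of z] \<mu>0 by (simp add: norm_mult)
    from \<Psi>[OF this] show ?thesis using \<mu>0 by (simp add: G_def \<Psi>_def)
  qed
  moreover have "\<Psi> z = \<psi> z" if "z \<in> ball 0 1" for z
    using \<Psi>[of z 0] that by (simp add: G_def)
  ultimately show thesis by (intro that) blast+
qed

text \<open>If \<open>A\<close> is a symmetry, so is its conjugate
  \<open>w \<mapsto> \<mu> * A (w / \<mu>)\<close>, because its effect on \<open>\<Psi>\<close>
  passes through \<open>f\<close>. For \<open>A w = C * w - b\<close> the conjugate is
  \<open>C * w - \<mu> * b\<close>, which differs from \<open>A\<close> by a translation.\<close>

lemma affine_symmetry_period:
  fixes \<Psi> :: "complex \<Rightarrow> 'a" and \<mu> C b :: complex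
  assumes "\<And>z. \<Psi> (\<mu> * z) = f (\<Psi> z)" "\<And>w. \<Psi> w = \<Psi> (C * w - b)" "C \<noteq> 0" "\<mu> \<noteq> 0"
  shows "\<Psi> (u + (1 - \<mu>) * b) = \<Psi> u"
proof -
  define w where "w = (u + b) / C"
  have u: "u = C * w - b" using assms(3) by (simp add: w_def)
  have "\<Psi> (C * w - \<mu> * b) = \<Psi> (\<mu> * (C * (w / \<mu>) - b))"
    using assms(4) by (simp add: algebra_simps)
  also have "\<dots> = f (\<Psi> (C * (w / \<mu>) - b))" by (rule assms(1))
  also have "\<dots> = f (\<Psi> (w / \<mu>))" by (simp only: assms(2)[symmetric])
  also have "\<dots> = \<Psi> w" using assms(1)[of "w / \<mu>"] assms(4) by simp
  also have "\<dots> = \<Psi> u" using assms(2) u by simp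
  finally show ?thesis by (simp add: u algebra_simps)
qed


section \<open>The good return map in the linearizing coordinate\<close>

lemma compact_in_unit_ball:
  fixes S :: "complex set"
  assumes "S \<subseteq> ball 0 1" "compact S"
  obtains r where "0 < r" "r < 1" "S \<subseteq> cball 0 r"
proof (cases "S = {}")
  case True
  then show thesis by (intro that[of "1/2"]) auto
next
  case False
  then obtain s where s: "s \<in> S" "\<And>t. t \<in> S \<Longrightarrow> norm t \<le> norm s"
    using continuous_attains_sup[of S norm] assms(2) by (auto intro: continuous_intros)
  have "norm s < 1" using s assms by auto
  show thesis
  proof (rule that[of "(norm s + 1) / 2"])
    show "S \<subseteq> cball 0 ((norm s + 1) / 2)" using s \<open>norm s < 1\<close> by fastforce
  qed (use \<open>norm s < 1\<close> in \<open>auto intro: add_nonneg_pos\<close>)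
qed

text \<open>The identity theorem, applied to the derivative: it equals \<open>D\<close> along a
  sequence of points other than \<open>a\<close> that tends to \<open>a\<close>.\<close>

lemma affine_of_frequent_deriv:
  assumes "\<sigma> analytic_on {a}" "w \<longlonglongrightarrow> a"
    and "\<forall>\<^sub>F n in sequentially. deriv \<sigma> (w n) = D \<and> w n \<noteq> (a::complex)"
  shows "\<forall>\<^sub>F u in nhds a. \<sigma> u = \<sigma> a + D * (u - a)"
proof -
  have an: "(\<lambda>u. deriv \<sigma> u - D) analytic_on {a}"
    using assms(1) by (intro analytic_intros analytic_deriv)
  have "filterlim w (at a) sequentially"
    using assms(2,3) by (auto simp: filterlim_at elim: eventually_mono)
  then have "\<not> (\<forall>\<^sub>F u in at a. deriv \<sigma> u - D \<noteq> 0)"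
  proof (intro notI)
    assume "\<forall>\<^sub>F u in at a. deriv \<sigma> u - D \<noteq> 0"
    then have "\<forall>\<^sub>F n in sequentially. deriv \<sigma> (w n) - D \<noteq> 0"
      using \<open>filterlim w (at a) sequentially\<close> by (rule eventually_compose_filterlim)
    with assms(3) have "\<forall>\<^sub>F n in sequentially. False" by eventually_elim auto
    then show False by simp
  qed
  with analytic_zero_dichotomy[OF an] have "\<forall>\<^sub>F u in nhds a. deriv \<sigma> u - D = 0" by blast
  moreover obtain e where e: "e > 0" "\<sigma> holomorphic_on ball a e"
    using assms(1) analytic_at_ball by blast
  ultimately obtain e' where e': "e' > 0" "\<And>u. u \<in> ball a e' \<Longrightarrow> deriv \<sigma> u = D"
    by (auto simp: eventually_nhds_metric dist_commute)
  define B where "B = ball a (min e e')"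
  have der: "((\<lambda>u. \<sigma> u - D * u) has_field_derivative 0) (at u within B)" if "u \<in> B" for u
  proof -
    have "(\<sigma> has_field_derivative deriv \<sigma> u) (at u)"
      using e(2) that by (auto simp: B_def intro!: holomorphic_derivI)
    moreover have "deriv \<sigma> u = D" using that e'(2) by (auto simp: B_def)
    ultimately have "((\<lambda>u. \<sigma> u - D * u) has_field_derivative 0) (at u)"
      by (auto intro!: derivative_eq_intros)
    then show ?thesis by (rule has_field_derivative_at_within)
  qed
  obtain c where c: "\<And>u. u \<in> B \<Longrightarrow> \<sigma> u - D * u = c"
    using has_field_derivative_zero_constant[OF _ der] by (auto simp: B_def)
  have B: "open B" "a \<in> B" using e e' by (auto simp: B_def)
  have "\<forall>\<^sub>F u in nhds a. u \<in> B" using B by (rule eventually_nhds_in_open)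
  then show ?thesis
    by eventually_elim (use c[OF B(2)] c in \<open>auto simp: algebra_simps\<close>)
qed

text \<open>Near \<open>p\<close> the iterates of \<open>f\<close> are linear in the coordinate, so
  the multiplier at \<open>q (m + n)\<close> splits into \<open>\<mu> ^ n\<close> and the derivative
  of the return map \<open>f ^^ m\<close> at a point close to \<open>x m\<close>.\<close>

theorem homoclinic_period:
  fixes F :: "complex ^ 2 \<Rightarrow> complex ^ 2" and f :: "P1 \<Rightarrow> P1" and \<mu> C :: complex
  assumes F: "\<And>j. hom_poly d (\<lambda>v. F v $ j)" "\<And>v. v \<noteq> 0 \<Longrightarrow> F v \<noteq> 0 \<and> f (pt v) = pt (F v)"
    and hom: "homoclinic_orbit f p x" and \<mu>: "P1_deriv f p = \<mu>" and C: "C \<noteq> 0"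
    and adj: "adjoint_sequence f x q"
    and mult: "\<forall>\<^sub>F i in sequentially. P1_deriv (f ^^ i) (q i) = C * \<mu> ^ i"
  obtains \<Psi> t where "\<forall>z. hol_at \<Psi> z" "\<forall>z. \<Psi> (\<mu> * z) = f (\<Psi> z)" "inj_on \<Psi> (ball 0 1)"
    "t \<noteq> 0" "\<forall>z. \<Psi> (z + t) = \<Psi> z"
proof -
  have fp: "f p = p" and \<mu>1: "1 < norm \<mu>" and x0: "x 0 = p" and x1: "x 1 \<noteq> p"
    and fx: "\<And>i. i \<ge> 1 \<Longrightarrow> f (x i) = x (i - 1)"
    using hom \<mu> by (auto simp: homoclinic_orbit_def repelling_fixed_point_def)
  have \<mu>0: "\<mu> \<noteq> 0" using \<mu>1 by auto
  obtain U m where "adjoint_sequence_wrt f x U m q"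
    using adj unfolding adjoint_sequence_def by blast
  then have lin: "linearization_domain f p U" and good: "good_return_time f x U m"
    and q: "\<And>i. i \<ge> m \<Longrightarrow> {y \<in> pullback f x U i. (f ^^ i) y = y} = {q i}"
    by (simp_all add: adjoint_sequence_wrt_def x0)
  obtain \<phi> where iso: "P1_isomorphism (affine0 \<circ> \<phi>) U (affine0 ` ball 0 1)"
    and \<phi>p: "\<phi> p = 0" and pU: "p \<in> U"
    and im: "\<phi> ` (f -` U \<inter> U) = {z \<in> ball 0 1. \<mu> * z \<in> ball 0 1}"
    and \<phi>f: "\<And>y. y \<in> U \<Longrightarrow> f y \<in> U \<Longrightarrow> \<phi> (f y) = \<mu> * \<phi> y"
    using lin unfolding linearization_domain_def Let_def \<mu> by auto
  obtain \<psi> where \<psi>_inv: "\<forall>z\<in>ball 0 1. \<psi> z \<in> U \<and> \<phi> (\<psi> z) = z"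
      "\<forall>y\<in>U. \<phi> y \<in> ball 0 1 \<and> \<psi> (\<phi> y) = y" "\<forall>z\<in>ball 0 1. hol_at \<psi> z"
    and \<psi>_cont: "continuous_on (ball 0 1) \<psi>" and \<phi>_cont: "continuous_on U \<phi>"
    by (rule disk_isomorphism_inverse[OF iso])
  note \<psi> = \<psi>_inv(1,2)[rule_format] and \<psi>_hol = \<psi>_inv(3)[rule_format]
  have inj_\<psi>: "inj_on \<psi> (ball 0 1)" using \<psi>(1) by (metis inj_onI)
  have \<psi>0: "\<psi> 0 = p" using \<psi>(2)[OF pU] \<phi>p by simp
  \<comment> \<open>By the image condition, every \<open>z\<close> for which both sides make sense
    is the coordinate of a point of \<open>U\<close> whose image stays in \<open>U\<close>.\<close>
  have f\<psi>: "f (\<psi> z) = \<psi> (\<mu> * z)" if "z \<in> ball 0 1" "\<mu> * z \<in> ball 0 1" for z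
  proof -
    have "z \<in> \<phi> ` (f -` U \<inter> U)" using that im by blast
    then obtain y where y: "y \<in> U" "f y \<in> U" "z = \<phi> y" by auto
    then have "f (\<psi> z) = f y" using \<psi>(2) by simp
    also have "\<dots> = \<psi> (\<phi> (f y))" using \<psi>(2) y by simp
    also have "\<dots> = \<psi> (\<mu> * z)" using \<phi>f y by simp
    finally show ?thesis .
  qed
  have scale: "norm (z / \<mu> ^ n) \<le> norm z" for z n
  proof -
    have "1 \<le> norm \<mu> ^ n" using \<mu>1 by (intro one_le_power) auto
    then show ?thesis using \<mu>0
      by (simp add: norm_divide norm_power divide_simps mult_le_cancel_left1)
  qed
  have f\<psi>n: "(f ^^ n) (\<psi> (z / \<mu> ^ n)) = \<psi> z" if "z \<in> ball 0 1" for n z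
  proof (induction n)
    case (Suc n)
    have "\<mu> * (z / \<mu> ^ Suc n) = z / \<mu> ^ n" using \<mu>0 by simp
    then have "f (\<psi> (z / \<mu> ^ Suc n)) = \<psi> (z / \<mu> ^ n)"
      using f\<psi>[of "z / \<mu> ^ Suc n"] scale[of z n] scale[of z "Suc n"] that by simp
    then show ?case using Suc by (simp add: funpow_swap1)
  qed simp

  define V where "V = pullback f x U m"
  have m1: "m \<ge> 1" and xU: "\<And>i. i \<ge> m \<Longrightarrow> x i \<in> U"
    and K: "compact (closure V)" "closure V \<subseteq> U" and isoV: "P1_isomorphism (f ^^ m) V U"
    using good unfolding good_return_time_def V_def by auto
  have VU: "V \<subseteq> U" using K closure_subset by blast
  have fxn: "(f ^^ n) (x (i + n)) = x i" for i n
  proof (induction n)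
    case (Suc n)
    then show ?case using fx[of "i + Suc n"] by (simp add: funpow_swap1)
  qed simp
  have xmV: "x m \<in> V"
    unfolding V_def pullback_def using fxn[of m 0] x0 pU by (auto intro: connected_component_refl)
  define a where "a = \<phi> (x m)"
  have a: "a \<in> ball 0 1" "\<psi> a = x m" using \<psi>(2)[OF xU[of m]] by (auto simp: a_def)
  \<comment> \<open>Otherwise \<open>x m = p\<close>, and \<open>m - 1\<close> applications of
    \<open>f\<close> lead to \<open>x 1 = p\<close>.\<close>
  have a0: "a \<noteq> 0"
  proof
    assume "a = 0"
    then have "x m = p" using a \<psi>0 by simp
    moreover have "(f ^^ n) p = p" for n by (induction n) (auto simp: fp)
    ultimately show False using fxn[of "m - 1" 1] m1 x1 by simp
  qed
  \<comment> \<open>Relative compactness of \<open>V\<close> keeps its coordinates in a closed disk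
    of radius \<open>r < 1\<close>, on which the fixed point theorem below operates.\<close>
  have "\<phi> ` closure V \<subseteq> ball 0 1" using K(2) \<psi>(2) by blast
  moreover have "compact (\<phi> ` closure V)"
    using \<phi>_cont K by (blast intro: compact_continuous_image continuous_on_subset)
  ultimately obtain r where r: "0 < r" "r < 1" "\<phi> ` closure V \<subseteq> cball 0 r"
    by (rule compact_in_unit_ball)
  have bij: "bij_betw (f ^^ m) V U" and inv_cont: "continuous_on U (inv_into V (f ^^ m))"
    using isoV by (auto simp: P1_isomorphism_def P1_holomorphic_on_def)
  \<comment> \<open>\<open>k\<close> is the inverse of the good return map, read in the linearizing
    coordinate.\<close>
  define k where "k w = \<phi> (inv_into V (f ^^ m) (\<psi> w))" for w
  have inv: "inv_into V (f ^^ m) y \<in> V" "(f ^^ m) (inv_into V (f ^^ m) y) = y" if "y \<in> U" for y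
    using that bij by (auto simp: bij_betw_def intro: inv_into_into f_inv_into_f)
  have k: "k w \<in> \<phi> ` V" "(f ^^ m) (\<psi> (k w)) = \<psi> w" if "w \<in> ball 0 1" for w
    using inv[of "\<psi> w"] \<psi>(1)[OF that] \<psi>(2) VU by (auto simp: k_def subset_iff)
  have k_ball: "k w \<in> cball 0 r" if "w \<in> ball 0 1" for w
    using k(1)[OF that] r(3) closure_subset[of V] by blast
  have k_cont: "continuous_on (ball 0 1) k"
    unfolding k_def
  proof (rule continuous_on_compose2[OF \<phi>_cont])
    show "continuous_on (ball 0 1) (\<lambda>w. inv_into V (f ^^ m) (\<psi> w))"
      using \<psi>(1) by (intro continuous_on_compose2[OF inv_cont \<psi>_cont]) auto
    show "(\<lambda>w. inv_into V (f ^^ m) (\<psi> w)) ` ball 0 1 \<subseteq> U" using inv VU \<psi>(1) by blast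
  qed
  have fmx: "(f ^^ m) (x m) = p" using fxn[of m 0] x0 by simp
  have k0: "k 0 = a"
    using inv_into_f_f[OF bij_betw_imp_inj_on[OF bij] xmV] by (simp add: k_def \<psi>0 fmx a_def)

  \<comment> \<open>Division by \<open>\<mu> ^ n\<close> is the inverse branch of
    \<open>f ^^ n\<close> that fixes \<open>p\<close>, so these fixed points give periodic points of
    \<open>f\<close>. Brouwer applies since \<open>k\<close> is continuous with values in the
    smaller disk.\<close>
  have "\<exists>w\<in>cball 0 r. k (w / \<mu> ^ n) = w" for n
  proof -
    have sc: "w / \<mu> ^ n \<in> ball 0 1" if "w \<in> cball 0 r" for w
      using scale[of w n] that r by simp
    have "continuous_on (cball 0 r) (\<lambda>w. k (w / \<mu> ^ n))"
      using sc \<mu>0 by (intro continuous_on_compose2[OF k_cont] continuous_intros) auto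
    moreover have "(\<lambda>w. k (w / \<mu> ^ n)) \<in> cball 0 r \<rightarrow> cball 0 r" using sc k_ball by blast
    moreover have "cball (0::complex) r \<noteq> {}" using r by simp
    ultimately obtain w where "w \<in> cball 0 r" "k (w / \<mu> ^ n) = w"
      using brouwer[OF compact_cball convex_cball] by blast
    then show ?thesis by blast
  qed
  then obtain w where w: "\<And>n. w n \<in> cball 0 r" "\<And>n. k (w n / \<mu> ^ n) = w n" by metis
  have w1: "w n \<in> ball 0 1" for n using w(1)[of n] r by simp
  define z where "z n = w n / \<mu> ^ n" for n
  have z1: "z n \<in> ball 0 1" for n using scale[of "w n" n] w1[of n] by (simp add: z_def)
  have kz: "k (z n) = w n" for n using w by (simp add: z_def)
  have z_lim: "z \<longlonglongrightarrow> 0"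
  proof (rule Lim_null_comparison)
    show "\<forall>\<^sub>F n in sequentially. norm (z n) \<le> inverse (norm \<mu>) ^ n"
    proof (rule always_eventually, rule allI)
      fix n show "norm (z n) \<le> inverse (norm \<mu>) ^ n"
        using w1[of n] \<mu>0 by (simp add: z_def norm_divide norm_power divide_simps power_inverse)
    qed
    show "(\<lambda>n. inverse (norm \<mu>) ^ n) \<longlonglongrightarrow> 0"
      using \<mu>1 by (intro LIMSEQ_power_zero) (auto simp: inverse_less_1_iff)
  qed
  have w_lim: "w \<longlonglongrightarrow> a"
  proof -
    have "isCont k 0" using k_cont by (simp add: continuous_on_eq_continuous_at)
    then have "(\<lambda>n. k (z n)) \<longlonglongrightarrow> k 0" using z_lim by (rule isCont_tendsto_compose)
    then show ?thesis by (simp add: kz k0)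
  qed
  have fmz: "(f ^^ m) (\<psi> (w n)) = \<psi> (z n)" for n using k(2)[OF z1[of n]] by (simp add: kz)
  have fnz: "(f ^^ n) (\<psi> (z n)) = \<psi> (w n)" for n unfolding z_def by (rule f\<psi>n[OF w1])
  have x_shift: "x (m + n) = \<psi> (a / \<mu> ^ n)" for n
  proof (induction n)
    case (Suc n)
    have U: "x (m + Suc n) \<in> U" "x (m + n) \<in> U" using xU by auto
    have "f (x (m + Suc n)) = x (m + n)" using fx[of "m + Suc n"] by simp
    then have "\<phi> (x (m + n)) = \<mu> * \<phi> (x (m + Suc n))" using \<phi>f[OF U(1)] U(2) by simp
    moreover have "\<phi> (x (m + n)) = a / \<mu> ^ n" using Suc \<psi>(1) scale[of a n] a by simp
    ultimately have "\<phi> (x (m + Suc n)) = a / \<mu> ^ Suc n" using \<mu>0 by (simp add: field_simps)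
    then show ?case using \<psi>(2)[OF U(1)] by metis
  qed (simp add: a)
  \<comment> \<open>\<open>S\<close> is the image of \<open>V\<close> under that inverse branch. It
    is connected, contains \<open>x (m + n)\<close> and \<open>\<psi> (z n)\<close>, and
    \<open>f ^^ (m + n)\<close> maps it into \<open>U\<close>; so the fixed point lies in the
    component that defines \<open>q (m + n)\<close>.\<close>
  have qz: "q (m + n) = \<psi> (z n)" for n
  proof -
    define S where "S = (\<lambda>u. \<psi> (\<phi> u / \<mu> ^ n)) ` V"
    have in1: "\<phi> u / \<mu> ^ n \<in> ball 0 1" if "u \<in> V" for u
      using scale[of "\<phi> u" n] \<psi>(2) VU that by (metis (no_types) mem_ball_0 order_le_less_trans subsetD)
    have "connected V" by (simp add: V_def pullback_def)
    moreover have "continuous_on V (\<lambda>u. \<psi> (\<phi> u / \<mu> ^ n))"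
      using in1 \<mu>0 \<phi>_cont VU
      by (intro continuous_on_compose2[OF \<psi>_cont] continuous_intros) (auto intro: continuous_on_subset)
    ultimately have conn: "connected S" unfolding S_def by (rule connected_continuous_image[rotated])
    have xS: "x (m + n) \<in> S" using xmV by (auto simp: S_def x_shift a_def)
    have zS: "\<psi> (z n) \<in> S"
    proof -
      obtain u where "u \<in> V" "w n = \<phi> u" using k(1)[OF z1[of n]] unfolding kz by blast
      then show ?thesis unfolding S_def z_def by (intro image_eqI[of _ _ u]) simp_all
    qed
    have "(f ^^ (m + n)) y \<in> U" if "y \<in> S" for y
    proof -
      obtain u where u: "u \<in> V" "y = \<psi> (\<phi> u / \<mu> ^ n)" using \<open>y \<in> S\<close> by (auto simp: S_def)
      then have uU: "u \<in> U" using VU by blast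
      have "(f ^^ n) y = u" using f\<psi>n[of "\<phi> u" n] \<psi>(2)[OF uU] u by simp
      then have "(f ^^ (m + n)) y = (f ^^ m) u" by (simp add: funpow_add)
      then show ?thesis using bij u(1) by (auto simp: bij_betw_def)
    qed
    then have "S \<subseteq> pullback f x U (m + n)"
      unfolding pullback_def by (intro connected_component_maximal[OF xS conn]) auto
    then have "\<psi> (z n) \<in> pullback f x U (m + n)" using zS by blast
    moreover have "(f ^^ (m + n)) (\<psi> (z n)) = \<psi> (z n)" by (simp add: funpow_add fnz fmz)
    ultimately have "\<psi> (z n) \<in> {y \<in> pullback f x U (m + n). (f ^^ (m + n)) y = y}" by blast
    then show ?thesis unfolding q[OF le_add1] by simp
  qed

  have hol_it: "hol_at (\<lambda>w. (f ^^ n) (\<psi> w)) y" if "y \<in> ball 0 1" for n y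
  proof (induction n)
    case (Suc n)
    then show ?case using hol_at_hom_poly[OF F Suc.IH] by simp
  qed (use that \<psi>_hol in simp)
  \<comment> \<open>The return map itself, as a germ at \<open>a\<close>; it vanishes there because
    \<open>f ^^ m\<close> sends \<open>x m\<close> to \<open>p\<close>.\<close>
  obtain \<sigma> where \<sigma>: "\<sigma> analytic_on {a}" "\<sigma> a = 0" "\<forall>\<^sub>F w in nhds a. \<psi> (\<sigma> w) = (f ^^ m) (\<psi> w)"
  proof (rule hol_at_transfer[OF hol_it[OF a(1), of m] \<psi>_hol[of 0]])
    show "(f ^^ m) (\<psi> a) = \<psi> 0" by (simp add: a(2) fmx \<psi>0)
    show "inj_on \<psi> (ball 0 1)" by (rule inj_\<psi>)
  qed auto
  have ev: "\<forall>\<^sub>F w in nhds a. w \<in> ball 0 1 \<and> \<sigma> w \<in> ball 0 1 \<and> \<sigma> analytic_on {w} \<and>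
      (\<forall>\<^sub>F u in nhds w. \<psi> (\<sigma> u) = (f ^^ m) (\<psi> u))"
  proof (intro eventually_conj)
    show "\<forall>\<^sub>F w in nhds a. w \<in> ball 0 1" using a(1) by (intro eventually_nhds_in_open) auto
    have "\<forall>\<^sub>F w in nhds 0. (w::complex) \<in> ball 0 1" by (intro eventually_nhds_in_open) auto
    then show "\<forall>\<^sub>F w in nhds a. \<sigma> w \<in> ball 0 1"
      using analytic_at_tendsto_nhds[OF \<sigma>(1)] unfolding \<sigma>(2) by (rule eventually_compose_filterlim)
    show "\<forall>\<^sub>F w in nhds a. \<sigma> analytic_on {w}"
      using \<sigma>(1) by (auto simp: analytic_at eventually_nhds)
    show "\<forall>\<^sub>F w in nhds a. \<forall>\<^sub>F u in nhds w. \<psi> (\<sigma> u) = (f ^^ m) (\<psi> u)"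
      using \<sigma>(3) by (auto simp: eventually_nhds)
  qed
  \<comment> \<open>Near \<open>\<psi> (z n)\<close> the map \<open>f ^^ (m + n)\<close> reads
    \<open>u \<mapsto> \<sigma> (\<mu> ^ n * u)\<close> in the coordinate.\<close>
  have fix_mult: "P1_deriv (f ^^ (m + n)) (\<psi> (z n)) = deriv \<sigma> (w n) * \<mu> ^ n \<and> \<sigma> (w n) = z n"
    if wn: "w n \<in> ball 0 1 \<and> \<sigma> (w n) \<in> ball 0 1 \<and> \<sigma> analytic_on {w n} \<and>
      (\<forall>\<^sub>F u in nhds (w n). \<psi> (\<sigma> u) = (f ^^ m) (\<psi> u))" for n
  proof
    have wz: "\<mu> ^ n * z n = w n" using \<mu>0 by (simp add: z_def)
    have "\<forall>\<^sub>F u in nhds (w n). \<psi> (\<sigma> u) = (f ^^ m) (\<psi> u)" using wn by blast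
    from eventually_nhds_x_imp_x[OF this] have "\<psi> (\<sigma> (w n)) = \<psi> (z n)" by (simp add: fmz)
    then show sz: "\<sigma> (w n) = z n" using inj_\<psi> wn z1 by (auto dest: inj_onD)
    let ?s = "\<lambda>u. \<sigma> (\<mu> ^ n * u)"
    have lim: "((\<lambda>u. \<mu> ^ n * u) \<longlongrightarrow> w n) (nhds (z n))"
      unfolding wz[symmetric] by (intro tendsto_intros filterlim_ident)
    have s_an: "(\<sigma> \<circ> (\<lambda>u. \<mu> ^ n * u)) analytic_on {z n}"
      using wn by (intro analytic_on_compose analytic_intros) (simp add: wz)
    have "\<forall>\<^sub>F u in nhds (w n). \<psi> (\<sigma> u) = (f ^^ m) (\<psi> u) \<and> u \<in> ball 0 1"
      using wn by (intro eventually_conj eventually_nhds_in_open) auto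
    then have "\<forall>\<^sub>F u in nhds (z n). \<psi> (\<sigma> (\<mu> ^ n * u)) = (f ^^ m) (\<psi> (\<mu> ^ n * u)) \<and>
        \<mu> ^ n * u \<in> ball 0 1"
      using lim by (rule eventually_compose_filterlim)
    then have "\<forall>\<^sub>F u in nhds (z n). (f ^^ (m + n)) (\<psi> u) = \<psi> (?s u)"
    proof eventually_elim
      case (elim u)
      then have "(f ^^ n) (\<psi> u) = \<psi> (\<mu> ^ n * u)"
        using f\<psi>n[of "\<mu> ^ n * u" n] \<mu>0 by simp
      then show ?case using elim by (simp add: funpow_add)
    qed
    moreover obtain \<rho> where \<rho>: "\<rho> > 0" "ball (z n) \<rho> \<subseteq> ball 0 1"
      using z1[of n] open_ball by (metis openE)
    then have "inj_on \<psi> (ball (z n) \<rho>)" using inj_\<psi> by (blast intro: inj_on_subset)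
    ultimately have "P1_deriv (f ^^ (m + n)) (\<psi> (z n)) = deriv ?s (z n)"
      using s_an \<psi>_hol[OF z1] \<rho>(1) by (intro P1_deriv_conjugate) (auto simp: o_def wz sz)
    also have "(?s has_field_derivative deriv \<sigma> (w n) * (\<mu> ^ n)) (at (z n))"
    proof (rule DERIV_chain2[where f = \<sigma> and g = "\<lambda>u. \<mu> ^ n * u"])
      show "(\<sigma> has_field_derivative deriv \<sigma> (w n)) (at (\<mu> ^ n * z n))"
        using analytic_on_imp_differentiable_at[of \<sigma> "{w n}" "w n"] wn
        by (simp add: wz DERIV_deriv_iff_field_differentiable)
      show "((\<lambda>u. \<mu> ^ n * u) has_field_derivative \<mu> ^ n) (at (z n))"
        by (auto intro!: derivative_eq_intros)
    qed
    then have "deriv ?s (z n) = deriv \<sigma> (w n) * \<mu> ^ n" by (rule DERIV_imp_deriv)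
    finally show "P1_deriv (f ^^ (m + n)) (\<psi> (z n)) = deriv \<sigma> (w n) * \<mu> ^ n" .
  qed
  \<comment> \<open>The multiplier \<open>C * \<mu> ^ (m + n)\<close> equals
    \<open>deriv \<sigma> (w n) * \<mu> ^ n\<close>, hence this value.\<close>
  define D where "D = C * \<mu> ^ m"
  have D0: "D \<noteq> 0" using C \<mu>0 by (simp add: D_def)
  have evw: "\<forall>\<^sub>F n in sequentially. deriv \<sigma> (w n) = D \<and> w n \<noteq> a"
  proof -
    have "\<forall>\<^sub>F n in sequentially. P1_deriv (f ^^ (m + n)) (q (m + n)) = C * \<mu> ^ (m + n)"
      using mult by (subst (asm) eventually_sequentially_seg[of _ m, symmetric]) (simp add: add.commute)
    moreover have "\<forall>\<^sub>F n in sequentially. w n \<in> ball 0 1 \<and> \<sigma> (w n) \<in> ball 0 1 \<and> \<sigma> analytic_on {w n} \<and>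
      (\<forall>\<^sub>F u in nhds (w n). \<psi> (\<sigma> u) = (f ^^ m) (\<psi> u))"
      using ev w_lim by (rule eventually_compose_filterlim)
    ultimately show ?thesis
    proof eventually_elim
      case (elim n)
      have fm: "P1_deriv (f ^^ (m + n)) (\<psi> (z n)) = deriv \<sigma> (w n) * \<mu> ^ n" "\<sigma> (w n) = z n"
        using fix_mult[OF elim(2)] by blast+
      have "deriv \<sigma> (w n) = D"
        using fm(1) elim(1) \<mu>0 by (simp add: qz D_def power_add)
      \<comment> \<open>\<open>\<sigma>\<close> sends \<open>a\<close> to 0 but \<open>w n\<close>
        to \<open>w n / \<mu> ^ n\<close>, which would be nonzero for
        \<open>w n = a\<close>.\<close>
      moreover have "w n \<noteq> a"
      proof
        assume "w n = a"
        then have "z n = 0" using fm(2) \<sigma>(2) by simp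
        then show False using \<open>w n = a\<close> a0 \<mu>0 by (simp add: z_def)
      qed
      ultimately show ?case by blast
    qed
  qed
  have \<sigma>_affine: "\<forall>\<^sub>F u in nhds a. \<sigma> u = D * (u - a)"
    using affine_of_frequent_deriv[OF \<sigma>(1) w_lim evw] \<sigma>(2) by simp

  obtain \<Psi> where \<Psi>_all: "\<forall>z. hol_at \<Psi> z" "\<forall>z. \<Psi> (\<mu> * z) = f (\<Psi> z)"
      "\<forall>z\<in>ball 0 1. \<Psi> z = \<psi> z"
    by (rule poincare_extension[OF F \<mu>1 \<psi>_hol f\<psi>])
  note \<Psi> = \<Psi>_all[rule_format]
  have iter: "\<Psi> (\<mu> ^ n * u) = (f ^^ n) (\<Psi> u)" for n u
  proof (induction n)
    case (Suc n)
    then show ?case using \<Psi>(2)[of "\<mu> ^ n * u"] by (simp add: mult.assoc)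
  qed simp
  \<comment> \<open>Both sides are \<open>f ^^ m\<close> applied to \<open>\<psi> u\<close>, once
    through the functional equation and once through \<open>\<sigma>\<close>.\<close>
  have "\<forall>\<^sub>F u in nhds a. \<Psi> (\<mu> ^ m * u) = \<Psi> (D * (u - a))"
    using ev \<sigma>_affine
  proof eventually_elim
    case (elim u)
    then have "\<psi> (\<sigma> u) = (f ^^ m) (\<psi> u)" by (blast dest: eventually_nhds_x_imp_x)
    then show ?case using elim \<Psi>(3) iter by simp
  qed
  then have "\<forall>\<^sub>F u in at a. \<Psi> (\<mu> ^ m * u) = \<Psi> (D * (u - a))" by (rule eventually_nhds_imp_at)
  then have "\<exists>\<^sub>F u in at a. \<Psi> (\<mu> ^ m * u) = \<Psi> (D * (u - a))"
    by (rule eventually_frequently[rotated]) simp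
  moreover have "hol_at (\<lambda>u. \<Psi> (\<mu> ^ m * u)) z" for z
    by (rule hol_at_compose[of \<Psi> "\<lambda>u. \<mu> ^ m * u", OF \<Psi>(1)]) (intro analytic_intros)
  moreover have "hol_at (\<lambda>u. \<Psi> (D * (u - a))) z" for z
    by (rule hol_at_compose[of \<Psi> "\<lambda>u. D * (u - a)", OF \<Psi>(1)]) (intro analytic_intros)
  ultimately have "(\<lambda>u. \<Psi> (\<mu> ^ m * u)) = (\<lambda>u. \<Psi> (D * (u - a)))"
    by (intro hol_at_identity[where ?z0.0 = a])
  then have sym: "\<Psi> (\<mu> ^ m * u) = \<Psi> (D * (u - a))" for u by (rule fun_cong)
  \<comment> \<open>Dividing the argument by \<open>\<mu> ^ m\<close> turns the slope
    \<open>D\<close> into \<open>C\<close>.\<close>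
  have sym': "\<Psi> v = \<Psi> (C * v - D * a)" for v
    using sym[of "v / \<mu> ^ m"] \<mu>0 by (simp add: D_def algebra_simps)
  have "inj_on \<Psi> (ball 0 1)"
    using inj_\<psi> inj_on_cong[of "ball 0 1" \<Psi> \<psi>] \<Psi>(3) by simp
  moreover have "(1 - \<mu>) * (D * a) \<noteq> 0"
  proof -
    have "\<mu> \<noteq> 1" using \<mu>1 by force
    then show ?thesis using D0 a0 by simp
  qed
  moreover have "\<forall>u. \<Psi> (u + (1 - \<mu>) * (D * a)) = \<Psi> u"
    using affine_symmetry_period[of \<Psi> \<mu> f C "D * a", OF \<Psi>(2) sym' C \<mu>0] by simp
  ultimately show thesis by (rule that[OF \<Psi>_all(1,2)])
qed

section \<open>Homogeneous polynomials and ratios of homogeneous coordinates\<close>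

lemma hom_poly_monomial:
  fixes \<alpha> :: "'n::finite \<Rightarrow> nat"
  assumes "(\<Sum>i\<in>UNIV. \<alpha> i) = d"
  shows "hom_poly d (\<lambda>v. c * (\<Prod>i\<in>UNIV. (v $ i) ^ \<alpha> i))"
  unfolding hom_poly_def
proof (intro exI allI)
  fix v :: "complex ^ 'n"
  have "(\<Sum>\<beta> | (\<Sum>i\<in>UNIV. \<beta> i) = d. (if \<beta> = \<alpha> then c else 0) * (\<Prod>i\<in>UNIV. (v $ i) ^ \<beta> i)) =
      (\<Sum>\<beta> | (\<Sum>i\<in>UNIV. \<beta> i) = d. if \<beta> = \<alpha> then c * (\<Prod>i\<in>UNIV. (v $ i) ^ \<alpha> i) else 0)"
    by (intro sum.cong) auto
  also have "\<dots> = c * (\<Prod>i\<in>UNIV. (v $ i) ^ \<alpha> i)"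
    using assms by (subst sum.delta) (auto simp: finite_exponents)
  finally show "c * (\<Prod>i\<in>UNIV. (v $ i) ^ \<alpha> i) =
      (\<Sum>\<beta> | (\<Sum>i\<in>UNIV. \<beta> i) = d. (if \<beta> = \<alpha> then c else 0) * (\<Prod>i\<in>UNIV. (v $ i) ^ \<beta> i))" ..
qed

lemma hom_poly_zero: "hom_poly d (\<lambda>v. 0)"
  unfolding hom_poly_def by (intro exI[of _ "\<lambda>_. 0"]) simp

lemma hom_poly_add:
  assumes "hom_poly d G" "hom_poly d H"
  shows "hom_poly d (\<lambda>v. G v + H v)"
proof -
  obtain a b where
    "\<And>v. G v = (\<Sum>\<alpha> | (\<Sum>i\<in>UNIV. \<alpha> i) = d. a \<alpha> * (\<Prod>i\<in>UNIV. (v $ i) ^ \<alpha> i))"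
    "\<And>v. H v = (\<Sum>\<alpha> | (\<Sum>i\<in>UNIV. \<alpha> i) = d. b \<alpha> * (\<Prod>i\<in>UNIV. (v $ i) ^ \<alpha> i))"
    using assms unfolding hom_poly_def by blast
  then show ?thesis
    unfolding hom_poly_def
    by (intro exI[of _ "\<lambda>\<alpha>. a \<alpha> + b \<alpha>"]) (simp add: sum.distrib distrib_right)
qed

lemma hom_poly_cmult:
  assumes "hom_poly d G"
  shows "hom_poly d (\<lambda>v. c * G v)"
proof -
  obtain a where
    "\<And>v. G v = (\<Sum>\<alpha> | (\<Sum>i\<in>UNIV. \<alpha> i) = d. a \<alpha> * (\<Prod>i\<in>UNIV. (v $ i) ^ \<alpha> i))"
    using assms unfolding hom_poly_def by blast
  then show ?thesis
    unfolding hom_poly_def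
    by (intro exI[of _ "\<lambda>\<alpha>. c * a \<alpha>"]) (simp add: sum_distrib_left mult.assoc)
qed

lemma hom_poly_sum:
  assumes "\<And>i. i \<in> I \<Longrightarrow> hom_poly d (G i)"
  shows "hom_poly d (\<lambda>v. \<Sum>i\<in>I. G i v)"
  using assms
  by (induction I rule: infinite_finite_induct) (auto intro: hom_poly_zero hom_poly_add)

definition rep :: "'n::finite cproj \<Rightarrow> complex ^ 'n" where
  "rep p = (SOME v. v \<noteq> 0 \<and> pt v = p)"

lemma rep_nonzero: "rep p \<noteq> 0" and pt_rep [simp]: "pt (rep p) = p"
proof -
  have "\<exists>v. v \<noteq> 0 \<and> pt v = p" using pt_surj by metis
  from someI_ex[OF this] show "rep p \<noteq> 0" "pt (rep p) = p" by (simp_all add: rep_def)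
qed

lemma rep_pt:
  assumes "v \<noteq> 0"
  obtains c where "c \<noteq> 0" "rep (pt v) = c *s v"
  using pt_eq_iff[OF rep_nonzero assms, of "pt v"] by auto

definition linform :: "complex ^ 'n::finite \<Rightarrow> complex ^ 'n \<Rightarrow> complex" where
  "linform a v = (\<Sum>i\<in>UNIV. a $ i * v $ i)"

lemma linform_scale: "linform a (c *s v) = c * linform a v"
  by (simp add: linform_def sum_distrib_left mult.left_commute)

lemma linform_axis [simp]: "linform (axis j 1) v = v $ j"
  by (simp add: linform_def axis_def if_distrib[of "\<lambda>x. x * _"] sum.delta cong: if_cong)

lemma analytic_on_linform:
  "vec_analytic_at A z \<Longrightarrow> (\<lambda>w. linform a (A w)) analytic_on {z}"
  by (auto simp: linform_def vec_analytic_at_def intro!: analytic_intros)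

text \<open>A quotient of linear forms has degree 0, so it does not depend on the vector chosen by
  \<open>rep\<close>. Where the denominator vanishes it is 0 by convention.\<close>

definition ratio :: "complex ^ 'n::finite \<Rightarrow> complex ^ 'n \<Rightarrow> 'n cproj \<Rightarrow> complex" where
  "ratio a b p = linform a (rep p) / linform b (rep p)"

lemma ratio_pt: "v \<noteq> 0 \<Longrightarrow> ratio a b (pt v) = linform a v / linform b v"
  by (rule rep_pt[of v]) (auto simp: ratio_def linform_scale)

lemma ratio_eventually:
  assumes "\<forall>\<^sub>F w in F. A w \<noteq> 0 \<and> \<Phi> w = pt (A w)"
  shows "\<forall>\<^sub>F w in F. ratio a b (\<Phi> w) = linform a (A w) / linform b (A w)"
  using assms by eventually_elim (simp add: ratio_pt)

lemma ratio_meromorphic: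
  assumes "hol_at \<Phi> z"
  shows "(\<lambda>w. ratio a b (\<Phi> w)) meromorphic_on {z}"
proof -
  obtain A where A: "vec_analytic_at A z" "\<forall>\<^sub>F w in nhds z. A w \<noteq> 0 \<and> \<Phi> w = pt (A w)"
    using assms by (rule hol_atE)
  have "(\<lambda>w. linform a (A w) / linform b (A w)) meromorphic_on {z}"
    using analytic_on_linform[OF A(1)]
    by (intro meromorphic_intros analytic_on_imp_meromorphic_on)
  moreover have "\<forall>\<^sub>F w in at z. ratio a b (\<Phi> w) = linform a (A w) / linform b (A w)"
    using ratio_eventually[OF A(2)] by (rule eventually_nhds_imp_at)
  ultimately show ?thesis
    by (subst meromorphic_on_cong[OF _ refl]) auto
qed

lemma ratio_analytic:
  assumes "hol_at \<Phi> z" "linform b (rep (\<Phi> z)) \<noteq> 0"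
  shows "(\<lambda>w. ratio a b (\<Phi> w)) analytic_on {z}"
proof -
  obtain A where A: "vec_analytic_at A z" "A z \<noteq> 0" "\<Phi> z = pt (A z)"
      "\<forall>\<^sub>F w in nhds z. A w \<noteq> 0 \<and> \<Phi> w = pt (A w)"
    using assms(1) by (rule hol_atE)
  have "linform b (A z) \<noteq> 0"
    using assms(2) A(3) by (auto simp: linform_scale intro: rep_pt[OF A(2)])
  then have "(\<lambda>w. linform a (A w) / linform b (A w)) analytic_on {z}"
    using analytic_on_linform[OF A(1)] by (intro analytic_intros) auto
  then show ?thesis
    using ratio_eventually[OF A(4), of a b] by (subst analytic_at_cong[OF _ refl]) auto
qed

section \<open>Meromorphic functions\<close>

lemma meromorphic_orderE:
  assumes "f meromorphic_on {z}" "\<exists>\<^sub>F w in at z. f w \<noteq> 0"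
  obtains g where "g analytic_on {z}" "g z \<noteq> 0"
    "\<forall>\<^sub>F w in at z. f w = g w * (w - z) powi (zorder f z)"
proof -
  have "isolated_singularity_at f z" "not_essential f z"
    using assms(1) by (auto simp: meromorphic_at_iff)
  from zorder_exist[OF this assms(2)] obtain r where
    r: "zor_poly f z z \<noteq> 0" "r > 0" "zor_poly f z holomorphic_on cball z r"
      "\<And>w. w \<in> cball z r - {z} \<Longrightarrow> f w = zor_poly f z w * (w - z) powi (zorder f z)"
    by blast
  have "zor_poly f z holomorphic_on ball z r"
    using r(3) by (rule holomorphic_on_subset) auto
  then have "zor_poly f z analytic_on {z}"
    using r(2) by (auto simp: analytic_at intro!: exI[of _ "ball z r"])
  moreover have "\<forall>\<^sub>F w in at z. w \<in> ball z r - {z}"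
    using r(2) by (intro eventually_at_in_open) auto
  then have "\<forall>\<^sub>F w in at z. f w = zor_poly f z w * (w - z) powi (zorder f z)"
    by eventually_elim (use r(4) in auto)
  ultimately show thesis using that r(1) by blast
qed

lemma meromorphic_times_power_tendsto:
  assumes "f meromorphic_on {z}"
  obtains n c where "((\<lambda>w. (w - z) ^ n * f w) \<longlongrightarrow> c) (at z)"
proof (cases "\<exists>\<^sub>F w in at z. f w \<noteq> 0")
  case False
  then have "\<forall>\<^sub>F w in at z. (w - z) ^ 0 * f w = 0"
    by (auto simp: frequently_def elim: eventually_mono)
  then have "((\<lambda>w. (w - z) ^ 0 * f w) \<longlongrightarrow> 0) (at z)" by (rule tendsto_eventually)
  then show thesis by (rule that)
next
  case True
  obtain g where g: "g analytic_on {z}" "\<forall>\<^sub>F w in at z. f w = g w * (w - z) powi (zorder f z)"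
    using meromorphic_orderE[OF assms True] by blast
  define n where "n = nat (- zorder f z)"
  define k where "k = nat (zorder f z)"
  have nk: "zorder f z = int k - int n" by (auto simp: n_def k_def)
  have ne: "\<forall>\<^sub>F w in at z. w \<noteq> z" by (simp add: eventually_at_filter)
  have "\<forall>\<^sub>F w in at z. (w - z) ^ n * f w = g w * (w - z) ^ k"
    using g(2) ne by eventually_elim (simp add: nk power_int_diff)
  moreover have "((\<lambda>w. g w * (w - z) ^ k) \<longlongrightarrow> g z * (z - z) ^ k) (at z)"
    using analytic_at_imp_isCont[OF g(1)] by (intro tendsto_intros) (simp add: isCont_def)
  ultimately have "((\<lambda>w. (w - z) ^ n * f w) \<longlongrightarrow> g z * (z - z) ^ k) (at z)"
    by (simp add: filterlim_cong[OF refl refl])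
  then show thesis by (rule that)
qed

section \<open>Discrete subgroups of the plane\<close>

lemma finite_has_minimizer:
  fixes g :: "'a \<Rightarrow> real"
  assumes "finite A" "A \<noteq> {}"
  shows "\<exists>a\<in>A. \<forall>b\<in>A. g a \<le> g b"
  using arg_min_if_finite(1)[OF assms] arg_min_least[OF assms] by blast

text \<open>A limit point of the set would provide two distinct elements whose difference lies in
  the ball of radius \<open>r\<close>.\<close>

lemma discrete_subgroup_finite_bounded:
  fixes T :: "complex set"
  assumes "\<And>s t. s \<in> T \<Longrightarrow> t \<in> T \<Longrightarrow> s - t \<in> T"
    and "r > 0" "T \<inter> ball 0 r \<subseteq> {0}" "bounded B"
  shows "finite (T \<inter> B)"
proof (rule ccontr)
  assume inf: "infinite (T \<inter> B)"
  obtain l where l: "l islimpt (T \<inter> B)"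
    using bounded_infinite_imp_islimpt[OF order_refl _ inf] assms(4) bounded_Int by blast
  obtain s where s: "s \<in> T" "s \<noteq> l" "dist s l < r / 2"
    using l assms(2) unfolding islimpt_approachable by (meson IntD1 half_gt_zero)
  have "min (r / 2) (dist s l) > 0" using s(2) assms(2) by simp
  then obtain t where t: "t \<in> T" "dist t l < min (r / 2) (dist s l)"
    using l unfolding islimpt_approachable by (meson IntD1)
  have "dist s t < r" using dist_triangle_half_l[OF s(3), of t] t(2) by simp
  then have "s - t \<in> T \<inter> ball 0 r" using assms(1)[OF s(1) t(1)] by (simp add: dist_norm norm_minus_commute)
  then have "s = t" using assms(3) by auto
  with t(2) show False by auto
qed

text \<open>Subtracting the integer part of a real element leaves an element of norm less than 1,
  which must be 0.\<close>

lemma discrete_subgroup_real: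
  fixes S :: "complex set"
  assumes sub: "\<And>s t. s \<in> S \<Longrightarrow> t \<in> S \<Longrightarrow> s - t \<in> S" and "1 \<in> S"
    and min: "\<And>s. s \<in> S \<Longrightarrow> s \<noteq> 0 \<Longrightarrow> norm s \<ge> 1"
  shows "of_int n \<in> S" and "s \<in> S \<Longrightarrow> Im s = 0 \<Longrightarrow> s \<in> \<int>"
proof -
  have 0: "0 \<in> S" using sub[OF assms(2,2)] by simp
  have neg: "- s \<in> S" if "s \<in> S" for s using sub[OF 0 that] by simp
  have add: "s + t \<in> S" if "s \<in> S" "t \<in> S" for s t using sub[OF that(1) neg[OF that(2)]] by simp
  have nat: "of_nat n \<in> S" for n by (induction n) (auto simp: 0 intro: add assms(2))
  show int: "of_int n \<in> S" for n
    by (cases n rule: int_cases2) (auto simp: nat intro: neg)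
  show "s \<in> \<int>" if s: "s \<in> S" "Im s = 0"
  proof -
    define t where "t = s - of_int \<lfloor>Re s\<rfloor>"
    have t: "t \<in> S" unfolding t_def by (intro sub s int)
    have "t = of_real (frac (Re s))" using s(2) by (simp add: t_def complex_eq_iff frac_def)
    then have "norm t = frac (Re s)" by simp
    then have "norm t < 1" using frac_lt_1 by metis
    then have "t = 0" using min[OF t] by force
    then have "s = of_int \<lfloor>Re s\<rfloor>" by (simp add: t_def)
    then show ?thesis by (metis Ints_of_int)
  qed
qed

text \<open>A shortest element \<open>\<omega>\<close> is scaled to 1, so that the real elements are
  exactly the integers. If there are others, \<open>\<tau>\<close> is taken with least positive
  imaginary part, and division with remainder by \<open>\<tau>\<close> leaves a real
  element.\<close>

lemma discrete_subgroup_cases: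
  fixes T :: "complex set"
  assumes sub: "\<And>s t. s \<in> T \<Longrightarrow> t \<in> T \<Longrightarrow> s - t \<in> T"
    and r: "r > 0" "T \<inter> ball 0 r \<subseteq> {0}" and t0: "t0 \<in> T" "t0 \<noteq> 0"
  obtains (cyclic) \<omega> where "\<omega> \<noteq> 0" "\<And>t. \<omega> * t \<in> T \<longleftrightarrow> t \<in> \<int>"
  | (lattice) \<omega> \<tau> where "\<omega> \<noteq> 0" "Im \<tau> > 0"
      "\<And>t. \<omega> * t \<in> T \<longleftrightarrow> (\<exists>m n. t = of_int m + of_int n * \<tau>)"
proof -
  note fin = discrete_subgroup_finite_bounded[OF sub r]
  define P where "P = T \<inter> cball 0 (norm t0) - {0}"
  have "finite P" "t0 \<in> P" using fin[of "cball 0 (norm t0)"] t0 by (auto simp: P_def)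
  then obtain \<omega> where \<omega>: "\<omega> \<in> P" "\<And>t. t \<in> P \<Longrightarrow> norm \<omega> \<le> norm t"
    using finite_has_minimizer[of P norm] by blast
  have \<omega>0: "\<omega> \<noteq> 0" "\<omega> \<in> T" using \<omega>(1) by (auto simp: P_def)
  have \<omega>_min: "norm \<omega> \<le> norm t" if "t \<in> T" "t \<noteq> 0" for t
    using \<omega> that by (cases "norm t \<le> norm t0") (auto simp: P_def)
  define S where "S = {s. \<omega> * s \<in> T}"
  have S_sub: "s - t \<in> S" if "s \<in> S" "t \<in> S" for s t
    using sub that by (auto simp: S_def right_diff_distrib)
  have S1: "1 \<in> S" using \<omega>0 by (simp add: S_def)
  have S_min: "1 \<le> norm s" if "s \<in> S" "s \<noteq> 0" for s
    using \<omega>_min[of "\<omega> * s"] that \<omega>0 by (auto simp: S_def norm_mult)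
  have S_int: "of_int n \<in> S" for n
    by (rule discrete_subgroup_real(1)[of S, OF _ S1]) (use S_sub S_min in auto)
  have S_real: "s \<in> \<int>" if "s \<in> S" "Im s = 0" for s
    by (rule discrete_subgroup_real(2)[of S, OF _ S1 _ that]) (use S_sub S_min in auto)
  have S_neg: "- s \<in> S" if "s \<in> S" for s using S_sub[OF S_int[of 0] that] by simp
  have S_add: "s + t \<in> S" if "s \<in> S" "t \<in> S" for s t using S_sub[OF that(1) S_neg[OF that(2)]] by simp
  have S_finite: "finite (S \<inter> cball 0 R)" for R
    using S_min by (intro discrete_subgroup_finite_bounded[OF S_sub, of 1]) fastforce+
  show thesis
  proof (cases "\<forall>s\<in>S. Im s = 0")
    case True
    have "\<omega> * t \<in> T \<longleftrightarrow> t \<in> \<int>" for t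
    proof
      assume "\<omega> * t \<in> T"
      then show "t \<in> \<int>" using True S_real by (auto simp: S_def)
    next
      assume "t \<in> \<int>"
      then show "\<omega> * t \<in> T" using S_int by (auto simp: S_def elim: Ints_cases)
    qed
    with \<omega>0(1) show thesis by (rule cyclic)
  next
    case False
    then obtain s0 where "s0 \<in> S" "Im s0 \<noteq> 0" by blast
    then obtain s1 where s1: "s1 \<in> S" "Im s1 > 0"
      using S_neg[of s0] by (cases "Im s0 > 0") auto
    define Q where "Q = {s \<in> S. 0 < Im s \<and> Im s \<le> Im s1 \<and> 0 \<le> Re s \<and> Re s \<le> 1}"
    \<comment> \<open>Integer translates move the candidates for \<open>\<tau>\<close> into a
      bounded rectangle, so that the minimum is taken over a finite set.\<close>
    define sh where "sh s = s - of_int \<lfloor>Re s\<rfloor>" for s :: complex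
    have sh: "sh s \<in> S" "Im (sh s) = Im s" "0 \<le> Re (sh s)" "Re (sh s) \<le> 1" if "s \<in> S" for s
      using S_sub[OF that S_int] frac_ge_0[of "Re s"] frac_lt_1[of "Re s"] by (auto simp: sh_def frac_def)
    have "Q \<subseteq> S \<inter> cball 0 (1 + Im s1)"
    proof
      fix s assume "s \<in> Q"
      moreover have "norm s \<le> \<bar>Re s\<bar> + \<bar>Im s\<bar>" by (rule cmod_le)
      ultimately show "s \<in> S \<inter> cball 0 (1 + Im s1)" by (auto simp: Q_def)
    qed
    then have "finite Q" using S_finite finite_subset by blast
    moreover have "sh s1 \<in> Q" using sh[OF s1(1)] s1(2) by (auto simp: Q_def)
    ultimately obtain \<tau> where \<tau>: "\<tau> \<in> Q" "\<And>s. s \<in> Q \<Longrightarrow> Im \<tau> \<le> Im s"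
      using finite_has_minimizer[of Q Im] by blast
    have \<tau>S: "\<tau> \<in> S" "Im \<tau> > 0" "Im \<tau> \<le> Im s1" using \<tau>(1) by (auto simp: Q_def)
    have \<tau>_min: "Im \<tau> \<le> Im s" if "s \<in> S" "Im s > 0" for s
      using \<tau>(2)[of "sh s"] sh[OF that(1)] that \<tau>S(3) by (cases "Im s \<le> Im s1") (auto simp: Q_def)
    have \<tau>nat: "of_nat n * \<tau> \<in> S" for n
      by (induction n) (use S_int[of 0] \<tau>S in \<open>auto simp: ring_distribs intro: S_add\<close>)
    have \<tau>int: "of_int n * \<tau> \<in> S" for n
      by (cases n rule: int_cases2) (use \<tau>nat S_neg in auto)
    have "\<omega> * t \<in> T \<longleftrightarrow> (\<exists>m n. t = of_int m + of_int n * \<tau>)" for t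
    proof
      assume "\<omega> * t \<in> T"
      then have t: "t \<in> S" by (simp add: S_def)
      define n where "n = \<lfloor>Im t / Im \<tau>\<rfloor>"
      define s where "s = t - of_int n * \<tau>"
      have s: "s \<in> S" unfolding s_def by (intro S_sub t \<tau>int)
      have "Im s = Im \<tau> * frac (Im t / Im \<tau>)"
        using \<tau>S(2) by (simp add: s_def n_def frac_def field_simps)
      moreover have "Im \<tau> * frac (Im t / Im \<tau>) < Im \<tau> * 1"
        using \<tau>S(2) frac_lt_1 by (intro mult_strict_left_mono) auto
      ultimately have "\<not> Im \<tau> \<le> Im s" "0 \<le> Im s" using \<tau>S(2) by auto
      with \<tau>_min[OF s] have "Im s = 0" by fastforce
      then obtain m where "s = of_int m" using S_real[OF s] by (auto elim: Ints_cases)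
      then show "\<exists>m n. t = of_int m + of_int n * \<tau>" by (auto simp: s_def algebra_simps)
    next
      assume "\<exists>m n. t = of_int m + of_int n * \<tau>"
      then show "\<omega> * t \<in> T" using S_add[OF S_int \<tau>int] by (auto simp: S_def)
    qed
    with \<omega>0(1) \<tau>S(2) show thesis by (rule lattice)
  qed
qed

section \<open>Rational functions\<close>

lemma analytic_on_poly: "(\<lambda>z. poly P z) analytic_on S" for P :: "complex poly"
  by (induction P) (auto intro!: analytic_intros)

lemma meromorphic_on_poly_inverse: "(\<lambda>u. poly P (1 / u)) meromorphic_on S" for P :: "complex poly"
  by (induction P) (auto intro!: meromorphic_intros)

text \<open>A polynomial \<open>Q\<close> clears the poles in \<open>S\<close>; the product extends
  to an entire function of polynomial growth, hence to a polynomial.\<close>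

lemma rational_of_meromorphic_on_sphere:
  fixes G :: "complex \<Rightarrow> complex"
  assumes S: "finite S" "\<And>z. z \<notin> S \<Longrightarrow> G analytic_on {z}" "\<And>z. z \<in> S \<Longrightarrow> G meromorphic_on {z}"
    and inf: "(\<lambda>u. G (1 / u)) meromorphic_on {0}"
  obtains P Q :: "complex poly" where "Q \<noteq> 0" "\<forall>z. z \<notin> S \<longrightarrow> G z * poly Q z = poly P z"
proof -
  have "\<exists>n c. ((\<lambda>w. (w - z) ^ n * G w) \<longlongrightarrow> c) (at z)" if "z \<in> S" for z
    using meromorphic_times_power_tendsto[OF S(3)[OF that]] by metis
  then obtain n where n: "\<And>z. z \<in> S \<Longrightarrow> \<exists>c. ((\<lambda>w. (w - z) ^ n z * G w) \<longlongrightarrow> c) (at z)" by metis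
  define Q where "Q = (\<Prod>s\<in>S. [:- s, 1:] ^ n s)"
  have Q0: "Q \<noteq> 0" using S(1) by (auto simp: Q_def)
  define E where "E w = G w * poly Q w" for w
  have E_an: "E analytic_on {z}" if "z \<notin> S" for z
    unfolding E_def using S(2)[OF that] by (intro analytic_intros analytic_on_poly)
  have E_mero: "E meromorphic_on {z}" for z
  proof (cases "z \<in> S")
    case True
    then show ?thesis unfolding E_def
      by (intro meromorphic_intros S(3) analytic_on_imp_meromorphic_on analytic_on_poly)
  qed (auto intro: E_an analytic_on_imp_meromorphic_on)
  have E_lim: "\<exists>c. (E \<longlongrightarrow> c) (at z)" for z
  proof (cases "z \<in> S")
    case True
    then obtain c where c: "((\<lambda>w. (w - z) ^ n z * G w) \<longlongrightarrow> c) (at z)" using n by blast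
    define R where "R = (\<Prod>s\<in>S - {z}. [:- s, 1:] ^ n s)"
    have "Q = [:- z, 1:] ^ n z * R" using S(1) True by (simp add: Q_def R_def prod.remove)
    then have "E w = (w - z) ^ n z * G w * poly R w" for w by (simp add: E_def poly_power)
    then have "E = (\<lambda>w. (w - z) ^ n z * G w * poly R w)" by (simp add: fun_eq_iff)
    moreover have "((\<lambda>w. poly R w) \<longlongrightarrow> poly R z) (at z)" by (intro tendsto_intros)
    from tendsto_mult[OF c this] have "((\<lambda>w. (w - z) ^ n z * G w * poly R w) \<longlongrightarrow> c * poly R z) (at z)" .
    ultimately show ?thesis by metis
  next
    case False
    then show ?thesis using analytic_at_imp_isCont[OF E_an] by (auto simp: isCont_def)
  qed
  define E' where "E' = remove_sings E"
  have E'_an: "E' analytic_on {z}" for z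
  proof -
    obtain c where "(E \<longlongrightarrow> c) (at z)" using E_lim by blast
    moreover have "isolated_singularity_at E z" using E_mero by (simp add: meromorphic_at_iff)
    ultimately show ?thesis unfolding E'_def by (intro remove_sings_analytic_at)
  qed
  then have hol: "E' holomorphic_on UNIV"
    by (intro analytic_imp_holomorphic analytic_on_analytic_at[THEN iffD2]) blast
  have E': "E' z = E z" if "z \<notin> S" for z
    unfolding E'_def using E_an[OF that] by (rule remove_sings_at_analytic)
  have "(\<lambda>u. E (1 / u)) meromorphic_on {0}"
    unfolding E_def by (intro meromorphic_intros inf meromorphic_on_poly_inverse)
  then obtain N c where Nc: "((\<lambda>u. (u - 0) ^ N * E (1 / u)) \<longlongrightarrow> c) (at 0)"
    by (rule meromorphic_times_power_tendsto)
  then have "\<forall>\<^sub>F u in at 0. norm ((u - 0) ^ N * E (1 / u)) < norm c + 1"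
    by (intro order_tendstoD(2)[OF tendsto_norm]) auto
  then obtain e where e: "e > 0" "\<And>u. u \<noteq> 0 \<Longrightarrow> norm u < e \<Longrightarrow> norm (u ^ N * E (1 / u)) < norm c + 1"
    by (auto simp: eventually_at)
  obtain M where M: "\<And>s. s \<in> S \<Longrightarrow> norm s \<le> M" using finite_imp_bounded[OF S(1)] by (auto simp: bounded_iff)
  \<comment> \<open>Beyond this radius \<open>z\<close> is nonzero and lies outside
    \<open>S\<close>, and \<open>1 / z\<close> is in the range of the estimate near
    infinity.\<close>
  define A where "A = max (2 / e) (max 1 (M + 1))"
  have bound: "norm (E' z) \<le> (norm c + 1) * norm z ^ N" if "A \<le> norm z" for z
  proof -
    have z: "norm z \<ge> 1" "norm z > M" "2 / e \<le> norm z" using that by (auto simp: A_def)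
    then have z0: "z \<noteq> 0" by auto
    have "z \<notin> S" using M[of z] z(2) by auto
    moreover have "norm (1 / z) < e"
      using z(3) e(1) z0 by (simp add: norm_divide field_simps)
    then have "norm ((1 / z) ^ N * E z) < norm c + 1" using e(2)[of "1 / z"] z0 by simp
    then have "norm (E z) < (norm c + 1) * norm z ^ N"
      using z0 by (simp add: norm_mult norm_power norm_divide power_one_over field_simps)
    ultimately show ?thesis using E' by simp
  qed
  define P where "P = (\<Sum>k\<le>N. monom ((deriv ^^ k) E' 0 / fact k) k)"
  have "E' z = poly P z" for z
    using Liouville_polynomial[OF hol bound, where \<xi> = z] by (simp add: P_def poly_sum poly_monom)
  then have "\<forall>z. z \<notin> S \<longrightarrow> G z * poly Q z = poly P z" using E' by (simp add: E_def)
  with Q0 show thesis by (rule that)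
qed

text \<open>Common linear factors are cancelled one at a time; \<open>D\<close> collects them, so
  that a relation between \<open>P\<close> and \<open>Q\<close> can be divided by \<open>D\<close>
  off its zeros.\<close>

lemma reduced_fraction:
  fixes P Q :: "complex poly"
  assumes "Q \<noteq> 0"
  obtains P' Q' D where "P = D * P'" "Q = D * Q'" "D \<noteq> 0" "Q' \<noteq> 0" "\<forall>z. poly P' z \<noteq> 0 \<or> poly Q' z \<noteq> 0"
proof -
  have "\<exists>P' Q' D. P = D * P' \<and> Q = D * Q' \<and> D \<noteq> 0 \<and> Q' \<noteq> 0 \<and> (\<forall>z. poly P' z \<noteq> 0 \<or> poly Q' z \<noteq> 0)"
    using assms
  proof (induction "degree Q" arbitrary: P Q rule: less_induct)
    case less
    show ?case
    proof (cases "\<exists>z. poly P z = 0 \<and> poly Q z = 0")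
      case False
      then have "P = 1 * P \<and> Q = 1 * Q \<and> (1 :: complex poly) \<noteq> 0 \<and> Q \<noteq> 0 \<and>
          (\<forall>z. poly P z \<noteq> 0 \<or> poly Q z \<noteq> 0)"
        using less.prems by auto
      then show ?thesis by blast
    next
      case True
      then obtain z P1 Q1 where z: "P = [:- z, 1:] * P1" "Q = [:- z, 1:] * Q1"
        by (auto simp: poly_eq_0_iff_dvd elim!: dvdE)
      have Q1: "Q1 \<noteq> 0" using less.prems z(2) by auto
      then have "degree Q = Suc (degree Q1)" unfolding z(2) by (subst degree_mult_eq) auto
      then obtain P' Q' D where IH: "P1 = D * P'" "Q1 = D * Q'" "D \<noteq> 0" "Q' \<noteq> 0"
          "\<forall>z. poly P' z \<noteq> 0 \<or> poly Q' z \<noteq> 0"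
        using less.hyps[of Q1 P1] Q1 by auto
      have "P = ([:- z, 1:] * D) * P'" "Q = ([:- z, 1:] * D) * Q'" "[:- z, 1:] * D \<noteq> 0"
        using IH(1-3) z by (simp_all only: mult.assoc mult_eq_0_iff) simp
      then show ?thesis using IH(4,5) by blast
    qed
  qed
  then show thesis using that by blast
qed

definition homogenize :: "nat \<Rightarrow> complex poly \<Rightarrow> complex ^ 2 \<Rightarrow> complex" where
  "homogenize N P v = (\<Sum>i\<le>N. coeff P i * (v $ 1) ^ i * (v $ 2) ^ (N - i))"

lemma hom_poly_monomial2:
  assumes "i + j = d"
  shows "hom_poly d (\<lambda>v :: complex ^ 2. c * (v $ 1) ^ i * (v $ 2) ^ j)"
  using hom_poly_monomial[of "\<lambda>k :: 2. if k = 1 then i else j" d c] assms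
  by (simp add: sum_2 prod_2 UNIV_2 mult.assoc)

lemma hom_poly_homogenize: "hom_poly N (homogenize N P)"
  unfolding homogenize_def[abs_def] by (intro hom_poly_sum hom_poly_monomial2) auto

lemma homogenize_eval:
  assumes "degree P \<le> N"
  shows "homogenize N P (vector [z, 1]) = poly P z" and "homogenize N P (vector [z, 0]) = coeff P N * z ^ N"
proof -
  show "homogenize N P (vector [z, 1]) = poly P z"
    unfolding homogenize_def poly_altdef using assms
    by (simp add: coeff_eq_0 sum.mono_neutral_right[of "{..N}" "{..degree P}"])
  have "homogenize N P (vector [z, 0]) = (\<Sum>i\<le>N. if i = N then coeff P N * z ^ N else 0)"
    unfolding homogenize_def by (intro sum.cong) (auto simp: power_0_left)
  then show "homogenize N P (vector [z, 0]) = coeff P N * z ^ N" by simp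
qed

lemma vec2_cases:
  fixes v :: "complex ^ 2"
  assumes "v \<noteq> 0"
  obtains c z where "c \<noteq> 0" "v = c *s vector [z, 1]" | c where "c \<noteq> 0" "v = c *s vector [1, 0]"
proof (cases "v $ 2 = 0")
  case True
  then have "v = v $ 1 *s vector [1, 0]" "v $ 1 \<noteq> 0" using assms by (auto simp: vec_eq_iff forall_2)
  then show thesis using that(2) by blast
next
  case False
  then have "v = v $ 2 *s vector [v $ 1 / v $ 2, 1]" by (auto simp: vec_eq_iff forall_2)
  then show thesis using that(1) False by blast
qed

text \<open>At finite points the polynomials have no common root; at infinity one of the two
  coefficients of degree \<open>N\<close> is nonzero by the choice of \<open>N\<close>.\<close>

lemma homogenize_no_common_zero:
  assumes "v \<noteq> 0" "Q \<noteq> 0" "\<forall>z. poly P z \<noteq> 0 \<or> poly Q z \<noteq> 0" "N = max (degree P) (degree Q)"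
  shows "homogenize N P v \<noteq> 0 \<or> homogenize N Q v \<noteq> 0"
proof -
  have deg: "degree P \<le> N" "degree Q \<le> N" using assms(4) by auto
  have sc: "homogenize N R (c *s w) = c ^ N * homogenize N R w" for R c w
    by (rule hom_poly_scale[OF hom_poly_homogenize])
  from assms(1) show ?thesis
  proof (cases rule: vec2_cases)
    case (1 c z)
    then show ?thesis using assms(3) by (simp add: sc homogenize_eval deg)
  next
    case (2 c)
    have "coeff P N \<noteq> 0 \<or> coeff Q N \<noteq> 0"
      using assms(2,4) by (cases "degree P \<le> degree Q") (auto simp: max_def)
    then show ?thesis using 2 by (auto simp: sc homogenize_eval deg)
  qed
qed

section \<open>Singly periodic Poincare functions\<close>

text \<open>The Poincare function rescaled so that its periods are exactly the integers; the
  multiplier preserves the periods and is then an integer \<open>k\<close>.\<close>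

locale singly_periodic =
  fixes F :: "complex ^ 2 \<Rightarrow> complex ^ 2" and f :: "P1 \<Rightarrow> P1" and d :: nat
    and \<Psi> :: "complex \<Rightarrow> P1" and k :: int and r :: real
  assumes F: "\<And>j. hom_poly d (\<lambda>v. F v $ j)" "\<And>v. v \<noteq> 0 \<Longrightarrow> F v \<noteq> 0 \<and> f (pt v) = pt (F v)"
    and hol: "\<And>z. hol_at \<Psi> z"
    and eq: "\<And>z. \<Psi> (of_int k * z) = f (\<Psi> z)"
    and k2: "\<bar>k\<bar> \<ge> 2"
    and inj: "inj_on \<Psi> (ball 0 r)" and r: "r > 0"
    and periods: "\<And>t. (\<forall>z. \<Psi> (z + t) = \<Psi> z) \<longleftrightarrow> t \<in> \<int>"
begin

lemma period: "t \<in> \<int> \<Longrightarrow> \<Psi> (z + t) = \<Psi> z"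
  using periods by blast

lemma iterate: "\<Psi> (of_int k ^ n * z) = (f ^^ n) (\<Psi> z)"
proof (induction n)
  case (Suc n)
  then show ?case using eq[of "of_int k ^ n * z"] by (simp add: mult.assoc)
qed simp

lemma not_locally_constant: "\<not> (\<forall>\<^sub>F w in nhds z. \<Psi> w = p)"
proof
  assume *: "\<forall>\<^sub>F w in nhds z. \<Psi> w = p"
  then have p: "p = \<Psi> z" by (auto dest: eventually_nhds_x_imp_x)
  have "\<forall>\<^sub>F w in at z. \<Psi> w = \<Psi> z" using eventually_nhds_imp_at[OF *] p by simp
  then have "\<exists>\<^sub>F w in at z. \<Psi> w = (\<lambda>_. \<Psi> z) w" by (rule eventually_frequently[rotated]) simp
  moreover have "hol_at (\<lambda>_. \<Psi> z) u" for u
    using hol_at_compose[of \<Psi> "\<lambda>_. z" u] hol by simp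
  ultimately have "\<Psi> = (\<lambda>_. \<Psi> z)" using hol_at_identity[OF hol] by blast
  then have "\<Psi> 0 = \<Psi> (of_real (r / 2))" by metis
  then have "0 = complex_of_real (r / 2)" using r by (intro inj_onD[OF inj]) auto
  from arg_cong[OF this, of Re] show False using r by simp
qed

text \<open>The two points \<open>z1 + s / k\<^sup>n\<close> and \<open>z1 + (s + 1) / k\<^sup>n\<close> have the same image under \<open>\<Psi> (k\<^sup>n _)\<close>,
  hence so have their images under \<open>\<sigma>\<close>. As \<open>x\<close> is real, \<open>k\<^sup>n x\<close> stays bounded modulo 1, and in the
  limit the derivative of \<open>\<sigma>\<close> becomes a period.\<close>

lemma deriv_transition_Ints:
  assumes \<sigma>: "\<sigma> analytic_on {z1}" "\<sigma> z1 = of_real x" "\<forall>\<^sub>F w in nhds z1. \<Psi> (\<sigma> w) = \<Psi> w"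
  shows "deriv \<sigma> z1 \<in> \<int>"
proof (cases "deriv \<sigma> z1 = 0")
  case False
  define D where "D = deriv \<sigma> z1"
  define K where "K n = (of_int k ^ n :: complex)" for n
  have K0: "K n \<noteq> 0" for n using k2 by (auto simp: K_def)
  have K_lim: "(\<lambda>n. s / K n) \<longlonglongrightarrow> 0" for s
  proof -
    have "norm (1 / of_int k :: complex) = 1 / of_int \<bar>k\<bar>" by (simp add: norm_divide)
    also have "\<dots> < 1" using k2 by simp
    finally have "(\<lambda>n. (1 / of_int k) ^ n) \<longlonglongrightarrow> (0::complex)" by (rule LIMSEQ_power_zero)
    then have "(\<lambda>n. s * (1 / of_int k) ^ n) \<longlonglongrightarrow> s * 0" by (rule tendsto_mult_left)
    then show ?thesis by (simp add: K_def power_one_over)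
  qed
  have der: "(\<sigma> has_field_derivative D) (at z1)"
    unfolding D_def using analytic_on_imp_differentiable_at[OF \<sigma>(1)]
    by (simp add: DERIV_deriv_iff_field_differentiable)
  \<comment> \<open>Difference quotients of \<open>\<sigma>\<close> at the scale
    \<open>1 / K n\<close>; they show that the rescaled displacement converges.\<close>
  have quot: "(\<lambda>n. K n * (\<sigma> (z1 + s / K n) - of_real x)) \<longlonglongrightarrow> D * s" for s
  proof (cases "s = 0")
    case False
    have "filterlim (\<lambda>n. s / K n) (at 0) sequentially"
      using K_lim[of s] K0 False by (simp add: filterlim_at)
    with der have "(\<lambda>n. (\<sigma> (z1 + s / K n) - \<sigma> z1) / (s / K n)) \<longlonglongrightarrow> D"
      unfolding DERIV_def by (rule filterlim_compose)
    then have "(\<lambda>n. (\<sigma> (z1 + s / K n) - \<sigma> z1) / (s / K n) * s) \<longlonglongrightarrow> D * s"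
      by (intro tendsto_intros)
    moreover have "(\<sigma> (z1 + s / K n) - \<sigma> z1) / (s / K n) * s = K n * (\<sigma> (z1 + s / K n) - of_real x)" for n
      using False K0 by (simp add: \<sigma>(2))
    ultimately show ?thesis by simp
  qed (simp add: \<sigma>(2))
  \<comment> \<open>\<open>K n * of_real x\<close> may diverge, but it matters only modulo 1;
    compactness of the unit interval yields a subsequence along which the fractional part
    converges.\<close>
  define fr where "fr n = frac (of_int k ^ n * x)" for n
  have "\<forall>n. fr n \<in> {0..1}"
    using frac_ge_0 less_imp_le[OF frac_lt_1] by (auto simp: fr_def)
  moreover have "seq_compact {0..1::real}" by (simp add: compact_imp_seq_compact)
  ultimately obtain l \<rho> where \<rho>: "strict_mono \<rho>" "(fr \<circ> \<rho>) \<longlonglongrightarrow> l" by (metis seq_compactE)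
  have fr_K: "K n * of_real x - of_real (fr n) \<in> \<int>" for n
  proof -
    have "K n * of_real x = of_real (of_int k ^ n * x)" by (simp add: K_def)
    then have "K n * of_real x - of_real (fr n) = of_int \<lfloor>of_int k ^ n * x\<rfloor>"
      by (simp add: fr_def frac_def)
    then show ?thesis by (metis Ints_of_int)
  qed
  \<comment> \<open>\<open>X s n\<close> differs from \<open>K n * \<sigma> (z1 + s / K n)\<close>
    by the integer part of \<open>K n * of_real x\<close>, which is a period.\<close>
  define X where "X s n = of_real (fr n) + K n * (\<sigma> (z1 + s / K n) - of_real x)" for s n
  have X_val: "\<forall>\<^sub>F n in sequentially. \<Psi> (X s n) = \<Psi> (K n * z1 + s)" for s
  proof -
    have "(\<lambda>n. z1 + s / K n) \<longlonglongrightarrow> z1 + 0" by (intro tendsto_intros K_lim)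
    then have lim: "(\<lambda>n. z1 + s / K n) \<longlonglongrightarrow> z1" by (simp only: add_0_right)
    have "\<forall>\<^sub>F n in sequentially. \<Psi> (\<sigma> (z1 + s / K n)) = \<Psi> (z1 + s / K n)"
      using \<sigma>(3) lim by (rule eventually_compose_filterlim)
    then show ?thesis
    proof eventually_elim
      case (elim n)
      have "\<Psi> (X s n) = \<Psi> (X s n + (K n * of_real x - of_real (fr n)))"
        using period[OF fr_K] by simp
      also have "\<dots> = \<Psi> (K n * \<sigma> (z1 + s / K n))" by (simp add: X_def algebra_simps)
      also have "\<dots> = \<Psi> (K n * (z1 + s / K n))" unfolding K_def iterate elim[unfolded K_def] ..
      also have "\<dots> = \<Psi> (K n * z1 + s)" using K0 by (simp add: distrib_left)
      finally show ?case .
    qed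
  qed
  have X_lim: "(\<lambda>n. X s (\<rho> n)) \<longlonglongrightarrow> of_real l + D * s" for s
  proof -
    have "(\<lambda>n. K (\<rho> n) * (\<sigma> (z1 + s / K (\<rho> n)) - of_real x)) \<longlonglongrightarrow> D * s"
      using LIMSEQ_subseq_LIMSEQ[OF quot \<rho>(1)] by (simp add: o_def)
    from tendsto_add[OF tendsto_of_real[OF \<rho>(2)] this] show ?thesis by (simp add: X_def o_def)
  qed
  have "\<Psi> (of_real l + D * (s + 1)) = \<Psi> (of_real l + D * s)" for s
  proof (rule hol_at_eq_limit[OF hol hol X_lim X_lim])
    have "\<forall>\<^sub>F n in sequentially. \<Psi> (X (s + 1) n) = \<Psi> (X s n)"
      using X_val[of s] X_val[of "s + 1"]
    proof eventually_elim
      case (elim n)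
      then show ?case using period[of 1 "K n * z1 + s"] by (simp add: add.assoc)
    qed
    then show "\<forall>\<^sub>F n in sequentially. \<Psi> (X (s + 1) (\<rho> n)) = \<Psi> (X s (\<rho> n))"
      using filterlim_subseq[OF \<rho>(1)] by (rule eventually_compose_filterlim)
  qed simp
  \<comment> \<open>As \<open>s\<close> runs through the plane, so does
    \<open>of_real l + D * s\<close>, because \<open>D\<close> is nonzero.\<close>
  from this[of "(z - of_real l) / D" for z] have "\<Psi> (z + D) = \<Psi> z" for z
    using False by (simp add: D_def distrib_left)
  then show ?thesis using periods[of D] unfolding D_def by blast
qed simp

text \<open>Points near \<open>z1\<close> that \<open>\<sigma>\<close> sends to the real line accumulate at \<open>z1\<close>, and at each of them the
  derivative of \<open>\<sigma>\<close> is an integer; so the derivative is locally constant.\<close>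

lemma transition_affine:
  assumes \<sigma>: "\<sigma> analytic_on {z1}" "\<sigma> z1 = of_real x" "\<forall>\<^sub>F w in nhds z1. \<Psi> (\<sigma> w) = \<Psi> w"
  obtains D where "D \<in> \<int>" "D \<noteq> 0" "\<forall>w. \<Psi> (of_real x + D * (w - z1)) = \<Psi> w"
proof -
  obtain e where e: "e > 0" "\<sigma> holomorphic_on ball z1 e"
    using \<sigma>(1) analytic_at_ball by blast
  obtain e' where e': "e' > 0" "\<And>w. w \<in> ball z1 e' \<Longrightarrow> \<Psi> (\<sigma> w) = \<Psi> w"
    using \<sigma>(3) by (auto simp: eventually_nhds_metric dist_commute)
  define \<delta> where "\<delta> n = min (min e e') (1 / real (Suc n))" for n
  have \<delta>: "\<delta> n > 0" for n using e e' by (simp add: \<delta>_def)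
  \<comment> \<open>\<open>\<sigma>\<close> is an open map, hence takes real values other than
    \<open>x\<close> arbitrarily close to \<open>z1\<close>.\<close>
  have "\<exists>w. w \<in> ball z1 (\<delta> n) \<and> w \<noteq> z1 \<and> \<sigma> w \<in> \<real>" for n
  proof -
    let ?B = "ball z1 (\<delta> n)"
    have "\<sigma> holomorphic_on ?B" using e(2) by (rule holomorphic_on_subset) (auto simp: \<delta>_def)
    moreover have "\<not> \<sigma> constant_on ?B"
    proof
      assume "\<sigma> constant_on ?B"
      then obtain c where c: "\<And>w. w \<in> ?B \<Longrightarrow> \<sigma> w = c" by (auto simp: constant_on_def)
      have "\<forall>\<^sub>F w in nhds z1. w \<in> ?B" using \<delta> by (intro eventually_nhds_in_open) auto
      then have "\<forall>\<^sub>F w in nhds z1. \<Psi> w = \<Psi> c"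
      proof eventually_elim
        case (elim w)
        then show ?case using e'(2)[of w] c by (simp add: \<delta>_def)
      qed
      then show False using not_locally_constant by blast
    qed
    ultimately have "open (\<sigma> ` ?B)"
      by (intro open_mapping_thm[of \<sigma> ?B]) auto
    moreover have "of_real x \<in> \<sigma> ` ?B" using \<sigma>(2) \<delta>[of n] by (intro image_eqI[of _ _ z1]) auto
    ultimately obtain \<epsilon> where \<epsilon>: "\<epsilon> > 0" "ball (of_real x) \<epsilon> \<subseteq> \<sigma> ` ?B" by (metis openE)
    have "of_real (x + \<epsilon> / 2) \<in> ball (complex_of_real x) \<epsilon>" using \<epsilon>(1) by (simp add: dist_norm)
    then obtain w where w: "w \<in> ?B" "\<sigma> w = of_real (x + \<epsilon> / 2)" using \<epsilon>(2) by (metis imageE subsetD)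
    have "w \<noteq> z1"
    proof
      assume "w = z1"
      then have "complex_of_real (x + \<epsilon> / 2) = of_real x" using w(2) \<sigma>(2) by simp
      then show False using \<epsilon>(1) unfolding of_real_eq_iff by simp
    qed
    then show ?thesis using w by (metis Reals_of_real)
  qed
  then obtain w where w: "\<And>n. w n \<in> ball z1 (\<delta> n)" "\<And>n. w n \<noteq> z1" "\<And>n. \<sigma> (w n) \<in> \<real>" by metis
  have w_lim: "w \<longlonglongrightarrow> z1"
  proof (rule LIMSEQ_I)
    fix \<epsilon> :: real assume "\<epsilon> > 0"
    then obtain N where N: "N > 0" "1 / real N < \<epsilon>" using ex_inverse_of_nat_less by (metis inverse_eq_divide)
    show "\<exists>no. \<forall>n\<ge>no. norm (w n - z1) < \<epsilon>"
    proof (intro exI allI impI)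
      fix n assume "n \<ge> N"
      then have "1 / real (Suc n) \<le> 1 / real N" using N(1) by (intro divide_left_mono) auto
      moreover have "norm (w n - z1) < 1 / real (Suc n)"
        using w(1)[of n] by (simp add: \<delta>_def dist_norm norm_minus_commute)
      ultimately show "norm (w n - z1) < \<epsilon>" using N(2) by linarith
    qed
  qed
  have w_int: "deriv \<sigma> (w n) \<in> \<int>" for n
  proof -
    obtain y where y: "\<sigma> (w n) = of_real y" using w(3) by (auto elim: Reals_cases)
    have wn: "w n \<in> ball z1 (min e e')" using w(1)[of n] by (simp add: \<delta>_def)
    have "\<sigma> analytic_on {w n}"
      using e(2) wn by (auto simp: analytic_at intro!: exI[of _ "ball z1 e"])
    moreover have "\<forall>\<^sub>F u in nhds (w n). u \<in> ball z1 e'"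
      using wn by (intro eventually_nhds_in_open) auto
    then have "\<forall>\<^sub>F u in nhds (w n). \<Psi> (\<sigma> u) = \<Psi> u" by eventually_elim (rule e'(2))
    ultimately show ?thesis using deriv_transition_Ints y by blast
  qed
  define D where "D = deriv \<sigma> z1"
  have D_int: "D \<in> \<int>" using deriv_transition_Ints[OF \<sigma>] by (simp add: D_def)
  have "(\<lambda>n. deriv \<sigma> (w n)) \<longlonglongrightarrow> D"
    unfolding D_def using analytic_at_tendsto_nhds[OF analytic_deriv[OF \<sigma>(1)]] w_lim
    by (rule filterlim_compose)
  \<comment> \<open>Integers closer than 1 to the integer \<open>D\<close> are equal to it, so
    convergence means eventual equality.\<close>
  then have "\<forall>\<^sub>F n in sequentially. dist (deriv \<sigma> (w n)) D < 1" by (rule tendstoD) simp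
  then have "\<forall>\<^sub>F n in sequentially. deriv \<sigma> (w n) = D \<and> w n \<noteq> z1"
  proof eventually_elim
    case (elim n)
    have "deriv \<sigma> (w n) - D \<in> \<int>" using w_int D_int by simp
    then obtain i where i: "deriv \<sigma> (w n) - D = of_int i" by (auto elim: Ints_cases)
    then have "norm (of_int i :: complex) < 1" using elim by (simp add: dist_norm)
    then have "i = 0" by simp
    then show ?case using i w(2) by simp
  qed
  from affine_of_frequent_deriv[OF \<sigma>(1) w_lim this]
  have aff: "\<forall>\<^sub>F u in nhds z1. \<sigma> u = of_real x + D * (u - z1)" by (simp add: \<sigma>(2))
  have ev: "\<forall>\<^sub>F u in nhds z1. \<Psi> (of_real x + D * (u - z1)) = \<Psi> u"
    using aff \<sigma>(3) by eventually_elim simp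
  have "D \<noteq> 0"
  proof
    assume "D = 0"
    have "\<forall>\<^sub>F u in nhds z1. \<Psi> u = \<Psi> (of_real x)"
      using ev by eventually_elim (simp add: \<open>D = 0\<close>)
    then show False using not_locally_constant by blast
  qed
  moreover have "\<exists>\<^sub>F u in at z1. \<Psi> (of_real x + D * (u - z1)) = \<Psi> u"
    using eventually_nhds_imp_at[OF ev] by (rule eventually_frequently[rotated]) simp
  moreover have "hol_at (\<lambda>u. \<Psi> (of_real x + D * (u - z1))) z" for z
    by (rule hol_at_compose[of \<Psi> "\<lambda>u. of_real x + D * (u - z1)", OF hol]) (intro analytic_intros)
  ultimately have "(\<lambda>u. \<Psi> (of_real x + D * (u - z1))) = \<Psi>"
    by (intro hol_at_identity[OF _ hol, where ?z0.0 = z1])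
  then have "\<forall>w. \<Psi> (of_real x + D * (w - z1)) = \<Psi> w" by (simp add: fun_eq_iff)
  with D_int \<open>D \<noteq> 0\<close> show thesis by (rule that)
qed

text \<open>The germ that carries \<open>z\<close> to \<open>x\<close> over \<open>\<Psi>\<close> is
  affine with integral slope \<open>D\<close>. Moving \<open>w\<close> by \<open>1 / D\<close> moves
  its image by a period, so \<open>1 / D\<close> is a period as well and \<open>D\<close> is 1 or
  -1: a translation or a reflection. The bound on \<open>x\<close> makes \<open>\<Psi>\<close>
  injective near it.\<close>

lemma fibre_cases:
  assumes "\<bar>x\<bar> < r" "\<Psi> z = \<Psi> (of_real x)"
  shows "z - of_real x \<in> \<int> \<or> (\<forall>w. \<Psi> (z + of_real x - w) = \<Psi> w)"
proof -
  have inj': "inj_on \<Psi> (ball (of_real x) (r - \<bar>x\<bar>))"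
  proof (rule inj_on_subset[OF inj], rule)
    fix w assume "w \<in> ball (complex_of_real x) (r - \<bar>x\<bar>)"
    then have "norm (w - of_real x) < r - \<bar>x\<bar>" by (simp add: dist_norm norm_minus_commute)
    moreover have "norm w \<le> norm (w - of_real x) + norm (complex_of_real x)"
      using norm_triangle_ineq[of "w - of_real x" "of_real x"] by simp
    ultimately show "w \<in> ball 0 r" by simp
  qed
  obtain \<sigma> where \<sigma>: "\<sigma> analytic_on {z}" "\<sigma> z = of_real x" "\<forall>\<^sub>F w in nhds z. \<Psi> (\<sigma> w) = \<Psi> w"
  proof (rule hol_at_transfer[OF hol hol assms(2) inj'])
    show "0 < r - \<bar>x\<bar>" using assms(1) by simp
  qed
  obtain D where D: "D \<in> \<int>" "D \<noteq> 0" "\<forall>w. \<Psi> (of_real x + D * (w - z)) = \<Psi> w"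
    using transition_affine[OF \<sigma>] by blast
  have "\<Psi> (w + 1 / D) = \<Psi> w" for w
  proof -
    have "\<Psi> (w + 1 / D) = \<Psi> (of_real x + D * (w + 1 / D - z))" using D(3) by simp
    also have "of_real x + D * (w + 1 / D - z) = of_real x + D * (w - z) + 1"
      using D(2) by (simp add: field_simps)
    also have "\<Psi> \<dots> = \<Psi> (of_real x + D * (w - z))" by (rule period) simp
    also have "\<dots> = \<Psi> w" using D(3) by simp
    finally show ?thesis .
  qed
  then have "1 / D \<in> \<int>" using periods by blast
  then obtain i j where ij: "D = of_int i" "1 / D = of_int j" using D(1) by (auto elim!: Ints_cases)
  have "of_int (i * j) = (1::complex)" using ij D(2) by (simp flip: ij)
  then have "i * j = 1" by (simp only: of_int_eq_1_iff)
  then have "i = 1 \<or> i = -1" by (auto simp: zmult_eq_1_iff)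
  then show ?thesis
  proof
    assume "i = 1"
    then have "\<Psi> (w + (of_real x - z)) = \<Psi> w" for w
      using D(3) ij(1) by (simp add: algebra_simps)
    then have "of_real x - z \<in> \<int>" using periods by blast
    then have "- (of_real x - z) \<in> \<int>" by (rule Ints_minus)
    then show ?thesis by simp
  next
    assume "i = -1"
    then have "\<Psi> (z + of_real x - w) = \<Psi> w" for w
      using D(3) ij(1) by (simp add: algebra_simps)
    then show ?thesis by blast
  qed
qed

text \<open>Two reflections compose to a translation, so the constant in
  \<open>w \<mapsto> c - w\<close> is unique up to periods and one \<open>c\<close> serves all
  \<open>x\<close>. If there are no reflections, any \<open>c\<close> will do.\<close>

lemma fibre:
  obtains c where "\<forall>x z. \<bar>x\<bar> < r \<longrightarrow> \<Psi> z = \<Psi> (of_real x) \<longrightarrow> z - of_real x \<in> \<int> \<or> z + of_real x - c \<in> \<int>"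
proof (cases "\<exists>c. \<forall>w. \<Psi> (c - w) = \<Psi> w")
  case True
  then obtain c where c: "\<And>w. \<Psi> (c - w) = \<Psi> w" by blast
  have "c' - c \<in> \<int>" if "\<forall>w. \<Psi> (c' - w) = \<Psi> w" for c'
  proof -
    have "\<Psi> (u + (c' - c)) = \<Psi> u" for u
      using that[rule_format, of "c - u"] c[of u] by (simp add: algebra_simps)
    then show ?thesis using periods by blast
  qed
  then show thesis using fibre_cases by (intro that[of c]) blast
next
  case False
  then show thesis using fibre_cases by (intro that[of 0]) blast
qed

end

section \<open>Rationality of \<open>H\<close> and the semiconjugacy with a power map\<close>

lemma holomorphic_on_analytic_at:
  assumes "\<And>z. z \<in> S \<Longrightarrow> f analytic_on {z}"
  shows "f holomorphic_on S"
  by (intro analytic_imp_holomorphic analytic_on_analytic_at[THEN iffD2]) (use assms in blast)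

text \<open>The great Picard theorem gives \<open>g\<close> or its inverse a limit at 0. If the
  inverse tends to 0, there is a pole; otherwise \<open>g\<close> itself converges.\<close>

lemma picard_meromorphic:
  assumes M: "open M" "0 \<in> M" and hol: "g holomorphic_on (M - {0})"
    and omits: "b \<noteq> 0" "\<And>w. w \<in> M - {0} \<Longrightarrow> g w \<noteq> 0 \<and> g w \<noteq> b"
  shows "g meromorphic_on {0}"
proof -
  have iso: "isolated_singularity_at g 0"
    using isolated_singularity_at_holomorphic[OF hol M] .
  obtain l where l: "(g \<longlongrightarrow> l) (at 0) \<or> ((inverse \<circ> g) \<longlongrightarrow> l) (at 0)"
    by (rule great_Picard[OF M omits(1)[symmetric] hol omits(2)])
  have "not_essential g 0"
  proof (cases "(g \<longlongrightarrow> l) (at 0)")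
    case False
    then have lim: "((\<lambda>w. inverse (g w)) \<longlongrightarrow> l) (at 0)" using l by (simp add: o_def)
    show ?thesis
    proof (cases "l = 0")
      case True
      have "\<forall>\<^sub>F w in at 0. w \<in> M - {0}" using M by (rule eventually_at_in_open)
      then have "\<forall>\<^sub>F w in at 0. inverse (g w) \<noteq> 0" by eventually_elim (use omits in auto)
      then have "filterlim (\<lambda>w. inverse (g w)) (at 0) (at 0)" using lim True by (simp add: filterlim_at)
      then have "is_pole g 0" unfolding is_pole_def by (simp add: filterlim_inverse_at_iff)
      then show ?thesis by (rule is_pole_imp_not_essential)
    next
      case False
      from tendsto_inverse[OF lim False] have "(g \<longlongrightarrow> inverse l) (at 0)" by simp
      then show ?thesis by (rule tendsto_imp_not_essential)
    qed
  qed (rule tendsto_imp_not_essential)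
  with iso show ?thesis by (simp add: meromorphic_at_iff)
qed

lemma eventually_at_finite_avoid:
  assumes "finite T"
  shows "\<forall>\<^sub>F w in at (z::complex). w \<notin> T"
proof -
  have "open (- (T - {z}))" by (intro open_Compl finite_imp_closed finite_Diff assms)
  then have "\<forall>\<^sub>F w in nhds z. w \<in> - (T - {z})" by (rule eventually_nhds_in_open) simp
  then show ?thesis by (auto simp: eventually_at_filter elim: eventually_mono)
qed

lemma hol_at_eq_extend:
  assumes "hol_at \<Phi> z" "hol_at \<Psi> z" "\<forall>\<^sub>F w in at z. \<Phi> w = \<Psi> w"
  shows "\<Phi> z = \<Psi> z"
proof -
  have "\<not> (\<forall>\<^sub>F w in at z. \<Phi> w \<noteq> \<Psi> w)"
  proof
    assume "\<forall>\<^sub>F w in at z. \<Phi> w \<noteq> \<Psi> w"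
    with assms(3) have "\<forall>\<^sub>F w in at z. False" by eventually_elim blast
    then show False by simp
  qed
  then have "\<forall>\<^sub>F w in nhds z. \<Phi> w = \<Psi> w" using hol_at_eq_dichotomy[OF assms(1,2)] by blast
  then show ?thesis by (rule eventually_nhds_x_imp_x)
qed

lemma power_lift_scale: "power_lift k (c *s v) = c ^ nat \<bar>k\<bar> *s power_lift k v"
  by (auto simp: power_lift_def vec_eq_iff forall_2 power_mult_distrib)

lemma hom_poly_power_lift: "hom_poly (nat \<bar>k\<bar>) (\<lambda>v. power_lift k v $ j)"
proof -
  have "hom_poly n (\<lambda>v :: complex ^ 2. 1 * (v $ 1) ^ n * (v $ 2) ^ 0)"
    "hom_poly n (\<lambda>v :: complex ^ 2. 1 * (v $ 1) ^ 0 * (v $ 2) ^ n)" for n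
    by (rule hom_poly_monomial2; simp)+
  then have "\<forall>j. hom_poly (nat \<bar>k\<bar>) (\<lambda>v. power_lift k v $ j)"
    by (cases "k \<ge> 0") (simp_all add: forall_2 power_lift_def)
  then show ?thesis ..
qed

lemma power_lift_nonzero: "v \<noteq> 0 \<Longrightarrow> power_lift k v \<noteq> 0"
  by (auto simp: power_lift_def vec_eq_iff forall_2)

context singly_periodic
begin

text \<open>The branch of the logarithm is immaterial since integers are periods.\<close>

definition H :: "complex \<Rightarrow> P1" where
  "H u = \<Psi> (Ln u / (2 * pi * \<i>))"

lemma H_exp: "H (exp (2 * pi * \<i> * z)) = \<Psi> z"
proof -
  have "exp (Ln (exp (2 * pi * \<i> * z))) = exp (2 * pi * \<i> * z)" by simp
  then obtain n :: int where "Ln (exp (2 * pi * \<i> * z)) = 2 * pi * \<i> * z + of_int (2 * n) * pi * \<i>"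
    unfolding exp_eq by (auto simp: mult_ac)
  then have "Ln (exp (2 * pi * \<i> * z)) / (2 * pi * \<i>) = z + of_int n"
    by (simp add: field_simps)
  then show ?thesis using period[of "of_int n" z] by (simp add: H_def)
qed

lemma ex_exp: "u \<noteq> 0 \<Longrightarrow> \<exists>z. u = exp (2 * pi * \<i> * z)"
  by (rule exI[of _ "Ln u / (2 * pi * \<i>)"]) simp

lemma hol_at_H:
  assumes "u \<noteq> 0"
  shows "hol_at H u"
proof -
  \<comment> \<open>A branch of the logarithm near \<open>u\<close>: dividing by \<open>u\<close>
    moves the argument of \<open>Ln\<close> into the right half plane, away from the cut.\<close>
  define g where "g w = (Ln (w / u) + Ln u) / (2 * pi * \<i>)" for w
  define B where "B = ball u (norm u)"
  have B: "open B" "u \<in> B" using assms by (auto simp: B_def)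
  have pos: "w / u \<notin> \<real>\<^sub>\<le>\<^sub>0 \<and> w \<noteq> 0" if "w \<in> B" for w
  proof -
    have "norm (1 - w / u) < 1"
      using that assms by (simp add: B_def dist_norm norm_divide diff_divide_distrib flip: diff_divide_distrib)
        (simp add: norm_divide field_simps)
    moreover have "Re (1 - w / u) \<le> norm (1 - w / u)" by (rule complex_Re_le_cmod)
    ultimately have "Re (w / u) > 0" by simp
    then show ?thesis by (auto simp: complex_nonpos_Reals_iff)
  qed
  have "g holomorphic_on B"
    unfolding g_def using assms pos by (intro holomorphic_intros) auto
  then have "g analytic_on {u}" using B by (auto simp: analytic_at)
  then have "hol_at (\<lambda>w. \<Psi> (g w)) u" by (intro hol_at_compose[of \<Psi> g] hol)
  moreover have "\<forall>\<^sub>F w in nhds u. w \<in> B" using B by (rule eventually_nhds_in_open)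
  then have "\<forall>\<^sub>F w in nhds u. \<Psi> (g w) = H w"
  proof eventually_elim
    case (elim w)
    have "exp (2 * pi * \<i> * g w) = w"
      using pos[OF elim] assms by (simp add: g_def exp_add)
    then show ?case using H_exp[of "g w"] by simp
  qed
  ultimately show ?thesis by (rule hol_at_transform)
qed

text \<open>Three values of \<open>H\<close> are taken at most twice each on the punctured plane, so that by the great
  Picard theorem neither 0 nor infinity is an essential singularity.\<close>

lemma monomial_representation:
  obtains N and \<Theta> :: "complex ^ 2 \<Rightarrow> complex ^ 2"
    where "\<And>j. hom_poly N (\<lambda>v. \<Theta> v $ j)" "\<And>v. v \<noteq> 0 \<Longrightarrow> \<Theta> v \<noteq> 0"
    "\<And>u. u \<noteq> 0 \<Longrightarrow> H u = pt (\<Theta> (vector [u, 1]))"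
proof -
  obtain c where c: "\<forall>x z. \<bar>x\<bar> < r \<longrightarrow> \<Psi> z = \<Psi> (of_real x) \<longrightarrow> z - of_real x \<in> \<int> \<or> z + of_real x - c \<in> \<int>"
    by (rule fibre)
  define e where "e z = exp (2 * pi * \<i> * z)" for z :: complex
  have e_int: "e z = e w" if "z - w \<in> \<int>" for z w
  proof -
    from that obtain n where "z - w = of_int n" by (rule Ints_cases)
    then have "z = w + of_int n" by (simp add: algebra_simps)
    then have "2 * pi * \<i> * z = 2 * pi * \<i> * w + of_int (2 * n) * pi * \<i>" by (simp add: algebra_simps)
    then show ?thesis unfolding e_def exp_eq by blast
  qed
  define fib where "fib x = {e (of_real x), e (c - of_real x)}" for x
  have fib: "u \<in> fib x" if "u \<noteq> 0" "\<bar>x\<bar> < r" "H u = \<Psi> (of_real x)" for u x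
  proof -
    obtain z where z: "u = e z" using ex_exp[OF \<open>u \<noteq> 0\<close>] by (auto simp: e_def)
    then have "\<Psi> z = \<Psi> (of_real x)" using that(3) H_exp by (simp add: e_def)
    then have "z - of_real x \<in> \<int> \<or> z - (c - of_real x) \<in> \<int>"
      using c that(2) by (simp add: algebra_simps)
    then show ?thesis using e_int z by (auto simp: fib_def)
  qed
  have fib0: "0 \<notin> fib x" "finite (fib x)" for x by (auto simp: fib_def e_def)
  \<comment> \<open>Three real points inside the disk of injectivity provide three distinct values
    with known fibres.\<close>
  have r3: "\<bar>0\<bar> < r" "\<bar>r / 3\<bar> < r" "\<bar>r / 2\<bar> < r" using r by auto
  have ne: "\<Psi> (of_real x) \<noteq> \<Psi> (of_real y)" if "\<bar>x\<bar> < r" "\<bar>y\<bar> < r" "x \<noteq> y" for x y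
    using inj_onD[OF inj, of "of_real x" "of_real y"] that by auto
  define V0 where "V0 = rep (\<Psi> (of_real 0))"
  define V1 where "V1 = rep (\<Psi> (of_real (r / 3)))"
  define V2 where "V2 = rep (\<Psi> (of_real (r / 2)))"
  have V: "V0 \<noteq> 0" "V1 \<noteq> 0" "V2 \<noteq> 0" by (simp_all add: V0_def V1_def V2_def rep_nonzero)
  have ptV: "pt V0 = \<Psi> (of_real 0)" "pt V1 = \<Psi> (of_real (r / 3))" "pt V2 = \<Psi> (of_real (r / 2))"
    by (simp_all only: V0_def V1_def V2_def pt_rep)
  \<comment> \<open>The linear form whose zero line is spanned by \<open>W\<close>.\<close>
  define a where "a W = (vector [W $ 2, - W $ 1] :: complex ^ 2)" for W :: "complex ^ 2"
  have lin: "linform (a W) v = v $ 1 * W $ 2 - v $ 2 * W $ 1" for W v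
    by (simp add: linform_def sum_2 a_def)
  have lin0: "linform (a W) v = 0 \<longleftrightarrow> pt v = pt W" if "v \<noteq> 0" "W \<noteq> 0" for v W
    using that by (auto simp: lin pt_eq_iff_minors forall_2)
  have lin_rep: "linform (a V0) (rep (H u)) = 0 \<longleftrightarrow> H u = \<Psi> (of_real 0)"
    "linform (a V1) (rep (H u)) = 0 \<longleftrightarrow> H u = \<Psi> (of_real (r / 3))"
    "linform (a V2) (rep (H u)) = 0 \<longleftrightarrow> H u = \<Psi> (of_real (r / 2))" for u
    using lin0[OF rep_nonzero] V ptV by simp_all
  define \<delta> where "\<delta> = V0 $ 1 * V1 $ 2 - V0 $ 2 * V1 $ 1"
  have \<delta>: "\<delta> \<noteq> 0" using lin0[OF V(1,2)] ne[OF r3(1,2)] r ptV by (simp add: lin \<delta>_def)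
  \<comment> \<open>A coordinate on the projective line that is infinite at \<open>V0\<close>, 0 at
    \<open>V1\<close> and \<open>\<gamma>\<close> at \<open>V2\<close>.\<close>
  define G where "G u = ratio (a V1) (a V0) (H u)" for u
  define S where "S = fib 0 \<union> fib (r / 3) \<union> fib (r / 2)"
  have S: "finite S" "0 \<notin> S" using fib0 by (auto simp: S_def)
  have G_an: "G analytic_on {u}" if "u \<noteq> 0" "u \<notin> fib 0" for u
    unfolding G_def using that fib[OF that(1) r3(1)] lin_rep(1)
    by (intro ratio_analytic hol_at_H) auto
  define \<gamma> where "\<gamma> = linform (a V1) V2 / linform (a V0) V2"
  have l2: "linform (a V1) V2 \<noteq> 0" "linform (a V0) V2 \<noteq> 0"
    using lin0 V ptV ne[OF r3(3,2)] ne[OF r3(3,1)] r by simp_all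
  have \<gamma>: "\<gamma> \<noteq> 0" using l2 by (simp add: \<gamma>_def)
  have G_omit: "G u \<noteq> 0 \<and> G u \<noteq> \<gamma>" if "u \<noteq> 0" "u \<notin> S" for u
  proof -
    have l: "linform (a V0) (rep (H u)) \<noteq> 0" "linform (a V1) (rep (H u)) \<noteq> 0" "linform (a V2) (rep (H u)) \<noteq> 0"
      unfolding lin_rep using fib[OF that(1)] r3 that(2) by (auto simp: S_def)
    have "G u \<noteq> \<gamma>"
    proof
      assume "G u = \<gamma>"
      then have "linform (a V1) (rep (H u)) * linform (a V0) V2 =
          linform (a V1) V2 * linform (a V0) (rep (H u))"
        using l l2 by (simp add: G_def ratio_def \<gamma>_def frac_eq_eq)
      \<comment> \<open>Equal coordinates mean proportional vectors: in dimension 2 the determinants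
        satisfy a relation from which the form of \<open>V2\<close> at \<open>H u\<close> can be
        isolated, up to the factor \<open>\<delta>\<close>.\<close>
      then have "linform (a V2) (rep (H u)) * \<delta> = 0"
        unfolding lin \<delta>_def by algebra
      then show False using l(3) \<delta> by simp
    qed
    then show ?thesis using l by (simp add: G_def ratio_def)
  qed
  have G0: "G meromorphic_on {0}"
  proof (rule picard_meromorphic[of "- S" G \<gamma>])
    show "G holomorphic_on - S - {0}"
    proof (rule holomorphic_on_analytic_at)
      fix u assume "u \<in> - S - {0}"
      then show "G analytic_on {u}" by (intro G_an) (auto simp: S_def)
    qed
    show "open (- S)" using S(1) by (intro open_Compl finite_imp_closed)
    show "0 \<in> - S" using S(2) by simp
    show "\<gamma> \<noteq> 0" by (rule \<gamma>)
    show "G w \<noteq> 0 \<and> G w \<noteq> \<gamma>" if "w \<in> - S - {0}" for w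
      using that by (intro G_omit) auto
  qed
  have Ginf: "(\<lambda>u. G (1 / u)) meromorphic_on {0}"
  proof (rule picard_meromorphic[of "- (inverse ` S)" _ \<gamma>])
    have inv: "1 / u \<notin> S" if "u \<in> - (inverse ` S) - {0}" for u
      using that by (auto simp: image_iff field_simps)
    have "(\<lambda>u. G (1 / u)) analytic_on {u}" if "u \<in> - (inverse ` S) - {0}" for u
    proof -
      have "(G \<circ> (\<lambda>u. 1 / u)) analytic_on {u}"
        using inv[OF that] that
        by (intro analytic_on_compose analytic_intros) (auto simp: S_def intro!: G_an)
      then show ?thesis by (simp add: o_def)
    qed
    then show "(\<lambda>u. G (1 / u)) holomorphic_on - (inverse ` S) - {0}"
      by (rule holomorphic_on_analytic_at)
    show "G (1 / w) \<noteq> 0 \<and> G (1 / w) \<noteq> \<gamma>" if "w \<in> - (inverse ` S) - {0}" for w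
      using inv[OF that] that by (intro G_omit) auto
    show "open (- (inverse ` S))" using S(1) by (intro open_Compl finite_imp_closed finite_imageI)
    show "0 \<in> - (inverse ` S)" using S(2) by auto
    show "\<gamma> \<noteq> 0" by (rule \<gamma>)
  qed
  obtain P Q where PQ: "Q \<noteq> 0" "\<forall>z. z \<notin> insert 0 (fib 0) \<longrightarrow> G z * poly Q z = poly P z"
  proof (rule rational_of_meromorphic_on_sphere[of "insert 0 (fib 0)" G])
    show "G meromorphic_on {z}" if "z \<in> insert 0 (fib 0)" for z
    proof (cases "z = 0")
      case False
      show ?thesis unfolding G_def by (intro ratio_meromorphic hol_at_H False)
    qed (use G0 in simp)
  qed (use fib0 G_an Ginf in auto)
  obtain P' Q' D where red: "P = D * P'" "Q = D * Q'" "D \<noteq> 0" "Q' \<noteq> 0" "\<forall>z. poly P' z \<noteq> 0 \<or> poly Q' z \<noteq> 0"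
    by (rule reduced_fraction[OF PQ(1)])
  define N where "N = max (degree P') (degree Q')"
  \<comment> \<open>The inverse of the coordinate: at \<open>\<alpha> *s V0 - \<beta> *s V1\<close>
    the ratio of the two linear forms is \<open>\<alpha> / \<beta>\<close>.\<close>
  define \<Theta> where "\<Theta> v = homogenize N P' v *s V0 - homogenize N Q' v *s V1" for v
  have comb: "\<alpha> *s V0 - \<beta> *s V1 = 0 \<Longrightarrow> \<alpha> = 0 \<and> \<beta> = 0" for \<alpha> \<beta>
  proof -
    assume "\<alpha> *s V0 - \<beta> *s V1 = 0"
    then have "\<alpha> * V0 $ 1 = \<beta> * V1 $ 1" "\<alpha> * V0 $ 2 = \<beta> * V1 $ 2" by (auto simp: vec_eq_iff forall_2)
    then have "\<alpha> * \<delta> = 0" "\<beta> * \<delta> = 0" unfolding \<delta>_def by algebra+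
    then show "\<alpha> = 0 \<and> \<beta> = 0" using \<delta> by simp
  qed
  have \<Theta>0: "\<Theta> v \<noteq> 0" if "v \<noteq> 0" for v
    using homogenize_no_common_zero[OF that red(4,5) N_def] comb unfolding \<Theta>_def by blast
  have \<Theta>_hom: "hom_poly N (\<lambda>v. \<Theta> v $ j)" for j
  proof -
    have "hom_poly N (\<lambda>v. V0 $ j * homogenize N P' v + (- V1 $ j) * homogenize N Q' v)"
      by (intro hom_poly_add hom_poly_cmult hom_poly_homogenize)
    then show ?thesis by (simp add: \<Theta>_def mult.commute)
  qed
  have \<Theta>_eval: "\<Theta> (vector [u, 1]) = poly P' u *s V0 - poly Q' u *s V1" for u
    by (simp add: \<Theta>_def homogenize_eval N_def)
  \<comment> \<open>Off this finite set the polynomial relation determines \<open>H u\<close>; its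
    points other than 0 follow by continuation.\<close>
  define T where "T = insert 0 (fib 0) \<union> {z. poly D z = 0}"
  have T: "finite T" using fib0 poly_roots_finite[OF red(3)] by (simp add: T_def)
  have off: "H u = pt (\<Theta> (vector [u, 1]))" if "u \<notin> T" for u
  proof -
    define A where "A = rep (H u)"
    define B where "B = \<Theta> (vector [u, 1])"
    have AB: "A \<noteq> 0" "B \<noteq> 0" "pt A = H u" by (simp_all add: A_def B_def rep_nonzero \<Theta>0)
    have u: "u \<noteq> 0" "u \<notin> fib 0" "poly D u \<noteq> 0" using that by (auto simp: T_def)
    have l0: "linform (a V0) A \<noteq> 0" unfolding A_def lin_rep using fib[OF u(1) r3(1)] u(2) by auto
    have "G u * poly Q u = poly P u" using PQ(2) u by blast
    then have "poly D u * (G u * poly Q' u) = poly D u * poly P' u"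
      unfolding red(1,2) poly_mult by (simp only: mult.left_commute)
    then have "G u * poly Q' u = poly P' u" unfolding mult_cancel_left using u(3) by blast
    then have rel: "linform (a V1) A * poly Q' u = linform (a V0) A * poly P' u"
      using l0 by (simp add: G_def ratio_def flip: A_def) (simp add: field_simps)
    have B: "B $ 1 = poly P' u * V0 $ 1 - poly Q' u * V1 $ 1" "B $ 2 = poly P' u * V0 $ 2 - poly Q' u * V1 $ 2"
      by (simp_all add: B_def \<Theta>_eval)
    have "linform (a V0) A * (A $ 1 * B $ 2 - A $ 2 * B $ 1) = 0"
      using rel unfolding lin B by algebra
    then have "A $ 1 * B $ 2 = A $ 2 * B $ 1" using l0 by simp
    then have "pt A = pt B" unfolding pt_eq_iff_minors[OF AB(1,2)] by (simp add: forall_2)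
    then show ?thesis using AB(3) by (simp add: B_def)
  qed
  have "H u = pt (\<Theta> (vector [u, 1]))" if "u \<noteq> 0" for u
  proof (rule hol_at_eq_extend[OF hol_at_H[OF that], where \<Psi> = "\<lambda>u. pt (\<Theta> (vector [u, 1]))"])
    have "vec_analytic_at (\<lambda>u. vector [u, 1] :: complex ^ 2) u"
      by (simp add: vec_analytic_at_def forall_2)
    then have "vec_analytic_at (\<lambda>u. \<Theta> (vector [u, 1])) u"
      using analytic_on_hom_poly[OF \<Theta>_hom] by (simp add: vec_analytic_at_def)
    then show "hol_at (\<lambda>u. pt (\<Theta> (vector [u, 1]))) u" by (rule hol_at_pt) (simp add: \<Theta>0)
    show "\<forall>\<^sub>F w in at u. H w = pt (\<Theta> (vector [w, 1]))"
      using eventually_at_finite_avoid[OF T] by eventually_elim (rule off)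
  qed
  with \<Theta>_hom \<Theta>0 show thesis by (rule that)
qed

text \<open>Under \<open>u = exp (2 * pi * \<i> * z)\<close> multiplication of \<open>z\<close> by
  \<open>k\<close> becomes the power map, which gives the semiconjugacy off 0 and infinity; both
  sides are holomorphic along curves through these two points.\<close>

theorem monomial: "monomial_type f"
proof -
  obtain N and \<Theta> :: "complex ^ 2 \<Rightarrow> complex ^ 2"
    where \<Theta>_hom: "\<And>j. hom_poly N (\<lambda>v. \<Theta> v $ j)" and \<Theta>0: "\<And>v. v \<noteq> 0 \<Longrightarrow> \<Theta> v \<noteq> 0"
    and HP: "\<And>u. u \<noteq> 0 \<Longrightarrow> H u = pt (\<Theta> (vector [u, 1]))"
    using monomial_representation by blast
  define \<pi> where "\<pi> p = pt (\<Theta> (rep p))" for p :: P1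
  have \<Theta>_scale: "\<Theta> (c *s v) = c ^ N *s \<Theta> v" for c v
    using hom_poly_scale[OF \<Theta>_hom] by (simp add: vec_eq_iff)
  have \<pi>_pt: "\<pi> (pt v) = pt (\<Theta> v)" if "v \<noteq> 0" for v
    using that by (auto simp: \<pi>_def \<Theta>_scale pt_scale \<Theta>0 intro: rep_pt[OF that])
  have \<Theta>_lift: "\<Theta> v \<noteq> 0 \<and> \<pi> (pt v) = pt (\<Theta> v)" if "v \<noteq> 0" for v
    using \<Theta>0 \<pi>_pt that by blast
  have hol_at_\<pi>: "hol_at (\<lambda>t. \<pi> (\<Phi> t)) z" if "hol_at \<Phi> z" for \<Phi> z
    by (rule hol_at_hom_poly[where F = \<Theta> and d = N]) (use \<Theta>_hom \<Theta>_lift that in auto)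
  have hol_at_f: "hol_at (\<lambda>t. f (\<Phi> t)) z" if "hol_at \<Phi> z" for \<Phi> z
    by (rule hol_at_hom_poly[where F = F and d = d]) (use F that in auto)
  have "morphism UNIV UNIV \<pi>"
    unfolding morphism_def
  proof (intro conjI ballI)
    fix x :: P1
    obtain v where v: "v \<noteq> 0" "x = pt v" using pt_surj by blast
    show "\<exists>d (F :: complex ^ 2 \<Rightarrow> complex ^ 2). (\<forall>j. hom_poly d (\<lambda>v. F v $ j)) \<and>
        (\<exists>v. v \<noteq> 0 \<and> pt v = x \<and> F v \<noteq> 0) \<and>
        (\<forall>v. v \<noteq> 0 \<and> pt v \<in> UNIV \<and> F v \<noteq> 0 \<longrightarrow> \<pi> (pt v) = pt (F v))"
      using \<Theta>_hom \<Theta>_lift v by blast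
  qed simp
  moreover have "\<not> \<pi> constant_on UNIV"
  proof
    assume "\<pi> constant_on UNIV"
    then obtain p where p: "\<And>x. \<pi> x = p" by (auto simp: constant_on_def)
    have "\<Psi> z = p" for z
      using HP[of "exp (2 * pi * \<i> * z)"] \<pi>_pt[of "vector [exp (2 * pi * \<i> * z), 1]"] p H_exp[of z] by simp
    then show False using not_locally_constant[of p 0] by simp
  qed
  moreover have "f (\<pi> (pt v)) = \<pi> (pt (power_lift k v))" if "v \<noteq> 0" for v
  proof -
    define E where "E v \<longleftrightarrow> f (\<pi> (pt v)) = \<pi> (pt (power_lift k v))" for v
    have E_scale: "E (c *s v) \<longleftrightarrow> E v" if "c \<noteq> 0" "v \<noteq> 0" for c v
      using that by (simp add: E_def power_lift_scale pt_scale power_lift_nonzero)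
    have gen: "E (vector [u, 1])" if u: "u \<noteq> 0" for u
    proof -
      obtain z where z: "u = exp (2 * pi * \<i> * z)" using ex_exp[OF u] by blast
      define u' where "u' = exp (2 * pi * \<i> * (of_int k * z))"
      have u': "u' \<noteq> 0" by (simp add: u'_def)
      have "u' = u powi k"
        unfolding u'_def z exp_power_int by (simp add: mult_ac)
      \<comment> \<open>For negative \<open>k\<close> the vector is
        \<open>[1, u ^ nat (- k)]\<close>, and extracting the second entry as a factor restores the
        form \<open>[u', 1]\<close>.\<close>
      then have "power_lift k (vector [u, 1]) = (if k \<ge> 0 then 1 else u ^ nat (- k)) *s vector [u', 1]"
        using u by (auto simp: power_lift_def power_int_def vec_eq_iff forall_2 power_inverse)
      then have "pt (power_lift k (vector [u, 1])) = pt (vector [u', 1])"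
        using u by (simp add: pt_scale)
      then have "\<pi> (pt (power_lift k (vector [u, 1]))) = H u'" using HP[OF u'] \<pi>_pt by simp
      moreover have "f (\<pi> (pt (vector [u, 1]))) = f (\<Psi> z)"
        using HP[OF u] \<pi>_pt H_exp[of z] z by simp
      ultimately show ?thesis using eq[of z] H_exp[of "of_int k * z"] by (simp add: E_def u'_def)
    qed
    have lim: "E (A 0)" if A: "vec_analytic_at A 0" "A 0 \<noteq> 0" "\<And>t. t \<noteq> 0 \<Longrightarrow> E (A t)" for A
      unfolding E_def
    proof (rule hol_at_eq_extend[where \<Phi> = "\<lambda>t. f (\<pi> (pt (A t)))" and \<Psi> = "\<lambda>t. \<pi> (pt (power_lift k (A t)))"])
      have "hol_at (\<lambda>t. pt (A t)) 0" using A(1,2) by (rule hol_at_pt)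
      then have "hol_at (\<lambda>t. \<pi> (pt (A t))) 0" by (rule hol_at_\<pi>)
      then show "hol_at (\<lambda>t. f (\<pi> (pt (A t)))) 0" by (rule hol_at_f)
      have "vec_analytic_at (\<lambda>t. power_lift k (A t)) 0"
        using analytic_on_hom_poly[OF hom_poly_power_lift A(1)] by (simp add: vec_analytic_at_def)
      then have "hol_at (\<lambda>t. pt (power_lift k (A t))) 0"
        using power_lift_nonzero[OF A(2)] by (rule hol_at_pt)
      then show "hol_at (\<lambda>t. \<pi> (pt (power_lift k (A t)))) 0" by (rule hol_at_\<pi>)
      have "\<forall>\<^sub>F t in at 0. t \<notin> {0::complex}" by (rule eventually_at_finite_avoid) simp
      then show "\<forall>\<^sub>F t in at 0. f (\<pi> (pt (A t))) = \<pi> (pt (power_lift k (A t)))"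
        by eventually_elim (use A(3) in \<open>auto simp: E_def\<close>)
    qed
    have E0: "E (vector [0, 1])"
      using lim[of "\<lambda>t. vector [t, 1]"] gen by (simp add: vec_analytic_at_def forall_2)
    have "E (vector [1, t])" if "t \<noteq> 0" for t
    proof -
      have "vector [1, t] = t *s (vector [1 / t, 1] :: complex ^ 2)"
        using that by (simp add: vec_eq_iff forall_2)
      then show ?thesis using E_scale gen that by simp
    qed
    then have E1: "E (vector [1, 0])"
      using lim[of "\<lambda>t. vector [1, t]"] by (simp add: vec_analytic_at_def forall_2)
    from that have "E v"
    proof (cases rule: vec2_cases)
      case (1 c z)
      then show ?thesis using gen[of z] E0 E_scale by (cases "z = 0") auto
    next
      case (2 c)
      then show ?thesis using E1 E_scale by simp
    qed
    then show ?thesis by (simp add: E_def)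
  qed
  ultimately show ?thesis unfolding monomial_type_def using k2 by blast
qed

end

section \<open>A quasi-periodic function with simple poles at the lattice points\<close>

text \<open>Together with \<open>qb\<close>, the terms of the logarithmic derivative
  \<open>u * d/du\<close> of a theta product: \<open>qa\<close> comes from the factor
  \<open>1 - u * q ^ n\<close> and \<open>qb\<close> from
  \<open>1 - q ^ (n + 1) / u\<close>.\<close>

definition qa :: "complex \<Rightarrow> nat \<Rightarrow> complex \<Rightarrow> complex" where
  "qa q n u = u * q ^ n / (u * q ^ n - 1)"

definition qb :: "complex \<Rightarrow> nat \<Rightarrow> complex \<Rightarrow> complex" where
  "qb q n u = q ^ (n + 1) / (u - q ^ (n + 1))"

definition qsum :: "complex \<Rightarrow> complex \<Rightarrow> complex" where
  "qsum q u = (\<Sum>n. qa q n u) + (\<Sum>n. qb q n u)"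

text \<open>Geometric bounds, uniform near \<open>u0\<close>, from an index on after which no term
  has a pole there.\<close>

lemma q_tail_bounds:
  assumes q: "norm q < 1" and u0: "u0 \<noteq> 0"
  obtains N M where "summable M" "N \<ge> 1"
    "\<forall>n\<ge>N. \<forall>u\<in>ball u0 (norm u0 / 2). norm (qa q n u) \<le> M n \<and> norm (qb q n u) \<le> M n \<and>
      u * q ^ n \<noteq> 1 \<and> u \<noteq> q ^ (n + 1)"
proof -
  define \<rho> where "\<rho> = norm q"
  define R where "R = norm u0"
  have R: "R > 0" using u0 by (simp add: R_def)
  \<comment> \<open>The sum of the constants \<open>3 * R\<close> for \<open>qa\<close> and
    \<open>4 / R\<close> for \<open>qb\<close>.\<close>
  define M where "M n = (3 * R + 4 / R) * \<rho> ^ n" for n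
  have "summable M" unfolding M_def using q by (intro summable_mult summable_geometric) (simp add: \<rho>_def)
  have "(\<lambda>n. \<rho> ^ n) \<longlonglongrightarrow> 0" using q by (intro LIMSEQ_power_zero) (simp add: \<rho>_def)
  \<comment> \<open>The first bound gives \<open>norm (u * q ^ n) \<le> 1 / 2\<close>; the second
    keeps \<open>q ^ (n + 1)\<close> at distance at least \<open>R / 4\<close> from
    \<open>u\<close>.\<close>
  then have "\<forall>\<^sub>F n in sequentially. \<rho> ^ n < min (1 / (3 * R)) (R / 4)"
    by (rule order_tendstoD) (use R in auto)
  then obtain N0 where N0: "\<And>n. n \<ge> N0 \<Longrightarrow> \<rho> ^ n < min (1 / (3 * R)) (R / 4)"
    by (auto simp: eventually_sequentially)
  show thesis
  proof (rule that[of M "N0 + 1"])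
    show "\<forall>n\<ge>N0 + 1. \<forall>u\<in>ball u0 (norm u0 / 2). norm (qa q n u) \<le> M n \<and> norm (qb q n u) \<le> M n \<and>
      u * q ^ n \<noteq> 1 \<and> u \<noteq> q ^ (n + 1)"
    proof (intro allI impI ballI)
      fix n u
      assume n: "n \<ge> N0 + 1" and "u \<in> ball u0 (norm u0 / 2)"
      then have d: "norm (u0 - u) < R / 2" by (simp add: dist_norm R_def)
      have u: "norm u < 3 * R / 2" "R / 2 < norm u"
        using d norm_triangle_ineq2[of u0 u] norm_triangle_ineq2[of u u0]
        by (auto simp: R_def norm_minus_commute)
      have qn: "\<rho> ^ n < 1 / (3 * R)" "\<rho> ^ n < R / 4" using N0[of n] n by auto
      have qn1: "norm (q ^ (n + 1)) \<le> \<rho> ^ n"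
        using q by (simp add: norm_mult norm_power \<rho>_def mult_left_le_one_le)
      have "norm (u * q ^ n) = norm u * \<rho> ^ n" by (simp add: norm_mult norm_power \<rho>_def)
      also have "\<dots> \<le> 3 * R / 2 * \<rho> ^ n" using u by (intro mult_right_mono) (auto simp: \<rho>_def)
      finally have uq: "norm (u * q ^ n) \<le> 3 * R / 2 * \<rho> ^ n" .
      also have "\<dots> \<le> 3 * R / 2 * (1 / (3 * R))" using qn R by (intro mult_left_mono) auto
      finally have "norm (u * q ^ n) \<le> 1 / 2" using R by simp
      then have da: "norm (u * q ^ n - 1) \<ge> 1 / 2"
        using norm_triangle_ineq2[of 1 "u * q ^ n"] by (simp add: norm_minus_commute)
      have "norm (qa q n u) \<le> (3 * R / 2 * \<rho> ^ n) / (1 / 2)"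
        unfolding qa_def norm_divide using uq da R by (intro frac_le) (auto simp: \<rho>_def)
      also have "\<dots> \<le> M n" using R by (simp add: M_def \<rho>_def algebra_simps)
      finally have 1: "norm (qa q n u) \<le> M n" .
      have db: "norm (u - q ^ (n + 1)) \<ge> R / 4"
        using norm_triangle_ineq2[of u "q ^ (n + 1)"] qn1 qn(2) u(2) by linarith
      have "norm (qb q n u) \<le> \<rho> ^ n / (R / 4)"
        unfolding qb_def norm_divide using qn1 db R by (intro frac_le) (auto simp: \<rho>_def)
      also have "\<dots> \<le> M n" using R by (simp add: M_def \<rho>_def algebra_simps)
      finally have 2: "norm (qb q n u) \<le> M n" .
      show "norm (qa q n u) \<le> M n \<and> norm (qb q n u) \<le> M n \<and> u * q ^ n \<noteq> 1 \<and> u \<noteq> q ^ (n + 1)"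
        using 1 2 da db R by auto
    qed
  qed (use \<open>summable M\<close> in auto)
qed

lemma holomorphic_on_suminf:
  fixes f :: "nat \<Rightarrow> complex \<Rightarrow> complex"
  assumes "open B" "\<And>n. f n holomorphic_on B" "\<And>n u. u \<in> B \<Longrightarrow> norm (f n u) \<le> M n" "summable M"
  shows "(\<lambda>u. \<Sum>n. f n u) holomorphic_on B"
proof (rule holomorphic_uniform_sequence[OF assms(1)])
  show "(\<lambda>u. \<Sum>i<n. f i u) holomorphic_on B" for n by (intro holomorphic_intros assms(2))
  fix x assume "x \<in> B"
  then obtain d where d: "d > 0" "cball x d \<subseteq> B" using assms(1) open_contains_cball by blast
  have "uniform_limit (cball x d) (\<lambda>n u. \<Sum>i<n. f i u) (\<lambda>u. \<Sum>n. f n u) sequentially"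
    using d assms(3) by (intro Weierstrass_m_test[OF _ assms(4)]) blast
  with d show "\<exists>d. 0 < d \<and> cball x d \<subseteq> B \<and>
      uniform_limit (cball x d) (\<lambda>n u. \<Sum>i<n. f i u) (\<lambda>u. \<Sum>n. f n u) sequentially" by blast
qed

lemma q_summable:
  assumes q: "norm q < 1" and u: "u \<noteq> 0"
  shows "summable (\<lambda>n. qa q n u)" "summable (\<lambda>n. qb q n u)"
proof -
  obtain N M where M: "summable M" "N \<ge> 1"
    "\<forall>n\<ge>N. \<forall>u\<in>ball u (norm u / 2). norm (qa q n u) \<le> M n \<and> norm (qb q n u) \<le> M n \<and>
      u * q ^ n \<noteq> 1 \<and> u \<noteq> q ^ (n + 1)"
    by (rule q_tail_bounds[OF assms])
  have "u \<in> ball u (norm u / 2)" using u by simp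
  then show "summable (\<lambda>n. qa q n u)" "summable (\<lambda>n. qb q n u)"
    using M(3) by (auto intro!: summable_comparison_test'[OF M(1), of N])
qed

text \<open>Finitely many rational terms carry all poles near \<open>u0\<close>; the tails converge
  uniformly.\<close>

lemma qsum_local:
  assumes q: "norm q < 1" and u0: "u0 \<noteq> 0"
  obtains N h where "N \<ge> 1" "h analytic_on {u0}"
    "\<forall>\<^sub>F u in nhds u0. qsum q u = (\<Sum>n<N. qa q n u + qb q n u) + h u"
proof -
  obtain N M where M: "summable M" and N: "N \<ge> 1"
    "\<forall>n\<ge>N. \<forall>u\<in>ball u0 (norm u0 / 2). norm (qa q n u) \<le> M n \<and> norm (qb q n u) \<le> M n \<and>
      u * q ^ n \<noteq> 1 \<and> u \<noteq> q ^ (n + 1)"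
    by (rule q_tail_bounds[OF assms])
  define B where "B = ball u0 (norm u0 / 2)"
  have B: "open B" "u0 \<in> B" using u0 by (auto simp: B_def)
  have M': "summable (\<lambda>n. M (n + N))" using M by (subst summable_iff_shift)
  define h where "h u = (\<Sum>n. qa q (n + N) u) + (\<Sum>n. qb q (n + N) u)" for u
  have "(\<lambda>u. \<Sum>n. qa q (n + N) u) holomorphic_on B"
  proof (rule holomorphic_on_suminf[OF B(1) _ _ M'])
    show "qa q (n + N) holomorphic_on B" for n
      unfolding qa_def[abs_def] using N(2)[rule_format, of "n + N"] by (intro holomorphic_intros) (auto simp: B_def)
  qed (use N(2) in \<open>auto simp: B_def\<close>)
  moreover have "(\<lambda>u. \<Sum>n. qb q (n + N) u) holomorphic_on B"
  proof (rule holomorphic_on_suminf[OF B(1) _ _ M'])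
    show "qb q (n + N) holomorphic_on B" for n
      unfolding qb_def[abs_def] using N(2)[rule_format, of "n + N"] by (intro holomorphic_intros) (auto simp: B_def)
  qed (use N(2) in \<open>auto simp: B_def\<close>)
  ultimately have "h holomorphic_on B" unfolding h_def by (intro holomorphic_intros)
  then have "h analytic_on {u0}" using B by (auto simp: analytic_at)
  moreover have "\<forall>\<^sub>F u in nhds u0. u \<in> B" using B by (rule eventually_nhds_in_open)
  then have "\<forall>\<^sub>F u in nhds u0. qsum q u = (\<Sum>n<N. qa q n u + qb q n u) + h u"
  proof eventually_elim
    case (elim u)
    then have "u \<noteq> 0" using u0 by (auto simp: B_def dist_norm)
    from q_summable[OF q this] show ?case
      unfolding qsum_def h_def
      by (simp add: suminf_split_initial_segment[of "\<lambda>n. qa q n u" N]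
          suminf_split_initial_segment[of "\<lambda>n. qb q n u" N] sum.distrib)
  qed
  ultimately show thesis using that N(1) by blast
qed

text \<open>Replacing \<open>u\<close> by \<open>q * u\<close> shifts the two series by one index in
  opposite directions: the first loses \<open>u / (u - 1)\<close>, the second gains
  \<open>1 / (u - 1)\<close>.\<close>

lemma qsum_shift:
  assumes q: "norm q < 1" "q \<noteq> 0" and u: "u \<noteq> 0" "u \<noteq> 1"
  shows "qsum q (q * u) = qsum q u - 1"
proof -
  have s: "summable (\<lambda>n. qa q n u)" "summable (\<lambda>n. qb q n (q * u))"
    using q_summable[OF q(1)] u q by auto
  have "qa q n (q * u) = qa q (Suc n) u" for n by (simp add: qa_def mult_ac)
  then have 1: "(\<Sum>n. qa q n (q * u)) = (\<Sum>n. qa q n u) - u / (u - 1)"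
    using suminf_split_head[OF s(1)] by (simp add: qa_def)
  have "qb q (Suc n) (q * u) = qb q n u" for n
  proof -
    have "q * u - q * q ^ Suc n = q * (u - q ^ Suc n)" by (simp add: algebra_simps)
    then show ?thesis using q(2) by (simp add: qb_def)
  qed
  moreover have "qb q 0 (q * u) = 1 / (u - 1)"
  proof -
    have "q * u - q = q * (u - 1)" by (simp add: algebra_simps)
    then show ?thesis using q(2) by (simp add: qb_def)
  qed
  ultimately have 2: "(\<Sum>n. qb q n (q * u)) = (\<Sum>n. qb q n u) + 1 / (u - 1)"
    using suminf_split_head[OF s(2)] by (simp add: algebra_simps)
  have "1 / (u - 1) - u / (u - 1) = -1" using u(2) by (simp add: field_simps)
  then show ?thesis unfolding qsum_def 1 2 by (simp add: algebra_simps)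
qed

section \<open>The lattice and the logarithmic derivative of its theta function\<close>

locale period_lattice =
  fixes \<tau> :: complex
  assumes Im_tau: "Im \<tau> > 0"
begin

definition L :: "complex set" where
  "L = {of_int m + of_int n * \<tau> | m n. True}"

lemma L_I: "of_int m + of_int n * \<tau> \<in> L" by (auto simp: L_def)

lemma L_0: "0 \<in> L" and L_1: "1 \<in> L" and L_tau: "\<tau> \<in> L"
  using L_I[of 0 0] L_I[of 1 0] L_I[of 0 1] by simp_all

lemma L_diff: "s \<in> L \<Longrightarrow> t \<in> L \<Longrightarrow> s - t \<in> L"
proof -
  assume "s \<in> L" "t \<in> L"
  then obtain a b c d where "s = of_int a + of_int b * \<tau>" "t = of_int c + of_int d * \<tau>"
    by (auto simp: L_def)
  then have "s - t = of_int (a - c) + of_int (b - d) * \<tau>" by (simp add: algebra_simps)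
  then show ?thesis using L_I by metis
qed

lemma L_minus: "s \<in> L \<Longrightarrow> - s \<in> L" using L_diff[OF L_0] by simp

lemma L_add: "s \<in> L \<Longrightarrow> t \<in> L \<Longrightarrow> s + t \<in> L" using L_diff[OF _ L_minus, of s t] by simp

lemma L_minus_iff [simp]: "- s \<in> L \<longleftrightarrow> s \<in> L" using L_minus[of s] L_minus[of "- s"] by auto

lemma L_add_iff: "t \<in> L \<Longrightarrow> s + t \<in> L \<longleftrightarrow> s \<in> L" using L_add[of s t] L_diff[of "s + t" t] by auto

text \<open>Comparing coefficients with respect to 1 and \<open>\<tau>\<close> would make an odd
  numerator even. These are the points of order 2 of the torus.\<close>

lemma L_half: "1 / 2 \<notin> L" "\<tau> / 2 \<notin> L" "(1 + \<tau>) / 2 \<notin> L"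
proof -
  have *: False if "of_int a / 2 + of_int b / 2 * \<tau> = of_int m + of_int n * \<tau>" "odd a \<or> odd b" for a b m n
  proof -
    have "of_int b / 2 * Im \<tau> = of_int n * Im \<tau>" using arg_cong[OF that(1), of Im] by simp
    then have "real_of_int b = real_of_int (2 * n)" using Im_tau by simp
    then have b: "b = 2 * n" by (simp only: of_int_eq_iff)
    then have "(of_int a :: complex) = of_int (2 * m)" using that(1) by simp
    then have "a = 2 * m" by (simp only: of_int_eq_iff)
    with b that(2) show False by simp
  qed
  show "1 / 2 \<notin> L" using *[of 1 0] by (auto simp: L_def)
  show "\<tau> / 2 \<notin> L" using *[of 0 1] by (auto simp: L_def)
  show "(1 + \<tau>) / 2 \<notin> L" using *[of 1 1] by (auto simp: L_def add_divide_distrib)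
qed

lemma L_discrete:
  obtains r where "r > 0" "L \<inter> ball 0 r \<subseteq> {0}"
proof (rule that[of "min 1 (Im \<tau>)"])
  show "L \<inter> ball 0 (min 1 (Im \<tau>)) \<subseteq> {0}"
  proof
    fix t assume t: "t \<in> L \<inter> ball 0 (min 1 (Im \<tau>))"
    then obtain m n where mn: "t = of_int m + of_int n * \<tau>" by (auto simp: L_def)
    have "\<bar>Im t\<bar> < Im \<tau>" using abs_Im_le_cmod[of t] t by simp
    then have "\<bar>real_of_int n\<bar> * Im \<tau> < 1 * Im \<tau>" using Im_tau by (simp add: mn abs_mult)
    then have "\<bar>real_of_int n\<bar> < 1" using Im_tau mult_less_cancel_right_pos by blast
    then have n: "n = 0" by simp
    then have "norm (of_int m :: complex) < 1" using t mn by simp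
    then show "t \<in> {0}" using mn n by simp
  qed
qed (use Im_tau in auto)

lemma eventually_not_L: "\<forall>\<^sub>F w in at z. w \<notin> L"
proof -
  obtain r where r: "r > 0" "L \<inter> ball 0 r \<subseteq> {0}" by (rule L_discrete)
  have "finite (L \<inter> ball z 1)"
    by (rule discrete_subgroup_finite_bounded[OF L_diff r bounded_ball])
  then have "\<forall>\<^sub>F w in at z. w \<notin> L \<inter> ball z 1" by (rule eventually_at_finite_avoid)
  moreover have "\<forall>\<^sub>F w in at z. w \<in> ball z 1 - {z}" by (rule eventually_at_in_open) auto
  ultimately show ?thesis by eventually_elim auto
qed

lemma eventually_nhds_not_L: "z \<notin> L \<Longrightarrow> \<forall>\<^sub>F w in nhds z. w \<notin> L"
  using eventually_not_L[of z] by (simp add: eventually_nhds_conv_at)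

definition ex :: "complex \<Rightarrow> complex" where "ex z = exp (2 * pi * \<i> * z)"

definition q :: complex where "q = ex \<tau>"

lemma ex_add: "ex (z + w) = ex z * ex w" by (simp add: ex_def exp_add distrib_left)

lemma ex_1: "ex 1 = 1" by (simp add: ex_def)

lemma ex_nonzero [simp]: "ex z \<noteq> 0" by (simp add: ex_def)

lemma ex_0 [simp]: "ex 0 = 1" by (simp add: ex_def)

lemma ex_mult_nat: "ex (of_nat n * z) = ex z ^ n"
  by (simp add: ex_def mult_ac flip: exp_of_nat_mult)

lemma q: "norm q < 1" "q \<noteq> 0"
  using Im_tau by (simp_all add: q_def ex_def norm_exp_eq_Re)

lemma ex_eq_imp_L:
  assumes "ex z = ex (of_int n * \<tau>)"
  shows "z \<in> L"
proof -
  obtain m :: int where "2 * pi * \<i> * z = 2 * pi * \<i> * (of_int n * \<tau>) + of_int (2 * m) * pi * \<i>"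
    using assms unfolding ex_def exp_eq by blast
  then have "2 * pi * \<i> * z = 2 * pi * \<i> * (of_int m + of_int n * \<tau>)" by (simp add: algebra_simps)
  then have "z = of_int m + of_int n * \<tau>" by simp
  then show ?thesis using L_I by simp
qed

lemma q_nonzero_terms:
  assumes "z \<notin> L"
  shows "ex z * q ^ n \<noteq> 1" "ex z \<noteq> q ^ n"
proof -
  have "ex (z + of_nat n * \<tau>) = ex z * q ^ n" by (simp add: ex_add ex_mult_nat q_def)
  moreover have "z + of_nat n * \<tau> \<notin> L" using assms L_add_iff[of "of_nat n * \<tau>" z] L_I[of 0 "int n"] by simp
  ultimately show "ex z * q ^ n \<noteq> 1" using ex_eq_imp_L[of "z + of_nat n * \<tau>" 0] by auto
  have "q ^ n = ex (of_int (int n) * \<tau>)" by (simp add: ex_mult_nat q_def)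
  then show "ex z \<noteq> q ^ n" using assms ex_eq_imp_L by metis
qed

text \<open>The values at lattice points are chosen such that quasi-periodicity holds without exception.\<close>

definition zt :: "complex \<Rightarrow> complex" where
  "zt z = 2 * pi * \<i> * (if z \<in> L then - of_real (Im z / Im \<tau>) else qsum q (ex z))"

lemma zt_1: "zt (z + 1) = zt z"
  by (simp add: zt_def L_add_iff L_1 ex_add ex_1)

lemma zt_tau: "zt (z + \<tau>) = zt z - 2 * pi * \<i>"
proof (cases "z \<in> L")
  case True
  then show ?thesis using Im_tau by (simp add: zt_def L_add_iff L_tau add_divide_distrib algebra_simps)
next
  case False
  have "ex z \<noteq> 1" using q_nonzero_terms(1)[OF False, of 0] by simp
  then have "qsum q (q * ex z) = qsum q (ex z) - 1" by (intro qsum_shift q) simp_all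
  moreover have "z + \<tau> \<notin> L" "ex (z + \<tau>) = q * ex z"
    using False by (simp_all add: L_add_iff L_tau ex_add q_def)
  ultimately have "zt (z + \<tau>) = 2 * pi * \<i> * (qsum q (ex z) - 1)" by (simp add: zt_def)
  also have "\<dots> = zt z - 2 * pi * \<i>" using False by (simp add: zt_def right_diff_distrib)
  finally show ?thesis .
qed

lemma analytic_ex: "ex analytic_on S"
  unfolding ex_def[abs_def] by (intro analytic_intros)

lemma zt_near:
  obtains N h where "N \<ge> 1" "h analytic_on {z}"
    "\<forall>\<^sub>F w in at z. zt w = 2 * pi * \<i> * ((\<Sum>n<N. qa q n (ex w) + qb q n (ex w)) + h w)"
proof -
  obtain N h where h: "N \<ge> 1" "h analytic_on {ex z}"
    "\<forall>\<^sub>F u in nhds (ex z). qsum q u = (\<Sum>n<N. qa q n u + qb q n u) + h u"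
    by (rule qsum_local[OF q(1) ex_nonzero])
  have "(h \<circ> ex) analytic_on {z}" using h(2) analytic_ex by (intro analytic_on_compose) auto
  moreover have "\<forall>\<^sub>F w in nhds z. qsum q (ex w) = (\<Sum>n<N. qa q n (ex w) + qb q n (ex w)) + h (ex w)"
    using h(3) analytic_at_tendsto_nhds[OF analytic_ex] by (rule eventually_compose_filterlim)
  from eventually_nhds_imp_at[OF this] eventually_not_L
  have "\<forall>\<^sub>F w in at z. zt w = 2 * pi * \<i> * ((\<Sum>n<N. qa q n (ex w) + qb q n (ex w)) + (h \<circ> ex) w)"
    by eventually_elim (simp add: zt_def)
  ultimately show thesis using that h(1) by blast
qed

lemma zt_meromorphic: "zt meromorphic_on {z}"
proof -
  obtain N h where "N \<ge> 1" and h: "h analytic_on {z}"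
    "\<forall>\<^sub>F w in at z. zt w = 2 * pi * \<i> * ((\<Sum>n<N. qa q n (ex w) + qb q n (ex w)) + h w)"
    by (rule zt_near)
  have "(\<lambda>w. 2 * pi * \<i> * ((\<Sum>n<N. qa q n (ex w) + qb q n (ex w)) + h w)) meromorphic_on {z}"
    unfolding qa_def qb_def
    by (intro meromorphic_intros analytic_on_imp_meromorphic_on h(1) analytic_ex)
  then show ?thesis using h(2) by (subst meromorphic_on_cong[OF _ refl]) auto
qed

lemma zt_analytic:
  assumes "z \<notin> L"
  shows "zt analytic_on {z}"
proof -
  obtain N h where "N \<ge> 1" and h: "h analytic_on {ex z}"
    "\<forall>\<^sub>F u in nhds (ex z). qsum q u = (\<Sum>n<N. qa q n u + qb q n u) + h u"
    by (rule qsum_local[OF q(1) ex_nonzero])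
  have "\<forall>\<^sub>F w in nhds z. qsum q (ex w) = (\<Sum>n<N. qa q n (ex w) + qb q n (ex w)) + h (ex w)"
    using h(2) analytic_at_tendsto_nhds[OF analytic_ex] by (rule eventually_compose_filterlim)
  with eventually_nhds_not_L[OF assms]
  have ev: "\<forall>\<^sub>F w in nhds z. zt w = 2 * pi * \<i> * ((\<Sum>n<N. qa q n (ex w) + qb q n (ex w)) + (h \<circ> ex) w)"
    by eventually_elim (simp add: zt_def)
  have "(h \<circ> ex) analytic_on {z}" using h(1) analytic_ex by (intro analytic_on_compose) auto
  then have "(\<lambda>w. 2 * pi * \<i> * ((\<Sum>n<N. qa q n (ex w) + qb q n (ex w)) + (h \<circ> ex) w)) analytic_on {z}"
    unfolding qa_def qb_def using q_nonzero_terms[OF assms]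
    by (intro analytic_intros analytic_ex) (auto simp: o_def simp del: power_Suc)
  then show ?thesis using ev by (subst analytic_at_cong[OF _ refl]) auto
qed

text \<open>Only the term \<open>n = 0\<close> of the first series is singular at 0; it equals
  \<open>ex w / (ex w - 1)\<close>, and the derivative of \<open>ex\<close> at 0 cancels the
  prefactor \<open>2 * pi * \<i>\<close>.\<close>

lemma zt_pole: "((\<lambda>w. w * zt w) \<longlongrightarrow> 1) (at 0)"
proof -
  obtain N h where N: "N \<ge> 1" and h: "h analytic_on {0}"
    "\<forall>\<^sub>F w in at 0. zt w = 2 * pi * \<i> * ((\<Sum>n<N. qa q n (ex w) + qb q n (ex w)) + h w)"
    by (rule zt_near)
  define g where "g w = (\<Sum>n\<in>{1..<N}. qa q n (ex w)) + (\<Sum>n<N. qb q n (ex w)) + h w" for w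
  have qn: "q ^ n \<noteq> 1" if "n \<ge> 1" for n
  proof
    assume "q ^ n = 1"
    then have "norm q ^ n = 1" by (simp flip: norm_power)
    moreover have "norm q ^ n \<le> norm q ^ 1" using q(1) that by (intro power_decreasing) auto
    ultimately show False using q(1) by simp
  qed
  have g: "g analytic_on {0}"
    unfolding g_def qa_def qb_def using qn
    by (intro analytic_intros analytic_ex h) (auto simp: simp del: power_Suc)
  have "((\<lambda>w. ex w) has_field_derivative 2 * pi * \<i>) (at 0)"
    unfolding ex_def by (auto intro!: derivative_eq_intros)
  then have "((\<lambda>w. (ex w - 1) / w) \<longlongrightarrow> 2 * pi * \<i>) (at 0)"
    by (simp add: has_field_derivative_iff)
  then have "((\<lambda>w. inverse ((ex w - 1) / w)) \<longlongrightarrow> inverse (2 * pi * \<i>)) (at 0)"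
    by (rule tendsto_inverse) simp
  then have quot: "((\<lambda>w. w / (ex w - 1)) \<longlongrightarrow> inverse (2 * pi * \<i>)) (at 0)" by simp
  have cont: "(ex \<longlongrightarrow> 1) (at 0)" "(g \<longlongrightarrow> g 0) (at 0)"
    using isContD[OF analytic_at_imp_isCont[OF analytic_ex, of 0]] isContD[OF analytic_at_imp_isCont[OF g]]
    by simp_all
  have lim: "((\<lambda>w. 2 * pi * \<i> * (w / (ex w - 1) * ex w + w * g w)) \<longlongrightarrow>
      2 * pi * \<i> * (inverse (2 * pi * \<i>) * 1 + 0 * g 0)) (at 0)"
    by (intro tendsto_intros quot cont)
  have ev: "\<forall>\<^sub>F w in at 0. 2 * pi * \<i> * (w / (ex w - 1) * ex w + w * g w) = w * zt w"
    using h(2)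
  proof eventually_elim
    case (elim w)
    have "{..<N} = insert 0 {1..<N}" using N by auto
    then have "(\<Sum>n<N. qa q n (ex w)) = ex w / (ex w - 1) + (\<Sum>n\<in>{1..<N}. qa q n (ex w))"
      by (simp add: qa_def)
    then have "zt w = 2 * pi * \<i> * (ex w / (ex w - 1) + g w)"
      unfolding elim g_def by (simp add: sum.distrib)
    then show ?case by (simp add: algebra_simps)
  qed
  have val: "2 * pi * \<i> * (inverse (2 * pi * \<i>) * 1 + 0 * g 0) = 1"
    unfolding mult_1_right mult_zero_left add_0_right by (rule right_inverse) simp
  show ?thesis using Lim_transform_eventually[OF lim ev] unfolding val .
qed

end

section \<open>Elliptic functions\<close>

text \<open>Absence of a pole as a statement on limits: the value at \<open>z\<close> itself is
  irrelevant, which suits products in which a zero cancels a pole.\<close>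

definition fin_at :: "(complex \<Rightarrow> complex) \<Rightarrow> complex \<Rightarrow> bool" where
  "fin_at f z \<longleftrightarrow> (\<exists>c. (f \<longlongrightarrow> c) (at z))"

lemma fin_at_analytic: "f analytic_on {z} \<Longrightarrow> fin_at f z"
  unfolding fin_at_def by (blast intro: isContD analytic_at_imp_isCont)

lemma fin_at_diff: "fin_at f z \<Longrightarrow> fin_at g z \<Longrightarrow> fin_at (\<lambda>w. f w - g w) z"
  and fin_at_mult: "fin_at f z \<Longrightarrow> fin_at g z \<Longrightarrow> fin_at (\<lambda>w. f w * g w) z"
  unfolding fin_at_def by (blast intro: tendsto_intros)+

lemma fin_at_shift:
  assumes "\<And>z. f (z + t) = f z + c" "fin_at f z"
  shows "fin_at f (z + t)"
proof -
  obtain l where "(f \<longlongrightarrow> l) (at z)" using assms(2) by (auto simp: fin_at_def)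
  then have "((\<lambda>w. f (w + - t)) \<longlongrightarrow> l) (at (z - - t))" by (rule LIM_offset)
  then have "((\<lambda>w. f (w - t) + c) \<longlongrightarrow> l + c) (at (z + t))" by (intro tendsto_add) simp_all
  moreover have "f (w - t) + c = f w" for w using assms(1)[of "w - t"] by simp
  ultimately show ?thesis by (auto simp: fin_at_def)
qed

text \<open>Were there a pole, its nonzero leading coefficient would be a limit of terms that tend
  to 0.\<close>

lemma meromorphic_tendsto_zero_fin_at:
  assumes "f meromorphic_on {a}" "((\<lambda>w. (w - a) * f w) \<longlongrightarrow> 0) (at a)"
  shows "fin_at f a"
proof (cases "\<exists>\<^sub>F w in at a. f w \<noteq> 0")
  case False
  then have "\<forall>\<^sub>F w in at a. f w = 0" by (auto simp: frequently_def elim: eventually_mono)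
  then show ?thesis unfolding fin_at_def by (blast intro: tendsto_eventually)
next
  case True
  obtain g where g: "g analytic_on {a}" "g a \<noteq> 0" "\<forall>\<^sub>F w in at a. f w = g w * (w - a) powi (zorder f a)"
    by (rule meromorphic_orderE[OF assms(1) True])
  have ne: "\<forall>\<^sub>F w in at a. w \<noteq> a" by (simp add: eventually_at_filter)
  have glim: "(g \<longlongrightarrow> g a) (at a)" using isContD[OF analytic_at_imp_isCont[OF g(1)]] .
  show ?thesis
  proof (cases "zorder f a \<ge> 0")
    case True
    define k where "k = nat (zorder f a)"
    have "\<forall>\<^sub>F w in at a. g w * (w - a) ^ k = f w"
      using g(3) by eventually_elim (use True in \<open>simp add: k_def power_int_def\<close>)
    moreover have "((\<lambda>w. g w * (w - a) ^ k) \<longlongrightarrow> g a * (a - a) ^ k) (at a)"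
      by (intro tendsto_intros glim)
    ultimately show ?thesis unfolding fin_at_def by (blast intro: Lim_transform_eventually)
  next
    case False
    define m where "m = nat (- (zorder f a + 1))"
    have m: "zorder f a = - int (Suc m)" using False by (simp add: m_def)
    have "((\<lambda>w. (w - a) ^ m * ((w - a) * f w)) \<longlongrightarrow> (a - a) ^ m * 0) (at a)"
      by (intro tendsto_intros assms(2))
    moreover have "\<forall>\<^sub>F w in at a. (w - a) ^ m * ((w - a) * f w) = g w"
      using g(3) ne
    proof eventually_elim
      case (elim w)
      have "(w - a) powi (- int (Suc m)) = inverse ((w - a) ^ Suc m)"
        unfolding power_int_minus power_int_of_nat ..
      moreover have "v ^ m * (v * (G * inverse (v ^ Suc m))) = G" if "v \<noteq> 0" for v G :: complex
        using that by (simp add: field_simps)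
      ultimately show ?case unfolding elim(1) m using elim(2) by simp
    qed
    ultimately have "(g \<longlongrightarrow> (a - a) ^ m * 0) (at a)" by (rule Lim_transform_eventually)
    then have "g a = 0" using tendsto_unique[OF _ glim] by simp
    with g(2) show ?thesis by simp
  qed
qed

text \<open>Once the leading coefficient is cancelled, the pole order drops by one; this drives
  every descent on pole orders below.\<close>

lemma meromorphic_lower_pole:
  assumes "f meromorphic_on {0}" "((\<lambda>w. w ^ Suc n * f w) \<longlongrightarrow> 0) (at 0)"
  obtains c where "((\<lambda>w. w ^ n * f w) \<longlongrightarrow> c) (at 0)"
proof -
  have "(\<lambda>w. w ^ n * f w) meromorphic_on {0}" using assms(1) by (intro meromorphic_intros)
  moreover have "((\<lambda>w. (w - 0) * (w ^ n * f w)) \<longlongrightarrow> 0) (at 0)"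
    using assms(2) by (simp add: mult_ac)
  ultimately have "fin_at (\<lambda>w. w ^ n * f w) 0" by (rule meromorphic_tendsto_zero_fin_at)
  then show thesis using that by (auto simp: fin_at_def)
qed

lemma analytic_extension:
  assumes "f meromorphic_on {a}" "(f \<longlongrightarrow> c) (at a)"
  obtains p where "p analytic_on {a}" "p a = c" "\<forall>\<^sub>F w in at a. f w = p w"
proof (rule that[of "remove_sings f"])
  have iso: "isolated_singularity_at f a" using assms(1) by (simp add: meromorphic_at_iff)
  show "remove_sings f analytic_on {a}" by (rule remove_sings_analytic_at[OF iso assms(2)])
  show "remove_sings f a = c" using assms(2) by (rule remove_sings_eqI)
  show "\<forall>\<^sub>F w in at a. f w = remove_sings f w"
    using eventually_remove_sings_eq_at[OF iso] by eventually_elim simp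
qed

text \<open>Writing \<open>f w = p w / w ^ n\<close> near 0 with \<open>p\<close> analytic turns the
  left side into \<open>w * deriv p w - of_nat n * p w\<close>.\<close>

lemma pole_deriv_tendsto:
  assumes "f meromorphic_on {0}" "((\<lambda>w. w ^ n * f w) \<longlongrightarrow> c) (at 0)"
  shows "((\<lambda>w. w ^ (n + 1) * deriv f w) \<longlongrightarrow> - of_nat n * c) (at 0)"
proof -
  have "(\<lambda>w. w ^ n * f w) meromorphic_on {0}" using assms(1) by (intro meromorphic_intros)
  then obtain p where p: "p analytic_on {0}" "p 0 = c" "\<forall>\<^sub>F w in at 0. w ^ n * f w = p w"
    using assms(2) by (rule analytic_extension)
  have ne: "\<forall>\<^sub>F w in at 0. w \<noteq> (0::complex)" by (simp add: eventually_at_filter)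
  have pa: "\<forall>\<^sub>F w in at 0. p analytic_on {w}"
    using p(1) by (intro eventually_nhds_imp_at) (auto simp: analytic_at eventually_nhds)
  have "\<forall>\<^sub>F w in at 0. f w = p w / w ^ n"
    using p(3) ne by eventually_elim (simp add: field_simps)
  then have "\<forall>\<^sub>F w in at 0. \<forall>\<^sub>F u in nhds w. f u = p u / u ^ n" by (rule eventually_at_nhds_propagate)
  with ne pa have "\<forall>\<^sub>F w in at 0. w * deriv p w - of_nat n * p w = w ^ (n + 1) * deriv f w"
  proof eventually_elim
    case (elim w)
    have "(p has_field_derivative deriv p w) (at w)"
      using analytic_on_imp_differentiable_at[OF elim(2)] by (simp add: DERIV_deriv_iff_field_differentiable)
    then have "((\<lambda>u. p u / u ^ n) has_field_derivative
        (deriv p w * w ^ n - p w * (of_nat n * w ^ (n - 1))) / (w ^ n * w ^ n)) (at w)"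
      using elim(1) by (auto intro!: derivative_eq_intros)
    then have "deriv f w = (deriv p w * w ^ n - p w * (of_nat n * w ^ (n - 1))) / (w ^ n * w ^ n)"
      using deriv_cong_ev[OF elim(3) refl] by (simp add: DERIV_imp_deriv)
    moreover have "deriv p w * w ^ n - p w * (of_nat n * w ^ (n - 1)) = (w * deriv p w - of_nat n * p w) * w ^ n / w"
      using elim(1) by (cases n) (simp_all add: field_simps)
    ultimately show ?case using elim(1) by simp
  qed
  moreover have "((\<lambda>w. w * deriv p w - of_nat n * p w) \<longlongrightarrow> 0 * deriv p 0 - of_nat n * p 0) (at 0)"
    using isContD[OF analytic_at_imp_isCont[OF p(1)]]
      isContD[OF analytic_at_imp_isCont[OF analytic_deriv[OF p(1)]]]
    by (intro tendsto_intros)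
  ultimately have "((\<lambda>w. w ^ (n + 1) * deriv f w) \<longlongrightarrow> 0 * deriv p 0 - of_nat n * p 0) (at 0)"
    by (rule Lim_transform_eventually[rotated])
  then show ?thesis by (simp add: p(2))
qed

lemma filterlim_uminus_at_0: "filterlim (\<lambda>w. - w) (at 0) (at (0::complex))"
  unfolding filterlim_at by (auto intro!: tendsto_eq_intros simp: eventually_at_filter)

lemma even_pole_odd_order:
  fixes h :: "complex \<Rightarrow> complex"
  assumes "\<And>z. h (- z) = h z" "((\<lambda>w. w ^ n * h w) \<longlongrightarrow> c) (at 0)" "odd n"
  shows "c = 0"
proof -
  have "((\<lambda>w. (- w) ^ n * h (- w)) \<longlongrightarrow> c) (at 0)"
    using assms(2) filterlim_uminus_at_0 by (rule filterlim_compose)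
  then have "((\<lambda>w. - (w ^ n * h w)) \<longlongrightarrow> c) (at 0)" using assms(1,3) by simp
  moreover have "((\<lambda>w. - (w ^ n * h w)) \<longlongrightarrow> - c) (at 0)" using assms(2) by (rule tendsto_minus)
  ultimately have "c = - c" by (intro tendsto_unique) auto
  then show ?thesis by simp
qed

section \<open>Liouville theorems for elliptic functions and the Weierstrass equation\<close>

context period_lattice
begin

lemma periodic_L:
  assumes "\<And>z. f (z + 1) = f z" "\<And>z. f (z + \<tau>) = f z" "t \<in> L"
  shows "f (z + t) = f z"
proof -
  have nat: "f (z + of_nat n * s) = f z" if "\<And>z. f (z + s) = f z" for n s z
  proof (induction n)
    case (Suc n)
    then show ?case using that[of "z + of_nat n * s"] by (simp add: algebra_simps)
  qed simp
  have int: "f (z + of_int n * s) = f z" if s: "\<And>z. f (z + s) = f z" for n s z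
  proof (cases n rule: int_cases2)
    case (nonneg k)
    then show ?thesis using nat[OF s, where n = k and z = z] by simp
  next
    case (nonpos k)
    then show ?thesis using nat[OF s, where n = k and z = "z - of_nat k * s"] by simp
  qed
  obtain m n where t: "t = of_int m + of_int n * \<tau>" using assms(3) by (auto simp: L_def)
  have "f (z + t) = f (z + of_int n * \<tau> + of_int m * 1)" by (simp add: t algebra_simps)
  also have "\<dots> = f z" by (simp only: int[OF assms(1)] int[OF assms(2)])
  finally show ?thesis .
qed

lemma zt_quasi:
  assumes "t \<in> L"
  obtains c where "\<forall>z. zt (z + t) = zt z + c"
proof -
  have nat: "\<exists>c. \<forall>z. zt (z + of_nat n * s) = zt z + c" if "\<forall>z. zt (z + s) = zt z + k" for n s k
  proof (induction n)
    case (Suc n)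
    then obtain c where c: "\<forall>z. zt (z + of_nat n * s) = zt z + c" by blast
    have "zt (z + of_nat (Suc n) * s) = zt z + (c + k)" for z
      using that[rule_format, of "z + of_nat n * s"] c by (simp add: algebra_simps)
    then show ?case by blast
  qed (auto intro: exI[of _ 0])
  have int: "\<exists>c. \<forall>z. zt (z + of_int n * s) = zt z + c" if s: "\<forall>z. zt (z + s) = zt z + k" for n s k
  proof (cases n rule: int_cases2)
    case (nonneg i)
    then show ?thesis using nat[OF s, where n = i] by simp
  next
    case (nonpos i)
    obtain c where c: "\<forall>z. zt (z + of_nat i * s) = zt z + c" using nat[OF s, where n = i] by blast
    have "zt (z + of_int n * s) = zt z + (- c)" for z
      using c[rule_format, of "z - of_nat i * s"] nonpos by simp
    then show ?thesis by blast
  qed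
  obtain m n where t: "t = of_int m + of_int n * \<tau>" using assms by (auto simp: L_def)
  obtain c1 where c1: "\<forall>z. zt (z + of_int m * 1) = zt z + c1"
    using int[of 1 0 m] zt_1 by auto
  obtain c2 where c2: "\<forall>z. zt (z + of_int n * \<tau>) = zt z + c2"
    using int[of \<tau> "- 2 * pi * \<i>" n] zt_tau by auto
  have "zt (z + t) = zt z + (c1 + c2)" for z
    using c2[rule_format, of "z + of_int m"] c1 by (simp add: t add.assoc)
  then show thesis using that by blast
qed

text \<open>Periodicity is demanded of total functions, including the arbitrary values at poles;
  pointwise arithmetic, with its convention for division by zero, preserves this.\<close>

definition ell :: "(complex \<Rightarrow> complex) \<Rightarrow> bool" where
  "ell h \<longleftrightarrow> (\<forall>z. h meromorphic_on {z}) \<and> (\<forall>z. h (z + 1) = h z) \<and> (\<forall>z. h (z + \<tau>) = h z)"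

lemma ell_meromorphic: "ell h \<Longrightarrow> h meromorphic_on {z}"
  and ell_periodic: "ell h \<Longrightarrow> t \<in> L \<Longrightarrow> h (z + t) = h z"
  by (auto simp: ell_def intro: periodic_L)

lemma ell_const: "ell (\<lambda>z. c)"
  and ell_add: "ell f \<Longrightarrow> ell g \<Longrightarrow> ell (\<lambda>z. f z + g z)"
  and ell_diff: "ell f \<Longrightarrow> ell g \<Longrightarrow> ell (\<lambda>z. f z - g z)"
  and ell_mult: "ell f \<Longrightarrow> ell g \<Longrightarrow> ell (\<lambda>z. f z * g z)"
  and ell_divide: "ell f \<Longrightarrow> ell g \<Longrightarrow> ell (\<lambda>z. f z / g z)"
  and ell_power: "ell f \<Longrightarrow> ell (\<lambda>z. f z ^ n)"
  by (auto simp: ell_def intro!: meromorphic_intros)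

lemma ell_prod: "(\<And>i. i \<in> I \<Longrightarrow> ell (f i)) \<Longrightarrow> ell (\<lambda>z. \<Prod>i\<in>I. f i z)"
  by (induction I rule: infinite_finite_induct) (auto intro: ell_const ell_mult)

lemma ell_shift:
  assumes "ell f"
  shows "ell (\<lambda>z. f (z - a))"
proof -
  have "(\<lambda>z. f (z - a)) meromorphic_on {z}" for z
    by (rule meromorphic_on_compose[of f "{z - a}" "\<lambda>z. z - a"])
       (use assms in \<open>auto simp: ell_def intro!: analytic_intros\<close>)
  moreover have "f (z + s - a) = f (z - a)" if "s \<in> L" for z s
  proof -
    have "z + s - a = z - a + s" by simp
    then show ?thesis by (simp only: ell_periodic[OF assms that])
  qed
  ultimately show ?thesis using L_1 L_tau by (simp add: ell_def)
qed

lemma ell_uminus_arg: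
  assumes "ell f"
  shows "ell (\<lambda>z. f (- z))"
proof -
  have "(\<lambda>z. f (- z)) meromorphic_on {z}" for z
    by (rule meromorphic_on_compose[of f "{- z}" uminus])
       (use assms in \<open>auto simp: ell_def intro!: analytic_intros\<close>)
  moreover have "f (- (z + s)) = f (- z)" if "s \<in> L" for z s
  proof -
    have "- (z + s) = - z + (- s)" by simp
    then show ?thesis using that by (simp only: ell_periodic[OF assms] L_minus_iff)
  qed
  ultimately show ?thesis using L_1 L_tau by (simp add: ell_def)
qed

lemma ell_fin_at_shift: "ell h \<Longrightarrow> t \<in> L \<Longrightarrow> fin_at h z \<Longrightarrow> fin_at h (z + t)"
  by (rule fin_at_shift[where c = 0]) (simp add: ell_periodic)

text \<open>A multiple of \<open>\<tau>\<close> adjusts the imaginary part and then an integer the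
  real part, so a rectangle serves as well as the parallelogram.\<close>

lemma fundamental_domain: "\<exists>w\<in>cbox 0 (Complex 1 (Im \<tau>)). z - w \<in> L"
proof -
  define n where "n = \<lfloor>Im z / Im \<tau>\<rfloor>"
  define z' where "z' = z - of_int n * \<tau>"
  define w where "w = z' - of_int \<lfloor>Re z'\<rfloor>"
  have "of_int n \<le> Im z / Im \<tau>" "Im z / Im \<tau> \<le> of_int n + 1"
    by (auto simp: n_def intro: less_imp_le)
  then have "of_int n * Im \<tau> \<le> Im z" "Im z \<le> (of_int n + 1) * Im \<tau>"
    using Im_tau by (simp_all add: field_simps)
  then have "0 \<le> Im w" "Im w \<le> Im \<tau>" by (simp_all add: w_def z'_def algebra_simps)
  moreover have "0 \<le> Re w" "Re w \<le> 1"
    using frac_ge_0[of "Re z'"] frac_lt_1[of "Re z'"] by (auto simp: w_def frac_def)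
  ultimately have "w \<in> cbox 0 (Complex 1 (Im \<tau>))" by (auto simp: in_cbox_complex_iff)
  moreover have "z - w = of_int \<lfloor>Re z'\<rfloor> + of_int n * \<tau>" by (simp add: w_def z'_def)
  then have "z - w \<in> L" using L_I by simp
  ultimately show ?thesis by blast
qed

lemma entire_periodic_constant:
  assumes an: "\<And>z. E analytic_on {z}" and per: "\<And>z. E (z + 1) = E z" "\<And>z. E (z + \<tau>) = E z"
  obtains C where "\<forall>z. E z = C"
proof -
  have hol: "E holomorphic_on UNIV" using an by (intro holomorphic_on_analytic_at)
  define K where "K = cbox 0 (Complex 1 (Im \<tau>))"
  have "range E \<subseteq> E ` K"
  proof
    fix y assume "y \<in> range E"
    then obtain z where z: "y = E z" by blast
    obtain w where w: "w \<in> K" "z - w \<in> L" using fundamental_domain unfolding K_def by blast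
    then have "E z = E w" using periodic_L[OF per w(2), of w] by simp
    then show "y \<in> E ` K" using z w(1) by blast
  qed
  moreover have "compact (E ` K)"
    unfolding K_def using holomorphic_on_imp_continuous_on[OF hol]
    by (intro compact_continuous_image compact_cbox) (rule continuous_on_subset, auto)
  ultimately have "bounded (range E)" using bounded_subset compact_imp_bounded by blast
  then show thesis using Liouville_theorem[OF hol] that by (auto simp: constant_on_def)
qed

lemma remove_sings_entire:
  assumes "\<And>z. h meromorphic_on {z}" "\<And>z. fin_at h z"
  shows "remove_sings h analytic_on {z}" "(h \<longlongrightarrow> remove_sings h z) (at z)"
    "\<forall>\<^sub>F w in at z. h w = remove_sings h w"
proof -
  obtain c where c: "(h \<longlongrightarrow> c) (at z)" using assms(2) by (auto simp: fin_at_def)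
  have iso: "isolated_singularity_at h z" using assms(1) by (simp add: meromorphic_at_iff)
  show "remove_sings h analytic_on {z}" by (rule remove_sings_analytic_at[OF iso c])
  show "(h \<longlongrightarrow> remove_sings h z) (at z)" using c remove_sings_eqI[OF c] by simp
  show "\<forall>\<^sub>F w in at z. h w = remove_sings h w"
    using eventually_remove_sings_eq_at[OF iso] by eventually_elim simp
qed

lemma remove_sings_quasi_periodic:
  assumes "\<And>z. h meromorphic_on {z}" "\<And>z. fin_at h z" "\<And>z. h (z + t) = h z + c"
  shows "remove_sings h (z + t) = remove_sings h z + c"
proof -
  have "((\<lambda>w. h (w + t)) \<longlongrightarrow> remove_sings h (z + t)) (at (z + t - t))"
    by (rule LIM_offset[OF remove_sings_entire(2)[OF assms(1,2)]])
  then have "((\<lambda>w. h w + c) \<longlongrightarrow> remove_sings h (z + t)) (at z)" by (simp add: assms(3))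
  moreover have "((\<lambda>w. h w + c) \<longlongrightarrow> remove_sings h z + c) (at z)"
    by (intro tendsto_intros remove_sings_entire(2)[OF assms(1,2)])
  ultimately show ?thesis by (intro tendsto_unique[of "at z"]) auto
qed

text \<open>Liouville's theorem after removal of the singularities; values of \<open>h\<close> at
  isolated points stay uncontrolled, hence the punctured conclusion.\<close>

lemma ell_no_poles:
  assumes h: "ell h" and fin: "\<And>z. fin_at h z"
  obtains C where "\<forall>z. \<forall>\<^sub>F w in at z. h w = C"
proof -
  note mero = ell_meromorphic[OF h]
  have "remove_sings h (z + t) = remove_sings h z + 0" if "t \<in> L" for z t
    using that by (intro remove_sings_quasi_periodic mero fin) (simp add: ell_periodic[OF h])
  then have per: "remove_sings h (z + 1) = remove_sings h z" "remove_sings h (z + \<tau>) = remove_sings h z" for z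
    using L_1 L_tau by simp_all
  obtain C where "\<forall>z. remove_sings h z = C"
    by (rule entire_periodic_constant[OF remove_sings_entire(1)[OF mero fin] per])
  then show thesis using remove_sings_entire(3)[OF mero fin] that by auto
qed

text \<open>Takes the place of the residue theorem. Subtracting \<open>c * zt\<close> leaves, after
  removal of singularities, an entire function with additive periods; its derivative is periodic and
  so constant. Period 1 makes the slope 0, and then \<open>\<tau>\<close> forces
  \<open>2 * pi * \<i> * c = 0\<close>.\<close>

lemma ell_no_simple_pole:
  assumes h: "ell h" and fin: "\<And>z. z \<notin> L \<Longrightarrow> fin_at h z"
    and lim: "((\<lambda>w. w * h w) \<longlongrightarrow> c) (at 0)"
  obtains C where "\<forall>z. \<forall>\<^sub>F w in at z. h w = C"
proof -
  define E where "E z = h z - c * zt z" for z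
  have mero: "E meromorphic_on {z}" for z
    unfolding E_def by (intro meromorphic_intros zt_meromorphic ell_meromorphic[OF h])
  have "((\<lambda>w. w * h w - c * (w * zt w)) \<longlongrightarrow> c - c * 1) (at 0)"
    by (intro tendsto_intros lim zt_pole)
  then have "((\<lambda>w. (w - 0) * E w) \<longlongrightarrow> 0) (at 0)" by (simp add: E_def algebra_simps)
  then have fin0: "fin_at E 0" by (intro meromorphic_tendsto_zero_fin_at mero)
  have finE: "fin_at E z" for z
  proof (cases "z \<in> L")
    case True
    then obtain k where k: "\<forall>w. zt (w + z) = zt w + k" by (rule zt_quasi)
    have "fin_at E (0 + z)"
      by (rule fin_at_shift[OF _ fin0, where c = "- c * k"])
         (simp add: E_def ell_periodic[OF h True] k algebra_simps)
    then show ?thesis by simp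
  next
    case False
    then show ?thesis unfolding E_def
      by (intro fin_at_diff fin_at_mult fin fin_at_analytic zt_analytic) simp_all
  qed
  define E0 where "E0 = remove_sings E"
  have E0_an: "E0 analytic_on {z}" for z unfolding E0_def by (rule remove_sings_entire(1)[OF mero finE])
  have "E (z + 1) = E z + 0" for z
    using ell_periodic[OF h L_1] by (simp add: E_def zt_1)
  then have E0_1: "E0 (z + 1) = E0 z" for z
    using remove_sings_quasi_periodic[OF mero finE, of 1 0] by (simp add: E0_def)
  have "E (z + \<tau>) = E z + 2 * pi * \<i> * c" for z
    unfolding E_def zt_tau ell_periodic[OF h L_tau] by (simp add: algebra_simps)
  then have E0_tau: "E0 (z + \<tau>) = E0 z + 2 * pi * \<i> * c" for z
    using remove_sings_quasi_periodic[OF mero finE, of \<tau>] by (simp add: E0_def)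
  have der: "(E0 has_field_derivative deriv E0 z) (at z)" for z
    using analytic_on_imp_differentiable_at[OF E0_an] by (simp add: DERIV_deriv_iff_field_differentiable)
  have der_per: "deriv E0 (z + t) = deriv E0 z" if "\<And>z. E0 (z + t) = E0 z + k" for z t k
  proof -
    have "((\<lambda>w. E0 (w + t)) has_field_derivative deriv E0 (z + t)) (at z)"
      using der[of "z + t"] by (simp add: DERIV_shift)
    then have "((\<lambda>w. E0 w + k) has_field_derivative deriv E0 (z + t)) (at z)" by (simp add: that)
    moreover have "((\<lambda>w. E0 w + k) has_field_derivative deriv E0 z) (at z)"
      using der by (auto intro!: derivative_eq_intros)
    ultimately show ?thesis by (rule DERIV_unique)
  qed
  obtain \<alpha> where \<alpha>: "\<forall>z. deriv E0 z = \<alpha>"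
  proof (rule entire_periodic_constant)
    show "deriv E0 analytic_on {z}" for z using E0_an by (rule analytic_deriv)
    show "deriv E0 (z + 1) = deriv E0 z" for z using der_per[of 1 0] E0_1 by simp
    show "deriv E0 (z + \<tau>) = deriv E0 z" for z using der_per E0_tau by blast
  qed
  have "((\<lambda>w. E0 w - \<alpha> * w) has_field_derivative 0) (at z)" for z
    using der[of z] \<alpha> by (auto intro!: derivative_eq_intros)
  then obtain \<beta> where "\<And>z. E0 z - \<alpha> * z = \<beta>"
    using has_field_derivative_zero_constant[of UNIV "\<lambda>w. E0 w - \<alpha> * w"] by auto
  then have \<beta>: "E0 z = \<alpha> * z + \<beta>" for z by (metis diff_add_cancel add.commute)
  have "\<alpha> = 0" using E0_1[of 0] by (simp add: \<beta>)
  then have "c = 0" using E0_tau[of 0] by (simp add: \<beta>)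
  then have "E = h" by (simp add: E_def fun_eq_iff)
  then have "fin_at h z" for z using finE by simp
  then show thesis using ell_no_poles[OF h] that by blast
qed

lemma analytic_eq_eventual_constant:
  assumes "f analytic_on {z}" "\<forall>\<^sub>F w in at z. f w = C"
  shows "f z = C"
  using isContD[OF analytic_at_imp_isCont[OF assms(1)]] tendsto_eventually[OF assms(2)]
  by (rule tendsto_unique[rotated]) simp

text \<open>The value 0 at lattice points makes the derivative of a function with additive periods
  periodic without exception.\<close>

definition dv :: "(complex \<Rightarrow> complex) \<Rightarrow> complex \<Rightarrow> complex" where
  "dv h z = (if z \<in> L then 0 else deriv h z)"

lemma dv_eventually: "\<forall>\<^sub>F w in at z. dv h w = deriv h w"
  using eventually_not_L[of z] by eventually_elim (simp add: dv_def)

lemma dv_analytic: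
  assumes "h analytic_on {z}" "z \<notin> L"
  shows "dv h analytic_on {z}"
proof -
  have "\<forall>\<^sub>F w in nhds z. dv h w = deriv h w"
    using eventually_nhds_not_L[OF assms(2)] by eventually_elim (simp add: dv_def)
  then show ?thesis using analytic_deriv[OF assms(1)] by (subst analytic_at_cong[OF _ refl]) auto
qed

lemma has_dv:
  assumes "h analytic_on {z}" "z \<notin> L"
  shows "(h has_field_derivative dv h z) (at z)"
  using analytic_on_imp_differentiable_at[OF assms(1)] assms(2)
  by (simp add: dv_def DERIV_deriv_iff_field_differentiable)

lemma ell_dv:
  assumes mero: "\<And>z. h meromorphic_on {z}" and an: "\<And>z. z \<notin> L \<Longrightarrow> h analytic_on {z}"
    and per: "\<And>z. h (z + 1) = h z + c1" "\<And>z. h (z + \<tau>) = h z + c2"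
  shows "ell (dv h)"
proof -
  have "dv h meromorphic_on {z}" for z
    using meromorphic_on_deriv[OF mero, of z] dv_eventually[of h z] by (subst meromorphic_on_cong[OF _ refl]) auto
  moreover have "dv h (z + t) = dv h z" if t: "t \<in> L" "\<And>z. h (z + t) = h z + c" for z t c
  proof (cases "z \<in> L")
    case True
    then show ?thesis using t(1) by (simp add: dv_def L_add_iff)
  next
    case False
    then have zt: "z + t \<notin> L" using t(1) by (simp add: L_add_iff)
    have "((\<lambda>w. h (w + t)) has_field_derivative dv h (z + t)) (at z)"
      using has_dv[OF an[OF zt] zt] by (simp add: DERIV_shift)
    then have "((\<lambda>w. h w + c) has_field_derivative dv h (z + t)) (at z)" by (simp add: t(2))
    moreover have "((\<lambda>w. h w + c) has_field_derivative dv h z) (at z)"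
      using has_dv[OF an[OF False] False] by (auto intro!: derivative_eq_intros)
    ultimately show ?thesis by (rule DERIV_unique)
  qed
  from this[OF L_1 per(1)] this[OF L_tau per(2)]
  have "dv h (z + 1) = dv h z" "dv h (z + \<tau>) = dv h z" for z by blast+
  ultimately show ?thesis by (simp add: ell_def)
qed

lemma dv_tendsto:
  assumes "h meromorphic_on {0}" "((\<lambda>w. w ^ n * h w) \<longlongrightarrow> c) (at 0)"
  shows "((\<lambda>w. w ^ (n + 1) * dv h w) \<longlongrightarrow> - of_nat n * c) (at 0)"
proof (rule Lim_transform_eventually[OF pole_deriv_tendsto[OF assms]])
  show "\<forall>\<^sub>F w in at 0. w ^ (n + 1) * deriv h w = w ^ (n + 1) * dv h w"
    using dv_eventually[of h 0] by eventually_elim simp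
qed

lemma ell_constant_off_L:
  assumes "ell h" "\<And>z. z \<notin> L \<Longrightarrow> h analytic_on {z}" "((\<lambda>w. w * h w) \<longlongrightarrow> c) (at 0)"
  obtains C where "\<forall>z. z \<notin> L \<longrightarrow> h z = C"
proof -
  obtain C where C: "\<forall>z. \<forall>\<^sub>F w in at z. h w = C"
    by (rule ell_no_simple_pole[OF assms(1) _ assms(3)]) (auto intro: fin_at_analytic assms(2))
  then show thesis using analytic_eq_eventual_constant assms(2) that by blast
qed

text \<open>The Weierstrass P-function up to an additive constant: off the lattice,
  \<open>zt\<close> differs from the Weierstrass zeta function by an affine function.\<close>

definition x0 :: "complex \<Rightarrow> complex" where "x0 z = - dv zt z"

lemma x0_analytic: "z \<notin> L \<Longrightarrow> x0 analytic_on {z}"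
  unfolding x0_def[abs_def] by (intro analytic_intros dv_analytic zt_analytic)

lemma ell_x0: "ell x0"
proof -
  have "ell (dv zt)"
    using zt_meromorphic zt_analytic by (rule ell_dv[of zt 0 "- (2 * pi * \<i>)"]) (simp_all add: zt_1 zt_tau)
  from ell_diff[OF ell_const[of 0] this] show ?thesis by (simp add: x0_def[abs_def])
qed

lemma x0_pole: "((\<lambda>w. w ^ 2 * x0 w) \<longlongrightarrow> 1) (at 0)"
proof -
  have "((\<lambda>w. w ^ (1 + 1) * dv zt w) \<longlongrightarrow> - of_nat 1 * 1) (at 0)"
    by (rule dv_tendsto[OF zt_meromorphic]) (use zt_pole in simp)
  then have "((\<lambda>w. - (w ^ 2 * dv zt w)) \<longlongrightarrow> - (- 1)) (at 0)"
    by (intro tendsto_minus) (simp add: numeral_2_eq_2)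
  then show ?thesis by (simp add: x0_def)
qed

lemma analytic_uminus_arg:
  assumes "f analytic_on {- z}"
  shows "(\<lambda>w. f (- w)) analytic_on {z::complex}"
proof -
  have "(f \<circ> uminus) analytic_on {z}" using assms by (intro analytic_on_compose analytic_intros) simp
  then show ?thesis by (simp add: o_def)
qed

text \<open>Twice the odd part has at most a simple pole and is constant off \<open>L\<close>;
  oddness at the half period \<open>1 / 2\<close> makes the constant 0.\<close>

lemma x0_even: "x0 (- z) = x0 z"
proof -
  define h where "h z = x0 z - x0 (- z)" for z
  have h: "ell h" unfolding h_def[abs_def] by (intro ell_diff ell_x0 ell_uminus_arg)
  have an: "h analytic_on {z}" if "z \<notin> L" for z
    unfolding h_def using that by (intro analytic_intros analytic_uminus_arg x0_analytic) simp_all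
  have "((\<lambda>w. (- w) ^ 2 * x0 (- w)) \<longlongrightarrow> 1) (at 0)"
    using x0_pole filterlim_uminus_at_0 by (rule filterlim_compose)
  from tendsto_diff[OF x0_pole this] have "((\<lambda>w. w ^ Suc 1 * h w) \<longlongrightarrow> 0) (at 0)"
    by (simp add: h_def algebra_simps power2_eq_square)
  then obtain c where "((\<lambda>w. w ^ 1 * h w) \<longlongrightarrow> c) (at 0)"
    by (rule meromorphic_lower_pole[OF ell_meromorphic[OF h]])
  then have lim: "((\<lambda>w. w * h w) \<longlongrightarrow> c) (at 0)" by simp
  obtain C where C: "\<forall>z. z \<notin> L \<longrightarrow> h z = C"
    by (rule ell_constant_off_L[OF h _ lim]) (rule an)
  have "h (- (1 / 2)) = - h (1 / 2)" by (simp add: h_def)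
  then have "C = - C" using C L_half(1) L_minus_iff[of "1 / 2"] by metis
  then have "C = 0" by simp
  show ?thesis
  proof (cases "z \<in> L")
    case True
    then show ?thesis by (simp add: x0_def dv_def)
  next
    case False
    then have "h z = 0" using C \<open>C = 0\<close> by blast
    then show ?thesis by (simp add: h_def)
  qed
qed

text \<open>The factor 1/2 gives the leading term \<open>- 1 / w ^ 3\<close>, so that
  \<open>y0 ^ 2\<close> and \<open>x0 ^ 3\<close> have the same leading term.\<close>

definition y0 :: "complex \<Rightarrow> complex" where "y0 z = dv x0 z / 2"

lemma y0_analytic: "z \<notin> L \<Longrightarrow> y0 analytic_on {z}"
  unfolding y0_def[abs_def] by (intro analytic_intros dv_analytic x0_analytic) auto

lemma ell_y0: "ell y0"
proof -
  have "ell (dv x0)"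
    using ell_x0 x0_analytic by (intro ell_dv[of x0 0 0]) (simp_all add: ell_def)
  from ell_divide[OF this ell_const[of 2]] show ?thesis by (simp add: y0_def[abs_def])
qed

lemma y0_pole: "((\<lambda>w. w ^ 3 * y0 w) \<longlongrightarrow> - 1) (at 0)"
proof -
  have "((\<lambda>w. w ^ (2 + 1) * dv x0 w) \<longlongrightarrow> - of_nat 2 * 1) (at 0)"
    by (rule dv_tendsto[OF ell_meromorphic[OF ell_x0] x0_pole])
  then have "((\<lambda>w. w ^ 3 * dv x0 w / 2) \<longlongrightarrow> - 2 / 2) (at 0)"
    by (intro tendsto_divide) simp_all
  then show ?thesis by (simp add: y0_def)
qed

lemma y0_odd: "y0 (- z) = - y0 z"
proof (cases "z \<in> L")
  case False
  then have mz: "- z \<notin> L" by simp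
  have "((\<lambda>w. x0 (- w)) has_field_derivative dv x0 (- z) * (- 1)) (at z)"
    by (rule DERIV_chain2[where f = x0 and g = uminus])
       (auto intro!: derivative_eq_intros has_dv[OF x0_analytic[OF mz] mz])
  then have "(x0 has_field_derivative - dv x0 (- z)) (at z)" by (simp add: x0_even)
  with has_dv[OF x0_analytic[OF False] False] have "dv x0 z = - dv x0 (- z)" by (rule DERIV_unique)
  then show ?thesis by (simp add: y0_def)
qed (simp add: y0_def dv_def)

text \<open>Powers of \<open>x0\<close> cancel the pole orders 6, 4 and 2 at 0; orders 5 and 3 do
  not occur because everything is even. What remains has at most a simple pole.\<close>

lemma x0_y0_equation:
  obtains c4 c2 c0 where "\<forall>z. z \<notin> L \<longrightarrow> y0 z ^ 2 = x0 z ^ 3 + c4 * x0 z ^ 2 + c2 * x0 z + c0"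
proof -
  define h1 where "h1 z = y0 z ^ 2 - x0 z ^ 3" for z
  have ell1: "ell h1" unfolding h1_def[abs_def] by (intro ell_diff ell_power ell_x0 ell_y0)
  have even1: "h1 (- z) = h1 z" for z by (simp add: h1_def x0_even y0_odd)
  have "((\<lambda>w. (w ^ 3 * y0 w) ^ 2 - (w ^ 2 * x0 w) ^ 3) \<longlongrightarrow> (- 1) ^ 2 - 1 ^ 3) (at 0)"
    by (intro tendsto_intros x0_pole y0_pole)
  then have "((\<lambda>w. w ^ Suc 5 * h1 w) \<longlongrightarrow> 0) (at 0)"
    by (simp add: h1_def power_mult_distrib right_diff_distrib flip: power_mult)
  then obtain c5 where c5: "((\<lambda>w. w ^ 5 * h1 w) \<longlongrightarrow> c5) (at 0)"
    by (rule meromorphic_lower_pole[OF ell_meromorphic[OF ell1]])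
  have "c5 = 0" using even_pole_odd_order[OF even1 c5] by simp
  then have "((\<lambda>w. w ^ Suc 4 * h1 w) \<longlongrightarrow> 0) (at 0)" using c5 by (simp add: numeral_eq_Suc)
  then obtain c4 where c4: "((\<lambda>w. w ^ 4 * h1 w) \<longlongrightarrow> c4) (at 0)"
    by (rule meromorphic_lower_pole[OF ell_meromorphic[OF ell1]])
  define h2 where "h2 z = h1 z - c4 * x0 z ^ 2" for z
  have ell2: "ell h2" unfolding h2_def[abs_def] by (intro ell_diff ell_mult ell_const ell1 ell_power ell_x0)
  have even2: "h2 (- z) = h2 z" for z by (simp add: h2_def x0_even even1)
  have "((\<lambda>w. w ^ 4 * h1 w - c4 * (w ^ 2 * x0 w) ^ 2) \<longlongrightarrow> c4 - c4 * 1 ^ 2) (at 0)"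
    by (intro tendsto_intros x0_pole c4)
  then have "((\<lambda>w. w ^ Suc 3 * h2 w) \<longlongrightarrow> 0) (at 0)"
    by (simp add: h2_def power_mult_distrib algebra_simps flip: power_mult)
  then obtain c3 where c3: "((\<lambda>w. w ^ 3 * h2 w) \<longlongrightarrow> c3) (at 0)"
    by (rule meromorphic_lower_pole[OF ell_meromorphic[OF ell2]])
  have "c3 = 0" using even_pole_odd_order[OF even2 c3] by simp
  then have "((\<lambda>w. w ^ Suc 2 * h2 w) \<longlongrightarrow> 0) (at 0)" using c3 by (simp add: numeral_eq_Suc)
  then obtain c2 where c2: "((\<lambda>w. w ^ 2 * h2 w) \<longlongrightarrow> c2) (at 0)"
    by (rule meromorphic_lower_pole[OF ell_meromorphic[OF ell2]])
  define h3 where "h3 z = h2 z - c2 * x0 z" for z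
  have ell3: "ell h3" unfolding h3_def[abs_def] by (intro ell_diff ell_mult ell_const ell2 ell_x0)
  have "((\<lambda>w. w ^ 2 * h2 w - c2 * (w ^ 2 * x0 w)) \<longlongrightarrow> c2 - c2 * 1) (at 0)"
    by (intro tendsto_intros x0_pole c2)
  then have "((\<lambda>w. w ^ Suc 1 * h3 w) \<longlongrightarrow> 0) (at 0)"
    by (simp add: h3_def algebra_simps power2_eq_square)
  then obtain c1 where "((\<lambda>w. w ^ 1 * h3 w) \<longlongrightarrow> c1) (at 0)"
    by (rule meromorphic_lower_pole[OF ell_meromorphic[OF ell3]])
  then have c1: "((\<lambda>w. w * h3 w) \<longlongrightarrow> c1) (at 0)" by simp
  have an3: "h3 analytic_on {z}" if "z \<notin> L" for z
    unfolding h3_def h2_def h1_def using that by (intro analytic_intros x0_analytic y0_analytic)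
  obtain c0 where "\<forall>z. z \<notin> L \<longrightarrow> h3 z = c0"
    by (rule ell_constant_off_L[OF ell3 _ c1]) (rule an3)
  then have "\<forall>z. z \<notin> L \<longrightarrow> y0 z ^ 2 = x0 z ^ 3 + c4 * x0 z ^ 2 + c2 * x0 z + c0"
    by (auto simp: h3_def h2_def h1_def algebra_simps)
  then show thesis by (rule that)
qed

end

text \<open>The properties of the Weierstrass functions on which the later arguments rest, detached
  from their construction.\<close>

locale weierstrass = period_lattice +
  fixes X Y :: "complex \<Rightarrow> complex" and a b :: complex
  assumes ell_X: "ell X" and ell_Y: "ell Y"
    and X_an: "z \<notin> L \<Longrightarrow> X analytic_on {z}" and Y_an: "z \<notin> L \<Longrightarrow> Y analytic_on {z}"
    and X_even: "X (- z) = X z" and Y_odd: "Y (- z) = - Y z"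
    and X_pole: "((\<lambda>w. w ^ 2 * X w) \<longlongrightarrow> 1) (at 0)"
    and Y_pole: "((\<lambda>w. w ^ 3 * Y w) \<longlongrightarrow> - 1) (at 0)"
    and X_deriv: "z \<notin> L \<Longrightarrow> (X has_field_derivative 2 * Y z) (at z)"
    and equation: "z \<notin> L \<Longrightarrow> Y z ^ 2 = X z ^ 3 + a * X z + b"

lemma (in period_lattice) weierstrass_exists:
  obtains X Y a b where "weierstrass \<tau> X Y a b"
proof -
  obtain c4 c2 c0 where eq: "\<forall>z. z \<notin> L \<longrightarrow> y0 z ^ 2 = x0 z ^ 3 + c4 * x0 z ^ 2 + c2 * x0 z + c0"
    by (rule x0_y0_equation)
  \<comment> \<open>The shift by \<open>c4 / 3\<close> removes the quadratic term of the cubic;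
    \<open>a\<close> and \<open>b\<close> are the coefficients that result.\<close>
  define X where "X z = x0 z + c4 / 3" for z
  define a where "a = c2 - c4 ^ 2 / 3"
  define b where "b = c0 + 2 * c4 ^ 3 / 27 - c2 * c4 / 3"
  have "weierstrass \<tau> X y0 a b"
  proof (unfold_locales)
    show "ell X" unfolding X_def[abs_def] by (intro ell_add ell_x0 ell_const)
    show "ell y0" by (rule ell_y0)
    show "X analytic_on {z}" if "z \<notin> L" for z
      unfolding X_def using that by (intro analytic_intros x0_analytic)
    show "y0 analytic_on {z}" if "z \<notin> L" for z using that by (rule y0_analytic)
    show "X (- z) = X z" "y0 (- z) = - y0 z" for z by (simp_all add: X_def x0_even y0_odd)
    have "((\<lambda>w. w ^ 2 * x0 w + w ^ 2 * (c4 / 3)) \<longlongrightarrow> 1 + 0 ^ 2 * (c4 / 3)) (at 0)"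
      by (intro tendsto_intros x0_pole)
    then show "((\<lambda>w. w ^ 2 * X w) \<longlongrightarrow> 1) (at 0)" by (simp add: X_def algebra_simps)
    show "((\<lambda>w. w ^ 3 * y0 w) \<longlongrightarrow> - 1) (at 0)" by (rule y0_pole)
    show "(X has_field_derivative 2 * y0 z) (at z)" if "z \<notin> L" for z
      using has_dv[OF x0_analytic[OF that] that] unfolding X_def y0_def
      by (auto intro!: derivative_eq_intros)
    show "y0 z ^ 2 = X z ^ 3 + a * X z + b" if "z \<notin> L" for z
    proof -
      have "x0 z ^ 3 + c4 * x0 z ^ 2 + c2 * x0 z + c0 = X z ^ 3 + a * X z + b"
        unfolding X_def a_def b_def by (simp add: field_simps power3_eq_cube power2_eq_square)
      then show ?thesis using eq that by simp
    qed
  qed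
  then show thesis by (rule that)
qed

section \<open>The Weierstrass parametrization\<close>

lemma tendsto_shift_arg: "(f \<longlongrightarrow> l) (at 0) \<Longrightarrow> ((\<lambda>z. f (z - a)) \<longlongrightarrow> l) (at (a::complex))"
  using LIM_offset[of f l 0 "- a"] by simp

lemma fin_at_transform: "fin_at f z \<Longrightarrow> \<forall>\<^sub>F w in at z. f w = g w \<Longrightarrow> fin_at g z"
  unfolding fin_at_def by (blast intro: Lim_transform_eventually)

lemma fin_at_double_zero:
  assumes "s analytic_on {a}" "s a = 0" "(s has_field_derivative 0) (at a)"
  shows "fin_at (\<lambda>w. s w / (w - a) ^ 2) a"
proof (rule meromorphic_tendsto_zero_fin_at)
  show "(\<lambda>w. s w / (w - a) ^ 2) meromorphic_on {a}"
    using assms(1) by (intro meromorphic_intros analytic_on_imp_meromorphic_on)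
  have "((\<lambda>w. s w / (w - a)) \<longlongrightarrow> 0) (at a)"
    using assms(2,3) by (simp add: has_field_derivative_iff)
  moreover have "(w - a) * (s w / (w - a) ^ 2) = s w / (w - a)" for w
    by (simp add: power2_eq_square)
  ultimately show "((\<lambda>w. (w - a) * (s w / (w - a) ^ 2)) \<longlongrightarrow> 0) (at a)" by simp
qed

lemma analytic_shift_arg:
  assumes "f analytic_on {z - a}"
  shows "(\<lambda>w. f (w - a)) analytic_on {z::complex}"
proof -
  have "(f \<circ> (\<lambda>w. w - a)) analytic_on {z}"
    using assms by (intro analytic_on_compose analytic_intros) simp
  then show ?thesis by (simp add: o_def)
qed

context weierstrass
begin

lemma X_shift_pole: "((\<lambda>w. w ^ 2 * (X w - c)) \<longlongrightarrow> 1) (at 0)"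
proof -
  have "((\<lambda>w. w ^ 2 * X w - w ^ 2 * c) \<longlongrightarrow> 1 - 0 ^ 2 * c) (at 0)"
    by (intro tendsto_intros X_pole)
  then show ?thesis by (simp add: right_diff_distrib)
qed

lemma X_avoid: "\<forall>\<^sub>F w in at z. X w \<noteq> c"
proof -
  have "X meromorphic_on UNIV"
    using ell_meromorphic[OF ell_X] by (subst meromorphic_on_meromorphic_at) blast
  then consider "\<forall>\<^sub>F w in cosparse UNIV. X w = c" | "\<forall>\<^sub>F w in cosparse UNIV. X w \<noteq> c"
    using meromorphic_imp_constant_or_avoid[of X UNIV c] by auto
  then show ?thesis
  proof cases
    case 1
    then have "\<forall>\<^sub>F w in at 0. X w = c" by (rule eventually_cosparse_imp_eventually_at) simp
    then have "\<forall>\<^sub>F w in at 0. w ^ 2 * (X w - c) = 0" by eventually_elim simp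
    then have "((\<lambda>w. w ^ 2 * (X w - c)) \<longlongrightarrow> 0) (at 0)" by (rule tendsto_eventually)
    then have "(0::complex) = 1" using X_shift_pole[of c] by (rule tendsto_unique[rotated]) simp
    then show ?thesis by simp
  next
    case 2
    then show ?thesis by (rule eventually_cosparse_imp_eventually_at) simp
  qed
qed

text \<open>If \<open>Y z1 = 0\<close>, then in \<open>(X z - X z1) (X (z - z1) - X z1)\<close> every pole is cancelled by a double zero.\<close>

lemma Y_zero_fibre:
  assumes z1: "z1 \<notin> L" "Y z1 = 0" and z2: "z2 \<notin> L" "X z2 = X z1"
  shows "z2 - z1 \<in> L"
proof (rule ccontr)
  assume z21: "z2 - z1 \<notin> L"
  define K where "K z = (X z - X z1) * (X (z - z1) - X z1)" for z
  have K: "ell K"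
    unfolding K_def[abs_def] by (intro ell_mult ell_diff ell_X ell_const ell_shift)
  have K_an: "K analytic_on {z}" if "z \<notin> L" "z - z1 \<notin> L" for z
    unfolding K_def using that by (intro analytic_intros X_an analytic_shift_arg)
  have zero: "(\<lambda>w. X w - X z1) analytic_on {z1}" "((\<lambda>w. X w - X z1) has_field_derivative 0) (at z1)"
    using X_an[OF z1(1)] X_deriv[OF z1(1)] z1(2) by (auto intro!: analytic_intros derivative_eq_intros)
  have K0: "fin_at K 0"
  proof -
    define s where "s w = X (w - z1) - X z1" for w
    have m: "- z1 \<notin> L" using z1 by simp
    have "s analytic_on {0}"
      unfolding s_def using X_an[OF m] by (intro analytic_intros analytic_shift_arg) simp
    moreover have "s 0 = 0" by (simp add: s_def X_even)
    moreover have "((\<lambda>w. X (w + - z1)) has_field_derivative 0) (at 0)"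
      using X_deriv[OF m] z1(2) by (subst DERIV_shift[symmetric]) (simp add: Y_odd)
    then have "(s has_field_derivative 0) (at 0)"
      unfolding s_def by (auto intro!: derivative_eq_intros)
    ultimately have "fin_at (\<lambda>w. s w / (w - 0) ^ 2) 0" by (rule fin_at_double_zero)
    moreover have "fin_at (\<lambda>w. w ^ 2 * (X w - X z1)) 0" using X_shift_pole by (auto simp: fin_at_def)
    ultimately have "fin_at (\<lambda>w. w ^ 2 * (X w - X z1) * (s w / (w - 0) ^ 2)) 0"
      by (rule fin_at_mult[rotated])
    moreover have "\<forall>\<^sub>F w in at 0. w ^ 2 * (X w - X z1) * (s w / (w - 0) ^ 2) = K w"
      unfolding eventually_at_filter by (auto simp: K_def s_def)
    ultimately show ?thesis by (rule fin_at_transform)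
  qed
  have K1: "fin_at K z1"
  proof -
    have "fin_at (\<lambda>w. (X w - X z1) / (w - z1) ^ 2) z1" using zero by (intro fin_at_double_zero) auto
    moreover have "fin_at (\<lambda>w. (w - z1) ^ 2 * (X (w - z1) - X z1)) z1"
      using tendsto_shift_arg[OF X_shift_pole] by (auto simp: fin_at_def)
    ultimately have "fin_at (\<lambda>w. (X w - X z1) / (w - z1) ^ 2 * ((w - z1) ^ 2 * (X (w - z1) - X z1))) z1"
      by (rule fin_at_mult)
    moreover have "\<forall>\<^sub>F w in at z1. (X w - X z1) / (w - z1) ^ 2 * ((w - z1) ^ 2 * (X (w - z1) - X z1)) = K w"
      unfolding eventually_at_filter by (auto simp: K_def)
    ultimately show ?thesis by (rule fin_at_transform)
  qed
  have "fin_at K z" for z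
  proof -
    consider "z \<in> L" | "z - z1 \<in> L" | "z \<notin> L" "z - z1 \<notin> L" by blast
    then show ?thesis
    proof cases
      case 1
      from ell_fin_at_shift[OF K this K0] show ?thesis by simp
    next
      case 2
      from ell_fin_at_shift[OF K this K1] show ?thesis by simp
    qed (auto intro: fin_at_analytic K_an)
  qed
  then obtain C where C: "\<forall>z. \<forall>\<^sub>F w in at z. K w = C" by (rule ell_no_poles[OF K])
  \<comment> \<open>\<open>K\<close> vanishes at \<open>z2\<close>, so the constant is 0, although
    both factors are nonzero on a punctured neighbourhood of 0.\<close>
  have "K z2 = C" using analytic_eq_eventual_constant[OF K_an[OF z2(1) z21]] C by blast
  then have "C = 0" using z2(2) by (simp add: K_def)
  have "filterlim (\<lambda>w. w - z1) (at (- z1)) (at 0)"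
    unfolding filterlim_at by (auto intro!: tendsto_eq_intros simp: eventually_at_filter)
  with X_avoid have "\<forall>\<^sub>F w in at 0. X (w - z1) \<noteq> X z1" by (rule eventually_compose_filterlim)
  moreover have "\<forall>\<^sub>F w in at 0. K w = 0" using C \<open>C = 0\<close> by blast
  ultimately have "\<forall>\<^sub>F w in at (0::complex). False"
    using X_avoid[of "X z1" 0] by eventually_elim (simp add: K_def)
  then show False by simp
qed

text \<open>Evenness of \<open>X\<close> puts \<open>- z\<close> into the fibre of \<open>z\<close>,
  which consists of a single class here.\<close>

lemma Y_zero_half_period:
  assumes "z \<notin> L" "Y z = 0"
  shows "z + z \<in> L"
  using Y_zero_fibre[OF assms, of "- z"] assms(1) L_minus_iff[of "z + z"] by (simp add: X_even)

text \<open>The principal parts of \<open>zt z\<close> and \<open>zt (- z)\<close> cancel, and so do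
  the additive periods.\<close>

lemma zt_reflection:
  obtains c where "\<forall>z. z \<notin> L \<longrightarrow> zt (- z) = c - zt z"
proof -
  define S where "S z = zt z + zt (- z)" for z
  have m: "zt (- z - 1) = zt (- z)" "zt (- z - \<tau>) = zt (- z) + 2 * pi * \<i>" for z
    using zt_1[of "- z - 1"] zt_tau[of "- z - \<tau>"] by simp_all
  have "(\<lambda>z. zt (- z)) meromorphic_on {z}" for z
    by (rule meromorphic_on_compose[OF zt_meromorphic[of "- z"], of uminus]) (auto intro!: analytic_intros)
  then have "S meromorphic_on {z}" for z
    unfolding S_def[abs_def] by (intro meromorphic_on_add zt_meromorphic)
  then have S: "ell S" using m by (simp add: ell_def S_def zt_1 zt_tau)
  have an: "S analytic_on {z}" if "z \<notin> L" for z
    unfolding S_def using that by (intro analytic_intros analytic_uminus_arg zt_analytic) simp_all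
  have "((\<lambda>w. (- w) * zt (- w)) \<longlongrightarrow> 1) (at 0)"
    using zt_pole filterlim_uminus_at_0 by (rule filterlim_compose)
  from tendsto_diff[OF zt_pole this] have lim: "((\<lambda>w. w * S w) \<longlongrightarrow> 0) (at 0)"
    by (simp add: S_def distrib_left)
  obtain c where "\<forall>z. z \<notin> L \<longrightarrow> S z = c"
    by (rule ell_constant_off_L[OF S _ lim]) (rule an)
  then show thesis by (intro that[of c]) (auto simp: S_def algebra_simps)
qed

text \<open>Otherwise a combination of \<open>zt (z - z1)\<close> and \<open>zt (z + z1)\<close> is the inverse of \<open>X z - X z1\<close>.\<close>

lemma X_fibre:
  assumes z1: "z1 \<notin> L" and z2: "z2 \<notin> L" "X z2 = X z1"
  shows "z2 - z1 \<in> L \<or> z2 + z1 \<in> L"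
proof (rule ccontr)
  assume "\<not> (z2 - z1 \<in> L \<or> z2 + z1 \<in> L)"
  then have z21: "z2 - z1 \<notin> L" "z2 + z1 \<notin> L" by auto
  have y1: "Y z1 \<noteq> 0" using Y_zero_fibre[OF z1 _ z2] z21(1) by blast
  have z11: "z1 + z1 \<notin> L"
  proof
    assume *: "z1 + z1 \<in> L"
    have "Y z1 = Y (- z1 + (z1 + z1))" by simp
    also have "\<dots> = - Y z1" by (simp only: ell_periodic[OF ell_Y *] Y_odd)
    finally show False using y1 by simp
  qed
  \<comment> \<open>Elliptic, with simple poles of residues 1 and -1 at \<open>z1\<close> and
    \<open>- z1\<close>.\<close>
  define G0 where "G0 z = zt (z - z1) - zt (z - - z1)" for z
  have G0_per: "G0 (z + 1) = G0 z" "G0 (z + \<tau>) = G0 z" for z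
  proof -
    have "z + s - c = z - c + s" for s c by simp
    then show "G0 (z + 1) = G0 z" "G0 (z + \<tau>) = G0 z" by (simp_all only: G0_def zt_1 zt_tau) simp
  qed
  have "G0 meromorphic_on {z}" for z
  proof -
    have "(\<lambda>z. zt (z - c)) meromorphic_on {z}" for c
      by (rule meromorphic_on_compose[OF zt_meromorphic[of "z - c"], of "\<lambda>z. z - c"]) (auto intro!: analytic_intros)
    then show ?thesis unfolding G0_def[abs_def] by (intro meromorphic_on_diff)
  qed
  then have G0: "ell G0" using G0_per by (simp add: ell_def)
  have G0_an: "G0 analytic_on {z}" if "z - z1 \<notin> L" "z + z1 \<notin> L" for z
    unfolding G0_def using that by (intro analytic_intros analytic_shift_arg zt_analytic) simp_all
  \<comment> \<open>The residue of \<open>1 / (X z - X z1)\<close> at \<open>z1\<close>. The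
    constant subtracted in \<open>G\<close> makes \<open>G\<close> vanish at 0.\<close>
  define r where "r = 1 / (2 * Y z1)"
  define G where "G z = r * (G0 z - G0 0)" for z
  have G: "ell G" unfolding G_def[abs_def] by (intro ell_mult ell_diff G0 ell_const)
  have G_an: "G analytic_on {z}" if "z - z1 \<notin> L" "z + z1 \<notin> L" for z
    unfolding G_def using that by (intro analytic_intros G0_an)
  obtain c0 where c0: "\<forall>z. z \<notin> L \<longrightarrow> zt (- z) = c0 - zt z" by (rule zt_reflection)
  have G_even: "G (- z) = G z" if "z - z1 \<notin> L" "z + z1 \<notin> L" for z
  proof -
    have "zt (- z - z1) = c0 - zt (z + z1)" using c0 that(2) by (metis minus_add_distrib uminus_add_conv_diff add.commute)
    moreover have "zt (- z + z1) = c0 - zt (z - z1)" using c0 that(1) by (metis minus_diff_eq add.commute diff_conv_add_uminus)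
    ultimately show ?thesis by (simp add: G_def G0_def)
  qed
  \<comment> \<open>\<open>G\<close> is even by the reflection rule and vanishes at 0, so its zero
    is double and cancels the pole of \<open>X\<close>.\<close>
  have G_zero: "fin_at (\<lambda>w. G w / (w - 0) ^ 2) 0"
  proof (rule fin_at_double_zero)
    have 0: "0 - z1 \<notin> L" "0 + z1 \<notin> L" using z1 by simp_all
    show an: "G analytic_on {0}" using G_an[OF 0] .
    show "G 0 = 0" by (simp add: G_def)
    have der: "(G has_field_derivative deriv G 0) (at 0)"
      using analytic_on_imp_differentiable_at[OF an] by (simp add: DERIV_deriv_iff_field_differentiable)
    have "((\<lambda>w. G (- w)) has_field_derivative deriv G 0 * (- 1)) (at 0)"
      by (rule DERIV_chain2[where f = G and g = uminus]) (use der in \<open>auto intro!: derivative_eq_intros\<close>)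
    moreover have "\<forall>\<^sub>F w in nhds 0. G (- w) = G w"
    proof -
      have lim: "((\<lambda>w. w - z1) \<longlongrightarrow> 0 - z1) (nhds 0)" "((\<lambda>w. w + z1) \<longlongrightarrow> 0 + z1) (nhds 0)"
        by (intro tendsto_intros filterlim_ident)+
      have "\<forall>\<^sub>F w in nhds 0. w - z1 \<notin> L"
        using eventually_nhds_not_L[OF 0(1)] lim(1) by (rule eventually_compose_filterlim)
      moreover have "\<forall>\<^sub>F w in nhds 0. w + z1 \<notin> L"
        using eventually_nhds_not_L[OF 0(2)] lim(2) by (rule eventually_compose_filterlim)
      ultimately show ?thesis by eventually_elim (rule G_even)
    qed
    ultimately have "(G has_field_derivative - deriv G 0) (at 0)"
      by (subst (asm) DERIV_cong_ev[OF refl _ refl]) simp_all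
    with der have "deriv G 0 = - deriv G 0" by (rule DERIV_unique)
    then show "(G has_field_derivative 0) (at 0)" using der by simp
  qed
  define K where "K z = (X z - X z1) * G z" for z
  have K: "ell K" unfolding K_def[abs_def] by (intro ell_mult ell_diff ell_X ell_const G)
  have K_an: "K analytic_on {z}" if "z \<notin> L" "z - z1 \<notin> L" "z + z1 \<notin> L" for z
    unfolding K_def using that by (intro analytic_intros X_an G_an)
  have K0: "fin_at K 0"
  proof -
    have "fin_at (\<lambda>w. w ^ 2 * (X w - X z1)) 0" using X_shift_pole by (auto simp: fin_at_def)
    from fin_at_mult[OF this G_zero]
    have "fin_at (\<lambda>w. w ^ 2 * (X w - X z1) * (G w / (w - 0) ^ 2)) 0" .
    moreover have "\<forall>\<^sub>F w in at 0. w ^ 2 * (X w - X z1) * (G w / (w - 0) ^ 2) = K w"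
      unfolding eventually_at_filter by (auto simp: K_def)
    ultimately show ?thesis by (rule fin_at_transform)
  qed
  have simple: "(K \<longlongrightarrow> 2 * Y c * (r * \<epsilon>)) (at c)"
    if c: "c \<notin> L" "X c = X z1" and e: "((\<lambda>w. (w - c) * G0 w) \<longlongrightarrow> \<epsilon>) (at c)" for c \<epsilon>
  proof -
    have "((\<lambda>w. (X w - X c) / (w - c)) \<longlongrightarrow> 2 * Y c) (at c)"
      using X_deriv[OF c(1)] by (simp add: has_field_derivative_iff)
    moreover have "((\<lambda>w. r * ((w - c) * G0 w - (w - c) * G0 0)) \<longlongrightarrow> r * (\<epsilon> - (c - c) * G0 0)) (at c)"
      by (intro tendsto_intros e)
    ultimately have "((\<lambda>w. (X w - X c) / (w - c) * (r * ((w - c) * G0 w - (w - c) * G0 0))) \<longlongrightarrow>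
        2 * Y c * (r * (\<epsilon> - (c - c) * G0 0))) (at c)" by (rule tendsto_mult)
    moreover have "\<forall>\<^sub>F w in at c. (X w - X c) / (w - c) * (r * ((w - c) * G0 w - (w - c) * G0 0)) = K w"
    proof -
      have "\<forall>\<^sub>F w in at c. w \<noteq> c" by (simp add: eventually_at_filter)
      then show ?thesis
      proof eventually_elim
        case (elim w)
        have "(w - c) * G0 w - (w - c) * G0 0 = (w - c) * (G0 w - G0 0)" by (rule right_diff_distrib[symmetric])
        then show ?case using elim by (simp add: K_def G_def c(2))
      qed
    qed
    ultimately have "(K \<longlongrightarrow> 2 * Y c * (r * (\<epsilon> - (c - c) * G0 0))) (at c)" by (rule Lim_transform_eventually)
    then show ?thesis by simp
  qed
  have zt_lim: "((\<lambda>w. (w - c) * zt (w - c)) \<longlongrightarrow> 1) (at c)" for c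
    by (rule tendsto_shift_arg[OF zt_pole])
  have zt_reg: "((\<lambda>w. (w - c) * zt (w - c')) \<longlongrightarrow> 0) (at c)" if "c - c' \<notin> L" for c c'
  proof -
    have "((\<lambda>w. (w - c) * zt (w - c')) \<longlongrightarrow> (c - c) * zt (c - c')) (at c)"
      using isContD[OF analytic_at_imp_isCont[OF analytic_shift_arg[OF zt_analytic[OF that]]]]
      by (intro tendsto_intros)
    then show ?thesis by simp
  qed
  have "((\<lambda>w. (w - z1) * zt (w - z1) - (w - z1) * zt (w - - z1)) \<longlongrightarrow> 1 - 0) (at z1)"
    using z11 by (intro tendsto_diff zt_lim zt_reg) simp
  then have "((\<lambda>w. (w - z1) * G0 w) \<longlongrightarrow> 1) (at z1)" by (simp add: G0_def right_diff_distrib)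
  from simple[OF z1 refl this] have K1: "(K \<longlongrightarrow> 1) (at z1)" using y1 by (simp add: r_def)
  have "((\<lambda>w. (w - - z1) * zt (w - z1) - (w - - z1) * zt (w - - z1)) \<longlongrightarrow> 0 - 1) (at (- z1))"
  proof (intro tendsto_diff zt_lim zt_reg)
    have "- z1 - z1 = - (z1 + z1)" by simp
    then show "- z1 - z1 \<notin> L" using z11 L_minus_iff by metis
  qed
  then have "((\<lambda>w. (w - - z1) * G0 w) \<longlongrightarrow> - 1) (at (- z1))" by (simp add: G0_def right_diff_distrib)
  then have K2: "fin_at K (- z1)" using simple[of "- z1"] z1 by (auto simp: fin_at_def X_even)
  have "fin_at K z" for z
  proof -
    consider "z \<in> L" | "z - z1 \<in> L" | "z + z1 \<in> L" | "z \<notin> L" "z - z1 \<notin> L" "z + z1 \<notin> L" by blast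
    then show ?thesis
    proof cases
      case 1
      from ell_fin_at_shift[OF K this K0] show ?thesis by simp
    next
      case 2
      have "fin_at K z1" using K1 by (auto simp: fin_at_def)
      from ell_fin_at_shift[OF K 2 this] show ?thesis by simp
    next
      case 3
      from ell_fin_at_shift[OF K this K2] show ?thesis by simp
    qed (auto intro: fin_at_analytic K_an)
  qed
  \<comment> \<open>The constant is 1 by the limit at \<open>z1\<close>, but \<open>K\<close>
    vanishes at \<open>z2\<close>.\<close>
  then obtain C where C: "\<forall>z. \<forall>\<^sub>F w in at z. K w = C" by (rule ell_no_poles[OF K])
  then have "(K \<longlongrightarrow> C) (at z1)" by (blast intro: tendsto_eventually)
  then have "C = 1" using K1 by (rule tendsto_unique[rotated]) simp
  moreover have "K z2 = C" using analytic_eq_eventual_constant[OF K_an[OF z2(1) z21]] C by blast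
  ultimately show False using z2(2) by (simp add: K_def)
qed

text \<open>If the classes differ, \<open>X_fibre\<close> leaves \<open>z = - w\<close> modulo
  \<open>L\<close>; then \<open>Y w = - Y w\<close>, so \<open>w\<close> is a half period and the
  classes agree after all.\<close>

lemma XY_injective:
  assumes "z \<notin> L" "w \<notin> L" "X z = X w" "Y z = Y w"
  shows "z - w \<in> L"
proof (rule ccontr)
  assume *: "z - w \<notin> L"
  then have zw: "z + w \<in> L" using X_fibre[OF assms(2,1,3)] by blast
  have "Y z = Y (- w + (z + w))" by simp
  also have "\<dots> = - Y w" by (simp only: ell_periodic[OF ell_Y zw] Y_odd)
  finally have "Y w = 0" using assms(4) by simp
  then have "w + w \<in> L" by (rule Y_zero_half_period[OF assms(2)])
  then have "z + w - (w + w) \<in> L" by (rule L_diff[OF zw])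
  with * show False by (simp add: algebra_simps)
qed

text \<open>Otherwise \<open>1 / (X z - c)\<close> is elliptic without poles, hence constant; its
  limit at 0 is 0, but it takes nonzero values.\<close>

lemma X_surj: "\<exists>z. z \<notin> L \<and> X z = c"
proof (rule ccontr)
  assume *: "\<not> (\<exists>z. z \<notin> L \<and> X z = c)"
  define h where "h z = 1 / (X z - c)" for z
  have h: "ell h" unfolding h_def[abs_def] by (intro ell_divide ell_diff ell_X ell_const)
  have "((\<lambda>w. w ^ 2 / (w ^ 2 * (X w - c))) \<longlongrightarrow> 0 ^ 2 / 1) (at 0)"
    by (intro tendsto_divide tendsto_intros X_shift_pole) simp
  moreover have "\<forall>\<^sub>F w in at 0. w ^ 2 / (w ^ 2 * (X w - c)) = h w"
    unfolding eventually_at_filter by (auto simp: h_def)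
  ultimately have lim: "(h \<longlongrightarrow> 0 ^ 2 / 1) (at 0)" by (rule Lim_transform_eventually)
  have "fin_at h z" for z
  proof (cases "z \<in> L")
    case True
    have "fin_at h 0" using lim by (auto simp: fin_at_def)
    from ell_fin_at_shift[OF h True this] show ?thesis by simp
  next
    case False
    then show ?thesis unfolding h_def using * by (intro fin_at_analytic analytic_intros X_an) auto
  qed
  then obtain C where C: "\<forall>z. \<forall>\<^sub>F w in at z. h w = C" by (rule ell_no_poles[OF h])
  then have "(h \<longlongrightarrow> C) (at 0)" by (blast intro: tendsto_eventually)
  then have "C = 0 ^ 2 / 1" using lim by (rule tendsto_unique[rotated]) simp
  with C have "\<forall>\<^sub>F w in at 0. h w = 0" by simp
  with X_avoid[of c 0] have "\<forall>\<^sub>F w in at (0::complex). False" by eventually_elim (simp add: h_def)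
  then show False by simp
qed

text \<open>\<open>Y\<close> vanishes at the three half periods, so their \<open>X\<close> values
  are roots of the cubic; they are distinct because the fibre of \<open>X\<close> over each is a
  single class.\<close>

lemma discriminant: "4 * a ^ 3 + 27 * b ^ 2 \<noteq> 0"
proof -
  have Y0: "Y h = 0" if "h + h \<in> L" for h
  proof -
    have "Y h = Y (- h + (h + h))" by simp
    also have "\<dots> = - Y h" by (simp only: ell_periodic[OF ell_Y that] Y_odd)
    finally show ?thesis by simp
  qed
  define e1 where "e1 = X (1 / 2)"
  define e2 where "e2 = X (\<tau> / 2)"
  define e3 where "e3 = X ((1 + \<tau>) / 2)"
  have per: "1 / 2 + 1 / 2 \<in> L" "\<tau> / 2 + \<tau> / 2 \<in> L" "(1 + \<tau>) / 2 + (1 + \<tau>) / 2 \<in> L"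
  proof -
    have half: "z / 2 + z / 2 = z" for z :: complex by (simp add: field_simps)
    show "1 / 2 + 1 / 2 \<in> L" "\<tau> / 2 + \<tau> / 2 \<in> L" "(1 + \<tau>) / 2 + (1 + \<tau>) / 2 \<in> L"
      unfolding half by (rule L_1 L_tau L_add[OF L_1 L_tau])+
  qed
  have root: "e1 ^ 3 + a * e1 + b = 0" "e2 ^ 3 + a * e2 + b = 0" "e3 ^ 3 + a * e3 + b = 0"
    using equation[OF L_half(1)] equation[OF L_half(2)] equation[OF L_half(3)]
      Y0[OF per(1)] Y0[OF per(2)] Y0[OF per(3)] by (simp_all add: e1_def e2_def e3_def)
  have "e2 \<noteq> e1"
  proof
    assume "e2 = e1"
    then have "\<tau> / 2 - 1 / 2 \<in> L"
      using Y_zero_fibre[OF L_half(1) Y0[OF per(1)] L_half(2)] by (simp add: e1_def e2_def)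
    from L_add[OF this L_1] show False using L_half(3) by (simp add: field_simps)
  qed
  moreover have "e3 \<noteq> e1"
  proof
    assume "e3 = e1"
    then have "(1 + \<tau>) / 2 - 1 / 2 \<in> L"
      using Y_zero_fibre[OF L_half(1) Y0[OF per(1)] L_half(3)] by (simp add: e1_def e3_def)
    then show False using L_half(2) by (simp add: field_simps)
  qed
  moreover have "e3 \<noteq> e2"
  proof
    assume "e3 = e2"
    then have "(1 + \<tau>) / 2 - \<tau> / 2 \<in> L"
      using Y_zero_fibre[OF L_half(2) Y0[OF per(2)] L_half(3)] by (simp add: e2_def e3_def)
    then show False using L_half(1) by (simp add: field_simps)
  qed
  moreover have "(e1 - e2) * (e1 ^ 2 + e1 * e2 + e2 ^ 2 + a) = 0" "(e1 - e3) * (e1 ^ 2 + e1 * e3 + e3 ^ 2 + a) = 0"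
    using root by algebra+
  ultimately have q: "e1 ^ 2 + e1 * e2 + e2 ^ 2 + a = 0" "e1 ^ 2 + e1 * e3 + e3 ^ 2 + a = 0" by auto
  then have "(e2 - e3) * (e1 + e2 + e3) = 0" by algebra
  then have "e1 + e2 + e3 = 0" unfolding mult_eq_0_iff using \<open>e3 \<noteq> e2\<close> by auto
  then have e: "e3 = - e1 - e2" by algebra
  have "a = - (e1 ^ 2 + e1 * e2 + e2 ^ 2)" using q(1) by algebra
  moreover have "b = e1 * e2 * (e1 + e2)" using root(1) q(1) by algebra
  \<comment> \<open>The roots have sum 0, and the expression is minus the square of the product of
    their differences.\<close>
  ultimately have "4 * a ^ 3 + 27 * b ^ 2 = - (((e1 - e2) * (e1 - e3) * (e2 - e3)) ^ 2)"
    unfolding e by algebra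
  then show ?thesis using \<open>e2 \<noteq> e1\<close> \<open>e3 \<noteq> e1\<close> \<open>e3 \<noteq> e2\<close> by simp
qed

end

section \<open>Elliptic functions as forms on the Weierstrass curve\<close>

lemma hom_poly_monomial3:
  assumes "i + j + k = d"
  shows "hom_poly d (\<lambda>v :: complex ^ 3. c * (v $ 1) ^ i * (v $ 2) ^ j * (v $ 3) ^ k)"
proof -
  define \<alpha> where "\<alpha> n = (if n = 1 then i else if n = 2 then j else k)" for n :: 3
  have "(\<Sum>n\<in>UNIV. \<alpha> n) = d" using assms by (simp add: \<alpha>_def sum_3)
  moreover have "(\<Prod>n\<in>UNIV. (v $ n) ^ \<alpha> n) = (v $ 1) ^ i * (v $ 2) ^ j * (v $ 3) ^ k" for v :: "complex ^ 3"
    unfolding UNIV_3 by (simp add: \<alpha>_def)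
  ultimately show ?thesis using hom_poly_monomial[of \<alpha> d c] by (simp only: mult.assoc)
qed

lemma vector3_nonzero [simp]: "(vector [p, q, 1] :: complex ^ 3) \<noteq> 0"
  by (auto simp: vec_eq_iff forall_3)

context weierstrass
begin

text \<open>A form of degree \<open>D\<close> restricted to the curve and dehomogenized by the third
  coordinate; only punctured neighbourhoods count, so values at poles are ignored.\<close>

definition form :: "nat \<Rightarrow> (complex \<Rightarrow> complex) \<Rightarrow> bool" where
  "form D h \<longleftrightarrow> (\<exists>G :: complex ^ 3 \<Rightarrow> complex. hom_poly D G \<and>
     (\<forall>z. \<forall>\<^sub>F w in at z. h w = G (vector [X w, Y w, 1])))"

lemma form_const:
  assumes "\<forall>z. \<forall>\<^sub>F w in at z. h w = C"
  shows "form D h"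
proof -
  have "hom_poly D (\<lambda>v :: complex ^ 3. C * (v $ 1) ^ 0 * (v $ 2) ^ 0 * (v $ 3) ^ D)"
    by (rule hom_poly_monomial3) simp
  then show ?thesis unfolding form_def using assms
    by (intro exI[of _ "\<lambda>v :: complex ^ 3. C * (v $ 3) ^ D"]) simp
qed

lemma form_add_monomial:
  assumes "form D (\<lambda>w. h w - C * X w ^ i * Y w ^ j)" "i + j \<le> D"
  shows "form D h"
proof -
  obtain G :: "complex ^ 3 \<Rightarrow> complex" where G: "hom_poly D G" "\<forall>z. \<forall>\<^sub>F w in at z. h w - C * X w ^ i * Y w ^ j = G (vector [X w, Y w, 1])"
    using assms(1) unfolding form_def by blast
  have "hom_poly D (\<lambda>v :: complex ^ 3. G v + C * (v $ 1) ^ i * (v $ 2) ^ j * (v $ 3) ^ (D - i - j))"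
    using assms(2) by (intro hom_poly_add G(1) hom_poly_monomial3) simp
  moreover have "\<forall>\<^sub>F w in at z. h w = G (vector [X w, Y w, 1]) + C * X w ^ i * Y w ^ j" for z
    using G(2)[rule_format, of z] by eventually_elim (simp add: algebra_simps)
  ultimately show ?thesis unfolding form_def
    by (intro exI[of _ "\<lambda>v :: complex ^ 3. G v + C * (v $ 1) ^ i * (v $ 2) ^ j * (v $ 3) ^ (D - i - j)"]) simp
qed

text \<open>Every pole order other than 1 at the lattice points is attained by a monomial
  \<open>X\<^sup>i Y\<^sup>j\<close> with \<open>i \<le> 2\<close>, and for order at most \<open>3 D\<close> this monomial has degree at most \<open>D\<close>.\<close>

lemma form_of_pole_order:
  assumes "ell h" "\<And>z. z \<notin> L \<Longrightarrow> fin_at h z" "((\<lambda>w. w ^ n * h w) \<longlongrightarrow> c) (at 0)" "n \<le> 3 * D"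
  shows "form D h"
  using assms
proof (induction n arbitrary: h c)
  case 0
  have "fin_at h 0" using "0.prems"(3) by (auto simp: fin_at_def)
  then have "fin_at h z" for z
    using "0.prems"(2)[of z] ell_fin_at_shift[OF "0.prems"(1), of z 0] by (cases "z \<in> L") auto
  then obtain C where "\<forall>z. \<forall>\<^sub>F w in at z. h w = C" by (rule ell_no_poles[OF "0.prems"(1)])
  then show ?case by (rule form_const)
next
  case (Suc m)
  show ?case
  proof (cases "m = 0")
    case True
    then have "((\<lambda>w. w * h w) \<longlongrightarrow> c) (at 0)" using Suc.prems(3) by simp
    then obtain C where "\<forall>z. \<forall>\<^sub>F w in at z. h w = C"
      using ell_no_simple_pole[OF Suc.prems(1,2)] by blast
    then show ?thesis by (rule form_const)
  next
    case False
    \<comment> \<open>The order modulo 3 dictates \<open>i\<close>; order 1 is excluded by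
      \<open>m \<noteq> 0\<close>. For \<open>i = 2\<close> the order is at most
      \<open>3 * D - 2\<close>, which gives the bound on \<open>i + j\<close>.\<close>
    obtain i j where ij: "Suc m = 2 * i + 3 * j" "i + j \<le> D"
    proof -
      consider "Suc m mod 3 = 0" | "Suc m mod 3 = 1" | "Suc m mod 3 = 2" by linarith
      then show thesis
      proof cases
        case 1
        then have "Suc m = 2 * 0 + 3 * (Suc m div 3)" by presburger
        then show thesis using that[of 0 "Suc m div 3"] Suc.prems(4) by linarith
      next
        case 2
        then have "Suc m = 2 * 2 + 3 * ((Suc m - 4) div 3)" using False by presburger
        then show thesis using that[of 2 "(Suc m - 4) div 3"] Suc.prems(4) by linarith
      next
        case 3
        then have "Suc m = 2 * 1 + 3 * ((Suc m - 2) div 3)" using False by presburger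
        then show thesis using that[of 1 "(Suc m - 2) div 3"] Suc.prems(4) by linarith
      qed
    qed
    \<comment> \<open>\<open>Y\<close> has leading coefficient -1, so that of
      \<open>X ^ i * Y ^ j\<close> is \<open>(- 1) ^ j\<close>; multiplied by \<open>C\<close> it
      becomes \<open>c\<close>.\<close>
    define C where "C = c * (- 1) ^ j"
    define h' where "h' w = h w - C * X w ^ i * Y w ^ j" for w
    have ell': "ell h'" unfolding h'_def[abs_def]
      by (intro ell_diff ell_mult ell_power ell_const ell_X ell_Y Suc.prems(1))
    have fin': "fin_at h' z" if "z \<notin> L" for z
      unfolding h'_def
      by (rule fin_at_diff[OF Suc.prems(2)[OF that] fin_at_analytic]) (intro analytic_intros X_an Y_an that)
    have "((\<lambda>w. w ^ Suc m * h w - C * (w ^ 2 * X w) ^ i * (w ^ 3 * Y w) ^ j) \<longlongrightarrow>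
        c - C * 1 ^ i * (- 1) ^ j) (at 0)"
      by (intro tendsto_intros Suc.prems(3) X_pole Y_pole)
    moreover have "C * (- 1) ^ j = c" by (simp add: C_def mult.assoc flip: power_mult_distrib)
    moreover have "C * (w ^ 2 * X w) ^ i * (w ^ 3 * Y w) ^ j = w ^ Suc m * (C * X w ^ i * Y w ^ j)" for w
      unfolding ij(1) by (simp add: power_mult_distrib power_add power_mult)
    ultimately have "((\<lambda>w. w ^ Suc m * h' w) \<longlongrightarrow> 0) (at 0)"
      by (simp add: h'_def right_diff_distrib)
    then obtain c' where "((\<lambda>w. w ^ m * h' w) \<longlongrightarrow> c') (at 0)"
      by (rule meromorphic_lower_pole[OF ell_meromorphic[OF ell']])
    then have "form D h'" using Suc.prems(4) by (intro Suc.IH[OF ell' fin']) auto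
    then show ?thesis using ij(2) unfolding h'_def by (rule form_add_monomial)
  qed
qed

definition P :: "complex \<Rightarrow> 3 cproj" where
  "P z = (if z \<in> L then pt (vector [0, 1, 0]) else pt (vector [X z, Y z, 1]))"

lemma P_periodic: "t \<in> L \<Longrightarrow> P (z + t) = P z"
  by (simp add: P_def L_add_iff ell_periodic[OF ell_X] ell_periodic[OF ell_Y])

lemma P_eq_iff: "P z = P w \<longleftrightarrow> z - w \<in> L"
proof
  assume "z - w \<in> L"
  from P_periodic[OF this, of w] show "P z = P w" by simp
next
  assume *: "P z = P w"
  have nz: "(vector [0, 1, 0] :: complex ^ 3) \<noteq> 0" by (auto simp: vec_eq_iff forall_3)
  show "z - w \<in> L"
  proof (cases "z \<in> L"; cases "w \<in> L")
    assume "z \<notin> L" "w \<notin> L"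
    with * have "X z = X w \<and> Y z = Y w" by (auto simp: P_def pt_eq_iff vec_eq_iff forall_3)
    then show ?thesis using XY_injective \<open>z \<notin> L\<close> \<open>w \<notin> L\<close> by blast
  qed (use * nz in \<open>auto simp: P_def pt_eq_iff vec_eq_iff forall_3 intro: L_diff\<close>)
qed

text \<open>At 0 the lift \<open>[X w, Y w, 1]\<close> is multiplied by \<open>w ^ 3\<close>, which
  removes the poles and leaves the nonzero vector \<open>[0, - 1, 0]\<close>; other lattice points
  follow by periodicity.\<close>

lemma hol_at_P: "hol_at P z"
proof (cases "z \<in> L")
  case False
  have "vec_analytic_at (\<lambda>w. vector [X w, Y w, 1] :: complex ^ 3) z"
    using X_an[OF False] Y_an[OF False] by (simp add: vec_analytic_at_def forall_3)
  then have "hol_at (\<lambda>w. pt (vector [X w, Y w, 1] :: complex ^ 3)) z" by (rule hol_at_pt) simp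
  moreover have "\<forall>\<^sub>F w in nhds z. pt (vector [X w, Y w, 1]) = P w"
    using eventually_nhds_not_L[OF False] by eventually_elim (simp add: P_def)
  ultimately show ?thesis by (rule hol_at_transform)
next
  case True
  have mero: "(\<lambda>w. w ^ 2 * X w) meromorphic_on {0}" "(\<lambda>w. w ^ 3 * Y w) meromorphic_on {0}"
    by (intro meromorphic_intros ell_meromorphic ell_X ell_Y)+
  obtain g2 where g2: "g2 analytic_on {0}" "g2 0 = 1" "\<forall>\<^sub>F w in at 0. w ^ 2 * X w = g2 w"
    by (rule analytic_extension[OF mero(1) X_pole])
  obtain g3 where g3: "g3 analytic_on {0}" "g3 0 = - 1" "\<forall>\<^sub>F w in at 0. w ^ 3 * Y w = g3 w"
    by (rule analytic_extension[OF mero(2) Y_pole])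
  define B where "B w = (vector [w * g2 w, g3 w, w ^ 3] :: complex ^ 3)" for w
  have "vec_analytic_at B 0"
    using g2(1) g3(1) by (auto simp: vec_analytic_at_def forall_3 B_def intro!: analytic_intros)
  moreover have B0: "B 0 \<noteq> 0" by (auto simp: B_def g3 vec_eq_iff forall_3)
  ultimately have "hol_at (\<lambda>w. pt (B w)) 0" by (rule hol_at_pt)
  moreover have "\<forall>\<^sub>F w in nhds 0. pt (B w) = P w"
  proof -
    have "\<forall>\<^sub>F w in at 0. w \<noteq> (0::complex)" by (simp add: eventually_at_filter)
    with g2(3) g3(3) eventually_not_L[of 0] have "\<forall>\<^sub>F w in at 0. pt (B w) = P w"
    proof eventually_elim
      case (elim w)
      have "B w = w ^ 3 *s vector [X w, Y w, 1]"
        by (simp add: B_def vec_eq_iff forall_3 power2_eq_square power3_eq_cube flip: elim(1,2))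
      then show ?case using elim by (simp add: P_def pt_scale)
    qed
    moreover have "pt (B 0) = P 0"
    proof -
      have "B 0 = (- 1) *s vector [0, 1, 0]" by (simp add: B_def g3 vec_eq_iff forall_3)
      moreover have "(vector [0, 1, 0] :: complex ^ 3) \<noteq> 0" by (auto simp: vec_eq_iff forall_3)
      ultimately have "pt (B 0) = pt (vector [0, 1, 0])" by (metis pt_scale neg_equal_0_iff_equal one_neq_zero)
      then show ?thesis by (simp add: P_def L_0)
    qed
    ultimately show ?thesis by (simp add: eventually_nhds_conv_at)
  qed
  ultimately have "hol_at P 0" by (rule hol_at_transform)
  then have "hol_at (\<lambda>w. P (w - z)) z" by (intro hol_at_compose[of P "\<lambda>w. w - z"]) (auto intro!: analytic_intros)
  moreover have "P (w - z) = P w" for w using P_periodic[of "- z" w] True by simp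
  ultimately show ?thesis by simp
qed

text \<open>For surjectivity, every first coordinate is a value of \<open>X\<close>, and replacing
  \<open>z\<close> by \<open>- z\<close> adjusts the sign of \<open>Y\<close>.\<close>

lemma range_P: "range P = weierstrass_curve a b"
proof (intro set_eqI iffI)
  fix p assume "p \<in> range P"
  then obtain z where z: "p = P z" by blast
  show "p \<in> weierstrass_curve a b"
  proof (cases "z \<in> L")
    case True
    have "(vector [0, 1, 0] :: complex ^ 3) \<noteq> 0" by (auto simp: vec_eq_iff forall_3)
    then show ?thesis unfolding weierstrass_curve_def z P_def using True
      by (auto intro!: exI[of _ "vector [0, 1, 0]"])
  next
    case False
    then show ?thesis unfolding weierstrass_curve_def z P_def using equation[OF False]
      by (auto intro!: exI[of _ "vector [X z, Y z, 1]"])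
  qed
next
  fix p assume "p \<in> weierstrass_curve a b"
  then obtain v :: "complex ^ 3" where v: "p = pt v" "v \<noteq> 0"
    "(v $ 2)\<^sup>2 * v $ 3 = (v $ 1) ^ 3 + a * v $ 1 * (v $ 3)\<^sup>2 + b * (v $ 3) ^ 3"
    by (auto simp: weierstrass_curve_def)
  show "p \<in> range P"
  proof (cases "v $ 3 = 0")
    case True
    then have "v $ 1 = 0" using v(3) by simp
    then have "v = v $ 2 *s vector [0, 1, 0]" "v $ 2 \<noteq> 0"
      using True v(2) by (auto simp: vec_eq_iff forall_3)
    moreover have "(vector [0, 1, 0] :: complex ^ 3) \<noteq> 0" by (auto simp: vec_eq_iff forall_3)
    ultimately have "p = P 0" unfolding v(1) P_def by (metis L_0 pt_scale)
    then show ?thesis by blast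
  next
    case False
    define x where "x = v $ 1 / v $ 3"
    define y where "y = v $ 2 / v $ 3"
    have vxy: "v = v $ 3 *s vector [x, y, 1]" using False by (auto simp: vec_eq_iff forall_3 x_def y_def)
    have xy: "y ^ 2 = x ^ 3 + a * x + b"
      using v(3) False by (simp add: x_def y_def field_simps power2_eq_square power3_eq_cube)
    obtain z where z: "z \<notin> L" "X z = x" using X_surj by blast
    then have "Y z ^ 2 = y ^ 2" using equation xy by simp
    then consider "Y z = y" | "Y z = - y" by (auto simp: power2_eq_iff)
    then obtain z' where "z' \<notin> L" "X z' = x" "Y z' = y"
    proof cases
      case 1
      then show thesis using that[of z] z by blast
    next
      case 2
      then show thesis using that[of "- z"] z by (simp add: X_even Y_odd)
    qed
    then have "P z' = pt (vector [x, y, 1])" by (simp add: P_def)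
    also have "\<dots> = p" using vxy False unfolding v(1) by (metis pt_scale vector3_nonzero)
    finally show ?thesis by blast
  qed
qed

end

section \<open>Holomorphic maps from the torus as morphisms of the curve\<close>

lemma hom_poly_tendsto:
  fixes G :: "complex ^ 'n::finite \<Rightarrow> complex"
  assumes "hom_poly d G" "(A \<longlongrightarrow> v) F"
  shows "((\<lambda>w. G (A w)) \<longlongrightarrow> G v) F"
proof -
  obtain c where c: "\<And>v. G v = (\<Sum>\<alpha> | (\<Sum>i\<in>UNIV. \<alpha> i) = d. c \<alpha> * (\<Prod>i\<in>UNIV. (v $ i) ^ \<alpha> i))"
    using assms(1) unfolding hom_poly_def by blast
  show ?thesis unfolding c by (intro tendsto_intros tendsto_vec_nth assms(2))
qed

context weierstrass
begin

text \<open>\<open>X - X p\<close> also vanishes at \<open>- p\<close>; if \<open>z0\<close> lies in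
  that fibre, \<open>Y - Y p\<close> separates the two points instead.\<close>

lemma separating_function:
  assumes "p \<notin> L" "p - z0 \<notin> L"
  obtains l m c where "ell l" "\<forall>z. z \<notin> L \<longrightarrow> l analytic_on {z}" "l p = 0" "c \<noteq> 0"
    "((\<lambda>w. w ^ m * l w) \<longlongrightarrow> c) (at 0)" "z0 \<notin> L \<longrightarrow> l z0 \<noteq> 0"
proof (cases "z0 \<notin> L \<and> X z0 = X p")
  case False
  show thesis
  proof (rule that[of "\<lambda>w. X w - X p" 1 2])
    show "ell (\<lambda>w. X w - X p)" by (intro ell_diff ell_X ell_const)
    show "\<forall>z. z \<notin> L \<longrightarrow> (\<lambda>w. X w - X p) analytic_on {z}" by (auto intro!: analytic_intros X_an)
  qed (use X_shift_pole False in auto)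
next
  case True
  have "Y z0 \<noteq> Y p"
  proof
    assume "Y z0 = Y p"
    then have "p - z0 \<in> L" using XY_injective[of p z0] True assms(1) by simp
    with assms(2) show False by simp
  qed
  show thesis
  proof (rule that[of "\<lambda>w. Y w - Y p" "- 1" 3])
    show "ell (\<lambda>w. Y w - Y p)" by (intro ell_diff ell_Y ell_const)
    show "\<forall>z. z \<notin> L \<longrightarrow> (\<lambda>w. Y w - Y p) analytic_on {z}" by (auto intro!: analytic_intros Y_an)
    have "((\<lambda>w. w ^ 3 * Y w - w ^ 3 * Y p) \<longlongrightarrow> - 1 - 0 ^ 3 * Y p) (at 0)"
      by (intro tendsto_intros Y_pole)
    then show "((\<lambda>w. w ^ 3 * (Y w - Y p)) \<longlongrightarrow> - 1) (at 0)" by (simp add: right_diff_distrib)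
  qed (use \<open>Y z0 \<noteq> Y p\<close> in auto)
qed

text \<open>A product of separating functions with zeros of sufficient order at the points of
  \<open>B\<close>. Its pole order at 0 is exactly \<open>3 * M\<close>, the largest that a form of
  degree \<open>M\<close> can have; this exactness yields a form that does not vanish at
  infinity.\<close>

lemma clearing_function:
  assumes B: "finite B" "\<And>p. p \<in> B \<Longrightarrow> p \<notin> L \<and> p - z0 \<notin> L"
  obtains Q M c where "ell Q" "\<forall>z. z \<notin> L \<longrightarrow> Q analytic_on {z}" "c \<noteq> 0"
    "((\<lambda>w. w ^ (3 * M) * Q w) \<longlongrightarrow> c) (at 0)" "z0 \<notin> L \<longrightarrow> Q z0 \<noteq> 0"
    "\<forall>p\<in>B. fin_at (\<lambda>w. Q w / (w - p) ^ N p) p"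
proof -
  have "\<forall>p\<in>B. \<exists>l m c. ell l \<and> (\<forall>z. z \<notin> L \<longrightarrow> l analytic_on {z}) \<and> l p = 0 \<and> c \<noteq> 0 \<and>
    ((\<lambda>w. w ^ m * l w) \<longlongrightarrow> c) (at 0) \<and> (z0 \<notin> L \<longrightarrow> l z0 \<noteq> 0)"
  proof
    fix p assume "p \<in> B"
    then have "p \<notin> L" "p - z0 \<notin> L" using B(2) by blast+
    then show "\<exists>l m c. ell l \<and> (\<forall>z. z \<notin> L \<longrightarrow> l analytic_on {z}) \<and> l p = 0 \<and> c \<noteq> 0 \<and>
      ((\<lambda>w. w ^ m * l w) \<longlongrightarrow> c) (at 0) \<and> (z0 \<notin> L \<longrightarrow> l z0 \<noteq> 0)"
      by (rule separating_function) blast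
  qed
  then obtain l m c where l: "\<And>p. p \<in> B \<Longrightarrow> ell (l p)"
    "\<And>p z. p \<in> B \<Longrightarrow> z \<notin> L \<Longrightarrow> l p analytic_on {z}" "\<And>p. p \<in> B \<Longrightarrow> l p p = 0"
    "\<And>p. p \<in> B \<Longrightarrow> c p \<noteq> 0" "\<And>p. p \<in> B \<Longrightarrow> ((\<lambda>w. w ^ m p * l p w) \<longlongrightarrow> c p) (at 0)"
    "\<And>p. p \<in> B \<Longrightarrow> z0 \<notin> L \<Longrightarrow> l p z0 \<noteq> 0"
    unfolding bchoice_iff by blast
  \<comment> \<open>The separating functions contribute pole order \<open>M\<close> in total, and
    the factor \<open>(X w - e) ^ M\<close> adds \<open>2 * M\<close>. The choice of
    \<open>e\<close> keeps that factor nonzero at \<open>z0\<close>.\<close>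
  define M where "M = (\<Sum>p\<in>B. m p * N p)"
  define e where "e = X z0 + 1"
  define Q where "Q w = (\<Prod>p\<in>B. l p w ^ N p) * (X w - e) ^ M" for w
  show thesis
  proof (rule that[of Q "\<Prod>p\<in>B. c p ^ N p" M])
    show "ell Q" unfolding Q_def[abs_def]
      by (intro ell_mult ell_prod ell_power ell_diff ell_X ell_const l(1))
    show "\<forall>z. z \<notin> L \<longrightarrow> Q analytic_on {z}"
      unfolding Q_def using l(2) by (auto intro!: analytic_intros X_an)
    show "(\<Prod>p\<in>B. c p ^ N p) \<noteq> 0" using l(4) B(1) by simp
    have "((\<lambda>w. (\<Prod>p\<in>B. (w ^ m p * l p w) ^ N p) * (w ^ 2 * (X w - e)) ^ M) \<longlongrightarrow>
        (\<Prod>p\<in>B. c p ^ N p) * 1 ^ M) (at 0)"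
      by (intro tendsto_intros l(5) X_shift_pole)
    moreover have "(\<Prod>p\<in>B. (w ^ m p * l p w) ^ N p) * (w ^ 2 * (X w - e)) ^ M = w ^ (3 * M) * Q w" for w
    proof -
      have "(\<Prod>p\<in>B. (w ^ m p * l p w) ^ N p) = w ^ M * (\<Prod>p\<in>B. l p w ^ N p)"
        by (simp add: power_mult_distrib prod.distrib M_def power_sum flip: power_mult)
      moreover have "w ^ (3 * M) = w ^ M * (w ^ 2) ^ M"
        by (simp flip: power_mult power_add)
      ultimately show ?thesis by (simp add: Q_def power_mult_distrib)
    qed
    ultimately show "((\<lambda>w. w ^ (3 * M) * Q w) \<longlongrightarrow> (\<Prod>p\<in>B. c p ^ N p)) (at 0)" by simp
    show "z0 \<notin> L \<longrightarrow> Q z0 \<noteq> 0" using l(6) B(1) by (simp add: Q_def e_def)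
    show "\<forall>p\<in>B. fin_at (\<lambda>w. Q w / (w - p) ^ N p) p"
    proof
      fix p assume p: "p \<in> B"
      then have pL: "p \<notin> L" using B(2) by blast
      define R where "R w = (\<Prod>s\<in>B - {p}. l s w ^ N s) * (X w - e) ^ M" for w
      have "R analytic_on {p}" unfolding R_def using l(2) pL by (auto intro!: analytic_intros X_an)
      then have "fin_at R p" by (rule fin_at_analytic)
      moreover have "fin_at (\<lambda>w. (l p w / (w - p)) ^ N p) p"
      proof -
        have "(l p has_field_derivative deriv (l p) p) (at p)"
          using analytic_on_imp_differentiable_at[OF l(2)[OF p pL]] by (simp add: DERIV_deriv_iff_field_differentiable)
        then have "((\<lambda>w. l p w / (w - p)) \<longlongrightarrow> deriv (l p) p) (at p)"
          using l(3)[OF p] by (simp add: has_field_derivative_iff)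
        from tendsto_power[OF this, of "N p"] show ?thesis unfolding fin_at_def by blast
      qed
      ultimately have "fin_at (\<lambda>w. (l p w / (w - p)) ^ N p * R w) p" by (rule fin_at_mult[rotated])
      moreover have "(l p w / (w - p)) ^ N p * R w = Q w / (w - p) ^ N p" for w
        using B(1) p by (simp add: Q_def R_def prod.remove[of B p] power_divide)
      ultimately show "fin_at (\<lambda>w. Q w / (w - p) ^ N p) p" by simp
    qed
  qed
qed

text \<open>The ratios of the coordinates of \<open>\<Phi>\<close> to one that is nonzero at
  \<open>z0\<close> are elliptic. Multiplied by a common \<open>Q\<close> they have poles only in
  \<open>L\<close>, hence become forms of a common degree; the \<open>j\<close>-th one comes from
  \<open>Q\<close> itself and is made nonzero at \<open>P z0\<close>.\<close>

lemma local_forms: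
  fixes \<Phi> :: "complex \<Rightarrow> 'm::finite cproj"
  assumes hol: "\<And>z. hol_at \<Phi> z" and per: "\<And>z t. t \<in> L \<Longrightarrow> \<Phi> (z + t) = \<Phi> z"
  obtains j D Q and G :: "'m \<Rightarrow> complex ^ 3 \<Rightarrow> complex" where "\<forall>i. hom_poly D (G i)"
    "\<forall>z. \<forall>\<^sub>F w in at z. rep (\<Phi> w) $ j \<noteq> 0 \<and>
      (\<forall>i. G i (vector [X w, Y w, 1]) * rep (\<Phi> w) $ j = Q w * rep (\<Phi> w) $ i)"
    "\<exists>v. v \<noteq> 0 \<and> pt v = P z0 \<and> G j v \<noteq> 0"
proof -
  obtain j where j: "rep (\<Phi> z0) $ j \<noteq> 0" using rep_nonzero[of "\<Phi> z0"] by (auto simp: vec_eq_iff)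
  define h where "h i w = ratio (axis i 1) (axis j 1) (\<Phi> w)" for i w
  have h_rep: "h i w = rep (\<Phi> w) $ i / rep (\<Phi> w) $ j" for i w by (simp add: h_def ratio_def)
  have h: "ell (h i)" for i
    unfolding ell_def h_def using per[OF L_1] per[OF L_tau] by (auto intro: ratio_meromorphic hol)
  define B where "B = {z. rep (\<Phi> z) $ j = 0}"
  have h_an: "h i analytic_on {z}" if "z \<notin> B" for i z
    unfolding h_def using that by (intro ratio_analytic hol) (simp add: B_def)
  have z0B: "z0 \<notin> B" using j by (simp add: B_def)
  have B_per: "z + t \<in> B \<longleftrightarrow> z \<in> B" if "t \<in> L" for z t using per[OF that] by (simp add: B_def)
  have B_avoid: "\<forall>\<^sub>F w in at z. w \<notin> B" for z
  proof -
    have "h j meromorphic_on UNIV"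
      using ell_meromorphic[OF h] by (subst meromorphic_on_meromorphic_at) blast
    then consider "\<forall>\<^sub>F w in cosparse UNIV. h j w = 0" | "\<forall>\<^sub>F w in cosparse UNIV. h j w \<noteq> 0"
      using meromorphic_imp_constant_or_avoid[of "h j" UNIV 0] by auto
    then show ?thesis
    proof cases
      case 1
      then have "\<forall>\<^sub>F w in at z0. h j w = 0" by (rule eventually_cosparse_imp_eventually_at) simp
      then have "h j z0 = 0" by (rule analytic_eq_eventual_constant[OF h_an[OF z0B]])
      then show ?thesis using j by (simp add: h_rep)
    next
      case 2
      then have "\<forall>\<^sub>F w in at z. h j w \<noteq> 0" by (rule eventually_cosparse_imp_eventually_at) simp
      then show ?thesis by eventually_elim (auto simp: B_def h_rep)
    qed
  qed
  \<comment> \<open>Representatives of the possible poles off the lattice; there are finitely many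
    because \<open>B\<close> has no limit point in the compact rectangle.\<close>
  define B0 where "B0 = cbox 0 (Complex 1 (Im \<tau>)) \<inter> B - L"
  have "finite (cbox 0 (Complex 1 (Im \<tau>)) \<inter> B)"
    by (rule finite_not_islimpt_in_compact) (use B_avoid in \<open>auto simp: islimpt_iff_eventually\<close>)
  then have finB: "finite B0" by (simp add: B0_def)
  have B0: "p \<notin> L \<and> p - z0 \<notin> L" if "p \<in> B0" for p
  proof -
    have "p - z0 \<notin> L"
    proof
      assume "p - z0 \<in> L"
      from B_per[OF this, of z0] have "p \<notin> B" using z0B by simp
      then show False using that by (simp add: B0_def)
    qed
    then show ?thesis using that by (simp add: B0_def)
  qed
  have "\<exists>n. fin_at (\<lambda>w. (w - p) ^ n * h i w) p" for p i
    by (rule meromorphic_times_power_tendsto[OF ell_meromorphic[OF h]]) (auto simp: fin_at_def)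
  then obtain n where n: "\<And>p i. fin_at (\<lambda>w. (w - p) ^ n p i * h i w) p" by metis
  \<comment> \<open>One exponent that works for all components at once.\<close>
  define N where "N p = (\<Sum>i\<in>UNIV. n p i)" for p
  have N: "fin_at (\<lambda>w. (w - p) ^ N p * h i w) p" for p i
  proof -
    define k where "k = (\<Sum>i\<in>UNIV - {i}. n p i)"
    have "N p = k + n p i" by (simp add: N_def k_def sum.remove[of UNIV i])
    moreover have "fin_at (\<lambda>w. (w - p) ^ k) p" by (intro fin_at_analytic analytic_intros)
    from fin_at_mult[OF this n] have "fin_at (\<lambda>w. (w - p) ^ k * ((w - p) ^ n p i * h i w)) p" .
    ultimately show ?thesis by (simp add: power_add mult.assoc)
  qed
  obtain Q M c where Q: "ell Q" "\<forall>z. z \<notin> L \<longrightarrow> Q analytic_on {z}" "c \<noteq> 0"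
    "((\<lambda>w. w ^ (3 * M) * Q w) \<longlongrightarrow> c) (at 0)" "z0 \<notin> L \<longrightarrow> Q z0 \<noteq> 0"
    "\<forall>p\<in>B0. fin_at (\<lambda>w. Q w / (w - p) ^ N p) p"
    by (rule clearing_function[OF finB B0])
  define k where "k i w = Q w * h i w" for i w
  have k: "ell (k i)" for i unfolding k_def[abs_def] by (intro ell_mult Q(1) h)
  have k_fin: "fin_at (k i) z" if z: "z \<notin> L" for i z
  proof (cases "z \<in> B")
    case False
    then show ?thesis unfolding k_def using Q(2) z
      by (intro fin_at_analytic analytic_intros h_an) auto
  next
    case True
    obtain p where p: "p \<in> cbox 0 (Complex 1 (Im \<tau>))" "z - p \<in> L" using fundamental_domain by blast
    have "p \<notin> L" using z L_add_iff[OF p(2), of p] by simp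
    moreover have "p \<in> B" using True B_per[OF p(2), of p] by simp
    ultimately have pB: "p \<in> B0" using p(1) by (simp add: B0_def)
    from fin_at_mult[OF Q(6)[rule_format, OF pB] N]
    have "fin_at (\<lambda>w. Q w / (w - p) ^ N p * ((w - p) ^ N p * h i w)) p" .
    moreover have "\<forall>\<^sub>F w in at p. Q w / (w - p) ^ N p * ((w - p) ^ N p * h i w) = k i w"
      unfolding eventually_at_filter by (auto simp: k_def)
    ultimately have "fin_at (k i) p" by (rule fin_at_transform)
    from ell_fin_at_shift[OF k p(2) this] show ?thesis by simp
  qed
  \<comment> \<open>For \<open>z0\<close> in \<open>L\<close> the degree is taken to be
    \<open>M\<close>, since then the pole order of \<open>Q\<close> is \<open>3 * D\<close> and the
    \<open>j\<close>-th form is nonzero at infinity. Otherwise any degree large enough will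
    do.\<close>
  have "\<exists>D. (\<forall>i. form D (k i)) \<and> (z0 \<in> L \<longrightarrow> D = M)"
  proof (cases "z0 \<in> L")
    case True
    have 0: "0 \<notin> B" using B_per[OF True, of 0] z0B by simp
    have "form M (k i)" for i
    proof (rule form_of_pole_order[OF k k_fin])
      have "((\<lambda>w. w ^ (3 * M) * Q w * h i w) \<longlongrightarrow> c * h i 0) (at 0)"
        by (intro tendsto_mult Q(4) isContD analytic_at_imp_isCont h_an 0)
      then show "((\<lambda>w. w ^ (3 * M) * k i w) \<longlongrightarrow> c * h i 0) (at 0)" by (simp add: k_def mult.assoc)
    qed simp_all
    then show ?thesis by blast
  next
    case False
    have "\<exists>n c. ((\<lambda>w. (w - 0) ^ n * k i w) \<longlongrightarrow> c) (at 0)" for i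
      by (rule meromorphic_times_power_tendsto[OF ell_meromorphic[OF k]]) blast
    then have "\<exists>n c. ((\<lambda>w. w ^ n * k i w) \<longlongrightarrow> c) (at 0)" for i by simp
    then obtain n c where nc: "\<And>i. ((\<lambda>w. w ^ n i * k i w) \<longlongrightarrow> c i) (at 0)" by metis
    have "form (\<Sum>i\<in>UNIV. n i) (k i)" for i
    proof (rule form_of_pole_order[OF k k_fin nc])
      have "n i \<le> (\<Sum>i\<in>UNIV. n i)" by (rule member_le_sum) auto
      then show "n i \<le> 3 * (\<Sum>i\<in>UNIV. n i)" by linarith
    qed
    then show ?thesis using False by blast
  qed
  then obtain D where D: "\<forall>i. form D (k i)" "z0 \<in> L \<longrightarrow> D = M" by blast
  then obtain G :: "'m \<Rightarrow> complex ^ 3 \<Rightarrow> complex" where G: "\<And>i. hom_poly D (G i)"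
    "\<And>i z. \<forall>\<^sub>F w in at z. k i w = G i (vector [X w, Y w, 1])"
    unfolding form_def by metis
  have hj: "\<forall>\<^sub>F w in at z. k j w = Q w" for z
    using B_avoid[of z] by eventually_elim (simp add: k_def h_rep B_def)
  show thesis
  proof (rule that[of D G j Q])
    show "\<forall>i. hom_poly D (G i)" using G(1) by blast
    have "\<forall>\<^sub>F w in at z. \<forall>i. k i w = G i (vector [X w, Y w, 1])" for z
      using G(2) by (simp add: eventually_all_finite)
    then have "\<forall>\<^sub>F w in at z. rep (\<Phi> w) $ j \<noteq> 0 \<and>
        (\<forall>i. G i (vector [X w, Y w, 1]) * rep (\<Phi> w) $ j = Q w * rep (\<Phi> w) $ i)" for z
      using B_avoid[of z]
    proof (rule eventually_elim2)
      fix w assume w: "\<forall>i. k i w = G i (vector [X w, Y w, 1])" "w \<notin> B"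
      then have "rep (\<Phi> w) $ j \<noteq> 0" by (simp add: B_def)
      moreover have "G i (vector [X w, Y w, 1]) = Q w * (rep (\<Phi> w) $ i / rep (\<Phi> w) $ j)" for i
        using w(1) by (simp add: k_def h_rep flip: w(1))
      ultimately show "rep (\<Phi> w) $ j \<noteq> 0 \<and>
        (\<forall>i. G i (vector [X w, Y w, 1]) * rep (\<Phi> w) $ j = Q w * rep (\<Phi> w) $ i)" by simp
    qed
    then show "\<forall>z. \<forall>\<^sub>F w in at z. rep (\<Phi> w) $ j \<noteq> 0 \<and>
        (\<forall>i. G i (vector [X w, Y w, 1]) * rep (\<Phi> w) $ j = Q w * rep (\<Phi> w) $ i)" by blast
    show "\<exists>v. v \<noteq> 0 \<and> pt v = P z0 \<and> G j v \<noteq> 0"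
    proof (cases "z0 \<in> L")
      case False
      have "vec_analytic_at (\<lambda>w. vector [X w, Y w, 1] :: complex ^ 3) z0"
        using X_an[OF False] Y_an[OF False] by (simp add: vec_analytic_at_def forall_3)
      from analytic_on_hom_poly[OF G(1) this]
      have "((\<lambda>w. G j (vector [X w, Y w, 1])) \<longlongrightarrow> G j (vector [X z0, Y z0, 1])) (at z0)"
        by (intro isContD analytic_at_imp_isCont)
      moreover have "\<forall>\<^sub>F w in at z0. G j (vector [X w, Y w, 1]) = Q w"
        using hj[of z0] G(2)[where i = j and z = z0] by eventually_elim simp
      ultimately have "(Q \<longlongrightarrow> G j (vector [X z0, Y z0, 1])) (at z0)" by (rule Lim_transform_eventually)
      moreover have "(Q \<longlongrightarrow> Q z0) (at z0)"
        using Q(2) False by (intro isContD analytic_at_imp_isCont) blast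
      ultimately have "G j (vector [X z0, Y z0, 1]) = Q z0" by (intro tendsto_unique[of "at z0"]) auto
      then show ?thesis using Q(5) False by (intro exI[of _ "vector [X z0, Y z0, 1]"]) (simp add: P_def)
    next
      case True
      then have DM: "D = M" using D(2) by blast
      \<comment> \<open>\<open>w ^ 3\<close> times \<open>[X w, Y w, 1]\<close>, written so that its
        limit, a vector over the point at infinity, is visible; homogeneity turns
        \<open>G j (A w)\<close> into \<open>w ^ (3 * M) * Q w\<close>, whose limit is
        \<open>c\<close>.\<close>
      define A where "A w = (vector [w * (w ^ 2 * X w), w ^ 3 * Y w, w ^ 3] :: complex ^ 3)" for w
      have A: "A w = w ^ 3 *s vector [X w, Y w, 1]" for w
        by (simp add: A_def vec_eq_iff forall_3 power2_eq_square power3_eq_cube)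
      have "((\<lambda>w. A w $ i) \<longlongrightarrow> (vector [0, - 1, 0] :: complex ^ 3) $ i) (at 0)" for i
      proof -
        have "((\<lambda>w. w * (w ^ 2 * X w)) \<longlongrightarrow> 0 * 1) (at 0)" by (intro tendsto_intros X_pole)
        moreover have "((\<lambda>w. w ^ 3) \<longlongrightarrow> 0 ^ 3) (at (0::complex))" by (intro tendsto_intros)
        ultimately have "\<forall>i. ((\<lambda>w. A w $ i) \<longlongrightarrow> (vector [0, - 1, 0] :: complex ^ 3) $ i) (at 0)"
          using Y_pole by (simp add: A_def forall_3)
        then show ?thesis ..
      qed
      then have "(A \<longlongrightarrow> vector [0, - 1, 0]) (at 0)" by (rule vec_tendstoI)
      then have "((\<lambda>w. G j (A w)) \<longlongrightarrow> G j (vector [0, - 1, 0])) (at 0)"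
        by (rule hom_poly_tendsto[OF G(1)])
      moreover have "\<forall>\<^sub>F w in at 0. G j (A w) = w ^ (3 * M) * Q w"
        using hj[of 0] G(2)[where i = j and z = 0]
        by eventually_elim (simp add: A hom_poly_scale[OF G(1)] DM power_mult)
      ultimately have "((\<lambda>w. w ^ (3 * M) * Q w) \<longlongrightarrow> G j (vector [0, - 1, 0])) (at 0)"
        by (rule Lim_transform_eventually)
      then have "G j (vector [0, - 1, 0]) = c" using Q(4) by (intro tendsto_unique[of "at 0"]) auto
      moreover have nz: "(vector [0, 1, 0] :: complex ^ 3) \<noteq> 0" by (auto simp: vec_eq_iff forall_3)
      moreover have eq: "(vector [0, - 1, 0] :: complex ^ 3) = (- 1) *s vector [0, 1, 0]"
        by (simp add: vec_eq_iff forall_3)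
      have "pt (vector [0, - 1, 0]) = pt (vector [0, 1, 0] :: complex ^ 3)"
        unfolding eq by (rule pt_scale[OF nz]) simp
      moreover have "(vector [0, - 1, 0] :: complex ^ 3) \<noteq> 0" by (auto simp: vec_eq_iff forall_3)
      ultimately show ?thesis using Q(3) True by (intro exI[of _ "vector [0, - 1, 0]"]) (simp add: P_def)
    qed
  qed
qed

text \<open>\<open>local_forms\<close> supplies polynomials for each point of the curve. That they
  represent \<open>\<pi>\<close> wherever they do not all vanish follows on punctured neighbourhoods
  from proportionality of coordinates, and at the point itself by continuation.\<close>

theorem factor_through_P:
  fixes \<Phi> :: "complex \<Rightarrow> 'm::finite cproj"
  assumes hol: "\<And>z. hol_at \<Phi> z" and per: "\<And>z t. t \<in> L \<Longrightarrow> \<Phi> (z + t) = \<Phi> z"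
  obtains \<pi> where "morphism (range P) UNIV \<pi>" "\<forall>z. \<pi> (P z) = \<Phi> z"
proof -
  define \<pi> where "\<pi> p = \<Phi> (SOME z. P z = p)" for p
  have \<pi>: "\<pi> (P z) = \<Phi> z" for z
  proof -
    have "P (SOME w. P w = P z) = P z" by (rule someI[of _ z]) simp
    then have "(SOME w. P w = P z) - z \<in> L" by (simp add: P_eq_iff)
    from per[OF this, of z] show ?thesis by (simp add: \<pi>_def)
  qed
  have "\<exists>d (F :: complex ^ 3 \<Rightarrow> complex ^ 'm). (\<forall>j. hom_poly d (\<lambda>v. F v $ j)) \<and>
        (\<exists>v. v \<noteq> 0 \<and> pt v = x \<and> F v \<noteq> 0) \<and>
        (\<forall>v. v \<noteq> 0 \<and> pt v \<in> range P \<and> F v \<noteq> 0 \<longrightarrow> \<pi> (pt v) = pt (F v))"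
    if "x \<in> range P" for x
  proof -
    obtain z0 where z0: "x = P z0" using \<open>x \<in> range P\<close> by blast
    obtain j D Q and G :: "'m \<Rightarrow> complex ^ 3 \<Rightarrow> complex" where G: "\<forall>i. hom_poly D (G i)"
      and rel: "\<forall>z. \<forall>\<^sub>F w in at z. rep (\<Phi> w) $ j \<noteq> 0 \<and>
        (\<forall>i. G i (vector [X w, Y w, 1]) * rep (\<Phi> w) $ j = Q w * rep (\<Phi> w) $ i)"
      and ex: "\<exists>v. v \<noteq> 0 \<and> pt v = P z0 \<and> G j v \<noteq> 0"
      by (rule local_forms[OF hol per])
    define F where "F v = (\<chi> i. G i v)" for v
    have F_hom: "hom_poly D (\<lambda>v. F v $ i)" for i using G by (simp add: F_def)
    have F_scale: "F (c *s v) = c ^ D *s F v" for c v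
      using hom_poly_scale[OF F_hom] by (simp add: vec_eq_iff)
    have "\<pi> (pt v) = pt (F v)" if v: "v \<noteq> 0" "pt v \<in> range P" "F v \<noteq> 0" for v
    proof -
      obtain z where z: "pt v = P z" using v(2) by blast
      obtain B where B: "vec_analytic_at B z" "B z \<noteq> 0" "P z = pt (B z)"
          "\<forall>\<^sub>F w in nhds z. B w \<noteq> 0 \<and> P w = pt (B w)"
        using hol_at_P by (rule hol_atE)
      have "pt v = pt (B z)" using z B(3) by simp
      then obtain c where c: "c \<noteq> 0" "v = c *s B z" using pt_eq_iff[OF v(1) B(2)] by blast
      have FB: "F (B z) \<noteq> 0" using v(3) c by (auto simp: F_scale)
      have an: "vec_analytic_at (\<lambda>w. F (B w)) z"
        using analytic_on_hom_poly[OF F_hom B(1)] by (simp add: vec_analytic_at_def)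
      have "\<forall>\<^sub>F w in at z. F (B w) \<noteq> 0"
        by (rule eventually_nhds_imp_at[OF vec_analytic_at_nonzero[OF an FB]])
      moreover note eventually_nhds_imp_at[OF B(4)] eventually_not_L[of z] rel[rule_format, of z]
      ultimately have "\<forall>\<^sub>F w in at z. \<Phi> w = pt (F (B w))"
      proof eventually_elim
        case (elim w)
        define r where "r = rep (\<Phi> w)"
        have r: "r \<noteq> 0" "pt r = \<Phi> w" by (simp_all add: r_def rep_nonzero)
        have "pt (B w) = pt (vector [X w, Y w, 1])" using elim by (simp add: P_def)
        then obtain c' where c': "c' \<noteq> 0" "B w = c' *s vector [X w, Y w, 1]"
          using pt_eq_iff[of "B w" "vector [X w, Y w, 1]"] elim by auto
        define s where "s = c' ^ D * Q w"
        have FB': "F (B w) $ i * r $ j = s * r $ i" for i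
          unfolding c'(2) F_scale s_def using elim by (simp add: F_def r_def mult.assoc)
        have "r $ i * F (B w) $ k = r $ k * F (B w) $ i" for i k
        proof -
          have "r $ j * (r $ i * F (B w) $ k) = r $ j * (r $ k * F (B w) $ i)"
            using FB'[of i] FB'[of k] by algebra
          then show ?thesis using elim by (simp add: r_def)
        qed
        then have "pt r = pt (F (B w))" using r(1) elim(1) by (simp add: pt_eq_iff_minors)
        then show ?case by (simp add: r(2))
      qed
      then have "\<Phi> z = pt (F (B z))"
        by (rule hol_at_eq_extend[OF hol hol_at_pt[OF an FB]])
      also have "\<dots> = pt (F v)" using c FB by (simp add: F_scale pt_scale)
      finally show ?thesis using \<pi> z by simp
    qed
    moreover have "\<exists>v. v \<noteq> 0 \<and> pt v = x \<and> F v \<noteq> 0"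
      using ex by (auto simp: z0 F_def vec_eq_iff)
    ultimately show ?thesis using F_hom by blast
  qed
  then have "morphism (range P) UNIV \<pi>" unfolding morphism_def by simp
  then show thesis using \<pi> that by blast
qed

text \<open>The factorization is used twice: for \<open>\<Psi>\<close> it yields
  \<open>\<pi>\<close>, and for \<open>z \<mapsto> P (\<mu> * z)\<close>, periodic because \<mu>
  preserves \<open>L\<close>, it yields \<open>g\<close>.\<close>

lemma lattes_of_periodic:
  fixes \<Psi> :: "complex \<Rightarrow> P1"
  assumes hol: "\<And>z. hol_at \<Psi> z" and per: "\<And>z t. t \<in> L \<Longrightarrow> \<Psi> (z + t) = \<Psi> z"
    and eq: "\<And>z. \<Psi> (\<mu> * z) = f (\<Psi> z)" and \<mu>: "\<And>t. t \<in> L \<Longrightarrow> \<mu> * t \<in> L"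
    and nc: "\<Psi> z1 \<noteq> \<Psi> z2"
  shows "lattes f"
proof -
  obtain \<pi> where \<pi>: "morphism (range P) UNIV \<pi>" "\<forall>z. \<pi> (P z) = \<Psi> z"
    by (rule factor_through_P[OF hol per])
  have "hol_at (\<lambda>z. P (\<mu> * z)) z" for z
    by (rule hol_at_compose[of P "\<lambda>z. \<mu> * z", OF hol_at_P]) (intro analytic_intros)
  moreover have "P (\<mu> * (z + t)) = P (\<mu> * z)" if "t \<in> L" for z t
    using P_periodic[OF \<mu>[OF that]] by (simp add: distrib_left)
  ultimately obtain g where g: "morphism (range P) UNIV g" "\<forall>z. g (P z) = P (\<mu> * z)"
    by (rule factor_through_P[of "\<lambda>z. P (\<mu> * z)"])
  have "elliptic_curve (range P)"
    unfolding elliptic_curve_def using discriminant range_P by blast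
  moreover have "morphism (range P) (range P) g"
    using g unfolding morphism_def by auto
  moreover have "\<not> \<pi> constant_on (range P)"
  proof
    assume "\<pi> constant_on (range P)"
    then obtain c where "\<And>z. \<pi> (P z) = c" by (auto simp: constant_on_def)
    then show False using nc \<pi>(2) by simp
  qed
  moreover have "f (\<pi> x) = \<pi> (g x)" if "x \<in> range P" for x
    using that \<pi>(2) g(2) eq by auto
  ultimately show ?thesis unfolding lattes_def using \<pi>(1) by blast
qed

end

section \<open>Periodic Poincare functions and exceptional maps\<close>

text \<open>Injectivity of \<open>\<Psi>\<close> near 0 makes the group \<open>T\<close> of periods
  discrete, and the functional equation shows that \<mu> preserves it. Rescaling by
  \<open>\<omega>\<close> normalizes the two possible shapes of \<open>T\<close>.\<close>

lemma exceptional_of_period: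
  fixes F :: "complex ^ 2 \<Rightarrow> complex ^ 2" and f :: "P1 \<Rightarrow> P1" and \<Psi> :: "complex \<Rightarrow> P1"
  assumes F: "\<And>j. hom_poly d (\<lambda>v. F v $ j)" "\<And>v. v \<noteq> 0 \<Longrightarrow> F v \<noteq> 0 \<and> f (pt v) = pt (F v)"
    and hol: "\<And>z. hol_at \<Psi> z" and eq: "\<And>z. \<Psi> (\<mu> * z) = f (\<Psi> z)" and \<mu>: "1 < norm \<mu>"
    and inj: "inj_on \<Psi> (ball 0 1)" and t0: "t0 \<noteq> 0" "\<And>z. \<Psi> (z + t0) = \<Psi> z"
  shows "exceptional f"
proof -
  define T where "T = {t. \<forall>z. \<Psi> (z + t) = \<Psi> z}"
  have sub: "s - t \<in> T" if "s \<in> T" "t \<in> T" for s t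
  proof -
    have "\<Psi> (z + (s - t)) = \<Psi> z" for z
    proof -
      have st: "\<forall>w. \<Psi> (w + s) = \<Psi> w" "\<forall>w. \<Psi> (w + t) = \<Psi> w"
        using that by (simp_all add: T_def)
      have "z + s = z + (s - t) + t" by simp
      then have "\<Psi> (z + s) = \<Psi> (z + (s - t))" using st(2) by (simp only:)
      then show ?thesis using st(1) by (simp only:)
    qed
    then show ?thesis by (simp add: T_def)
  qed
  have disc: "T \<inter> ball 0 1 \<subseteq> {0}"
  proof
    fix t assume t: "t \<in> T \<inter> ball 0 1"
    then have "\<forall>z. \<Psi> (z + t) = \<Psi> z" by (simp add: T_def)
    from spec[OF this, of 0] have "\<Psi> t = \<Psi> 0" by simp
    then have "t = 0" using t by (intro inj_onD[OF inj]) auto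
    then show "t \<in> {0}" by simp
  qed
  have \<mu>0: "\<mu> \<noteq> 0" using \<mu> by auto
  have \<mu>T: "\<mu> * t \<in> T" if "t \<in> T" for t
  proof -
    have "\<Psi> (z + \<mu> * t) = \<Psi> z" for z
    proof -
      have "\<Psi> (z + \<mu> * t) = \<Psi> (\<mu> * (z / \<mu> + t))" using \<mu>0 by (simp add: distrib_left)
      also have "\<dots> = f (\<Psi> (z / \<mu>))" using that by (simp add: eq T_def)
      also have "\<dots> = \<Psi> z" using \<mu>0 by (simp flip: eq)
      finally show ?thesis .
    qed
    then show ?thesis by (simp add: T_def)
  qed
  have t0T: "t0 \<in> T" using t0(2) by (simp add: T_def)
  have hol': "hol_at (\<lambda>z. \<Psi> (\<omega> * z)) z" for \<omega> z
    by (rule hol_at_compose[of \<Psi> "\<lambda>z. \<omega> * z", OF hol]) (intro analytic_intros)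
  have per': "(\<forall>z. \<Psi> (\<omega> * (z + t)) = \<Psi> (\<omega> * z)) \<longleftrightarrow> \<omega> * t \<in> T" if "\<omega> \<noteq> 0" for \<omega> t
  proof
    assume *: "\<forall>z. \<Psi> (\<omega> * (z + t)) = \<Psi> (\<omega> * z)"
    have "\<Psi> (z + \<omega> * t) = \<Psi> z" for z using *[rule_format, of "z / \<omega>"] that by (simp add: distrib_left)
    then show "\<omega> * t \<in> T" by (simp add: T_def)
  next
    assume "\<omega> * t \<in> T"
    then show "\<forall>z. \<Psi> (\<omega> * (z + t)) = \<Psi> (\<omega> * z)" by (simp add: T_def distrib_left)
  qed
  show ?thesis
  proof (rule discrete_subgroup_cases[OF sub zero_less_one disc t0T t0(1)])
    fix \<omega> assume cyclic: "\<omega> \<noteq> 0" "\<And>t. \<omega> * t \<in> T \<longleftrightarrow> t \<in> \<int>"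
    have "\<omega> * 1 \<in> T" using cyclic(2)[of 1] by simp
    \<comment> \<open>\<mu> times the generator \<open>\<omega>\<close> is again a period, hence an
      integral multiple of \<open>\<omega>\<close>.\<close>
    from \<mu>T[OF this] have "\<mu> \<in> \<int>" using cyclic(2)[of \<mu>] by (simp add: mult.commute)
    then obtain k where k: "\<mu> = of_int k" by (rule Ints_cases)
    have "\<bar>real_of_int k\<bar> > 1" using \<mu> k by simp
    then have k2: "\<bar>k\<bar> \<ge> 2" by linarith
    interpret singly_periodic F f d "\<lambda>z. \<Psi> (\<omega> * z)" k "1 / norm \<omega>"
    proof
      show "hom_poly d (\<lambda>v. F v $ j)" for j by (rule F(1))
      show "F v \<noteq> 0 \<and> f (pt v) = pt (F v)" if "v \<noteq> 0" for v using that by (rule F(2))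
      show "\<Psi> (\<omega> * (of_int k * z)) = f (\<Psi> (\<omega> * z))" for z
        using eq[of "\<omega> * z"] by (simp add: k mult.left_commute)
      show "inj_on (\<lambda>z. \<Psi> (\<omega> * z)) (ball 0 (1 / norm \<omega>))"
      proof (rule inj_onI)
        fix x y assume "x \<in> ball 0 (1 / norm \<omega>)" "y \<in> ball 0 (1 / norm \<omega>)" "\<Psi> (\<omega> * x) = \<Psi> (\<omega> * y)"
        then have "\<omega> * x = \<omega> * y"
          using cyclic(1) by (intro inj_onD[OF inj]) (auto simp: norm_mult field_simps)
        then show "x = y" using cyclic(1) by simp
      qed
      show "(\<forall>z. \<Psi> (\<omega> * (z + t)) = \<Psi> (\<omega> * z)) \<longleftrightarrow> t \<in> \<int>" for t
        using per'[OF cyclic(1)] cyclic(2) by simp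
    qed (use hol' k2 cyclic(1) in auto)
    show ?thesis using monomial by (simp add: exceptional_def)
  next
    fix \<omega> \<tau>
    assume lattice: "\<omega> \<noteq> 0" "Im \<tau> > 0"
      "\<And>t. \<omega> * t \<in> T \<longleftrightarrow> (\<exists>m n. t = of_int m + of_int n * \<tau>)"
    interpret period_lattice \<tau> by standard (rule lattice(2))
    obtain X Y a b where "weierstrass \<tau> X Y a b" by (rule weierstrass_exists)
    then interpret weierstrass \<tau> X Y a b .
    have LT: "\<omega> * t \<in> T \<longleftrightarrow> t \<in> L" for t using lattice(3) by (auto simp: L_def)
    have "lattes f"
    proof (rule lattes_of_periodic[where \<mu> = \<mu>])
      show "hol_at (\<lambda>z. \<Psi> (\<omega> * z)) z" for z by (rule hol')
      show "\<Psi> (\<omega> * (z + t)) = \<Psi> (\<omega> * z)" if "t \<in> L" for z t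
        using per'[OF lattice(1)] LT that by blast
      show "\<Psi> (\<omega> * (\<mu> * z)) = f (\<Psi> (\<omega> * z))" for z
        using eq[of "\<omega> * z"] by (simp add: mult.left_commute)
      show "\<mu> * t \<in> L" if "t \<in> L" for t
        using \<mu>T[of "\<omega> * t"] that by (simp add: mult.left_commute flip: LT)
      have "\<Psi> 0 \<noteq> \<Psi> (1 / 2)" using inj_onD[OF inj, of 0 "1 / 2"] by (auto simp: norm_divide)
      then show "\<Psi> (\<omega> * 0) \<noteq> \<Psi> (\<omega> * (1 / 2 / \<omega>))" using lattice(1) by simp
    qed
    then show ?thesis by (simp add: exceptional_def)
  qed
qed

theorem theorem2p11:
  fixes f :: "P1 \<Rightarrow> P1" and d :: nat and p :: P1 and \<mu> C :: complex
    and x q :: "nat \<Rightarrow> P1"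
  assumes "endomorphism_of_degree d f" and "d \<ge> 2"
    and "repelling_fixed_point f p" and "P1_deriv f p = \<mu>"
    and "homoclinic_orbit f p x" and "\<And>i. x i \<notin> critical_points f"
    and "C \<noteq> 0" and "adjoint_sequence f x q"
    and "\<forall>\<^sub>F i in sequentially. P1_deriv (f ^^ i) (q i) = C * \<mu> ^ i"
  shows "exceptional f"
proof -
  obtain F :: "complex ^ 2 \<Rightarrow> complex ^ 2" where F: "\<And>j. hom_poly d (\<lambda>v. F v $ j)"
      "\<And>v. v \<noteq> 0 \<Longrightarrow> F v \<noteq> 0 \<and> f (pt v) = pt (F v)"
    using assms(1) unfolding endomorphism_of_degree_def by blast
  have \<mu>: "1 < norm \<mu>" using assms(3,4) by (simp add: repelling_fixed_point_def)
  obtain \<Psi> t where \<Psi>: "\<forall>z. hol_at \<Psi> z" "\<forall>z. \<Psi> (\<mu> * z) = f (\<Psi> z)" "inj_on \<Psi> (ball 0 1)"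
    "t \<noteq> 0" "\<forall>z. \<Psi> (z + t) = \<Psi> z"
    by (rule homoclinic_period[OF F assms(5,4,7,8,9)])
  show ?thesis
    by (rule exceptional_of_period[OF F \<Psi>(1)[rule_format] \<Psi>(2)[rule_format] \<mu> \<Psi>(3,4) \<Psi>(5)[rule_format]])
qed

end
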